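(* Let $F:\mathrm{Br}_{Ar}\to\mathbb R$ be a potential on a Bratteli diagram $\mathrm{Br}$. The set $\mathrm{GS}(\alpha^F)$ of ground states for the generalized gauge action $\alpha^F$ is a closed face in the state space $S(\mathrm{AF}(\mathrm{Br}))$, and it is affinely homeomorphic with the state space of $\mathrm{AF}(\mathrm{Br}^+)$ via the map $$S\left(\mathrm{AF}(\mathrm{Br}^+)\right)\ni\omega\ \mapsto\ \omega\circ Q_F .$$
   Context: A Bratteli diagram $\mathrm{Br}$ is a directed graph with vertex set $\mathrm{Br}_V$, arrow set $\mathrm{Br}_{Ar}$, source and range maps $s,r$, such that $\mathrm{Br}_V=\bigsqcup_{n\ge 0}\mathrm{Br}_n$ with each level set $\mathrm{Br}_n$ finite, $\mathrm{Br}_0=\{v_0\}$, every vertex emits at least one and at most finitely many arrows, arrows emitted from $\mathrm{Br}_n$ end in $\mathrm{Br}_{n+1}$, and $v_0$ is the only vertex that is not the range of an arrow. Let $\mathcal P_n$ be the set of paths of length $n$ starting at $v_0$. $\mathrm{AF}(\mathrm{Br})$ is the unital $C^*$-algebra which is the closure of the increasing union of finite-dimensional unital subalgebras $\mathrm{AF}_n(\mathrm{Br})$, where $\mathrm{AF}_n(\mathrm{Br})$ has as linear basis matrix units $E^n_{\mu,\mu'}$, $\mu,\mu'\in\mathcal P_n$, $r(\mu)=r(\mu')$, with $E^n_{\mu,\mu'}E^n_{\nu,\nu'}=\delta_{\mu',\nu}E^n_{\mu,\nu'}$, $(E^n_{\mu,\mu'})^*=E^n_{\mu',\mu}$, $\sum_\mu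 E^n_{\mu,\mu}=1$, and $E^n_{\mu,\mu'}=\sum_{a\in s^{-1}(r(\mu))}E^{n+1}_{\mu a,\mu' a}$. A potential $F:\mathrm{Br}_{Ar}\to\mathbb R$ is extended to paths by $F(a_1\cdots a_n)=\sum_i F(a_i)$ and defines a flow $\alpha^F$ on $\mathrm{AF}(\mathrm{Br})$, called a generalized gauge action, by $\alpha^F_t(E^n_{\mu,\mu'})=e^{it(F(\mu)-F(\mu'))}E^n_{\mu,\mu'}$. Let $\delta_F$ be its infinitesimal generator. A ground state is a state $\omega$ with $-i\omega(a^*\delta_F(a))\ge0$ for all $a\in D(\delta_F)$; $\mathrm{GS}(\alpha^F)$ is the set of ground states. $S(A)$ is the state space of $A$ with the weak* topology. Let $P(\mathrm{Br})$ be the set of infinite paths $p=p_1p_2\cdots$ starting at $v_0$, and $p[1,n]=p_1\cdots p_n$. $p\in P(\mathrm{Br})$ is an ($F$-)geodesic if $F(p[1,n])\le F(\mu)$ for all $n\ge1$ and all $\mu\in\mathcal P_n$ with $r(\mu)=r(p_n)$. $\mathrm{Br}^+$ is the Bratteli sub-diagram of $\mathrm{Br}$ with $\mathrm{Br}^+_0=\{v_0\}$, $\mathrm{Br}^+_n=\{r(p[1,n]): p \text{ a geodesic}\}$ for $n\ge1$, and whose arrows are the $a\in\mathrm{Br}_{Ar}$ such that $a=p_n$ for some geodesic $p$ and some $n$. Let $\mathcal G_n\subseteq\mathcal P_n$ be the set of paths in $\mathrm{Br}^+$ of length $n$ starting at $v_0$ and $Q_n=\sum_{\mu\in\mathcal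 G_n}E^n_{\mu,\mu}$. For each $n$, $\mathrm{AF}_n(\mathrm{Br}^+)$ is identified (via matrix units) with the corner $Q_n\mathrm{AF}_n(\mathrm{Br})Q_n$ of $\mathrm{AF}_n(\mathrm{Br})$. Let $\mathrm{AF}(\mathrm{Br})^{\alpha^F}$ be the fixed point algebra, $R:\mathrm{AF}(\mathrm{Br})\to\mathrm{AF}(\mathrm{Br})^{\alpha^F}$ the conditional expectation $R(a)=\lim_{T\to\infty}\frac1T\int_0^T\alpha^F_t(a)\,dt$, and $q_F:\mathrm{AF}(\mathrm{Br})^{\alpha^F}\to\mathrm{AF}(\mathrm{Br}^+)$ the unital surjective $*$-homomorphism determined by $q_F(a)=Q_naQ_n\in\mathrm{AF}_n(\mathrm{Br}^+)$ for $a\in\mathrm{AF}_n(\mathrm{Br})\cap\mathrm{AF}(\mathrm{Br})^{\alpha^F}$. Set $Q_F=q_F\circ R:\mathrm{AF}(\mathrm{Br})\to\mathrm{AF}(\mathrm{Br}^+)$. *)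

theory Defs
  imports
    "HOL-Analysis.Analysis"
    "HOL-Library.Function_Algebras"
    "Graph_Theory.Arc_Walk"
begin

section \<open>Unital C*-algebras and their state spaces\<close>

class cstar_algebra = real_normed_algebra_1 + banach +
  fixes scaleC :: "complex \<Rightarrow> 'a \<Rightarrow> 'a" (infixr "*\<^sub>C" 75)
    and star :: "'a \<Rightarrow> 'a"
  assumes scaleC_add_right: "c *\<^sub>C (x + y) = c *\<^sub>C x + c *\<^sub>C y"
    and scaleC_add_left: "(c + d) *\<^sub>C x = c *\<^sub>C x + d *\<^sub>C x"
    and scaleC_scaleC: "c *\<^sub>C d *\<^sub>C x = (c * d) *\<^sub>C x"
    and scaleC_of_real: "of_real t *\<^sub>C x = t *\<^sub>R x"
    and mult_scaleC_left: "(c *\<^sub>C x) * y = c *\<^sub>C (x * y)"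
    and mult_scaleC_right: "x * (c *\<^sub>C y) = c *\<^sub>C (x * y)"
    and norm_scaleC: "norm (c *\<^sub>C x) = cmod c * norm x"
    and star_star: "star (star x) = x"
    and star_add: "star (x + y) = star x + star y"
    and star_scaleC: "star (c *\<^sub>C x) = cnj c *\<^sub>C star x"
    and star_mult: "star (x * y) = star y * star x"
    and cstar_identity: "norm (star x * x) = (norm x)\<^sup>2"

text \<open>
  The pointwise real vector space structure on functions makes the library notions of convexity
  and faces available for sets of functionals.
\<close>

instantiation "fun" :: (type, real_vector) real_vector
begin

definition scaleR_fun :: "real \<Rightarrow> ('a \<Rightarrow> 'b) \<Rightarrow> 'a \<Rightarrow> 'b"
  where "scaleR_fun t f = (\<lambda>x. t *\<^sub>R f x)"

instance
  by standard (simp_all add: scaleR_fun_def plus_fun_def scaleR_add_right scaleR_add_left)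

end

text \<open>
  The topology of the type \<open>'a \<Rightarrow> complex\<close> is that of pointwise convergence, so that
  \<open>top_of_set state_space\<close> is the state space with the weak* topology.  Boundedness of
  a state is a consequence of positivity.
\<close>

definition state_space :: "('a::cstar_algebra \<Rightarrow> complex) set" where
  "state_space = {\<omega>.
     (\<forall>x y. \<omega> (x + y) = \<omega> x + \<omega> y) \<and>
     (\<forall>c x. \<omega> (c *\<^sub>C x) = c * \<omega> x) \<and>
     (\<forall>x. \<omega> (star x * x) \<in> \<real>\<^sub>\<ge>\<^sub>0) \<and>
     \<omega> 1 = 1}"

text \<open>
  Unital *-homomorphisms defined on a unital C*-subalgebra \<open>S\<close>.  Continuity is automatic for these;
  it is listed so that a homomorphism is visibly determined by its values on a dense subset.
\<close>

definition star_hom_on ::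
    "'a::cstar_algebra set \<Rightarrow> ('a \<Rightarrow> 'b::cstar_algebra) \<Rightarrow> bool" where
  "star_hom_on S f \<longleftrightarrow>
     (\<forall>x\<in>S. \<forall>y\<in>S. f (x + y) = f x + f y) \<and>
     (\<forall>c. \<forall>x\<in>S. f (c *\<^sub>C x) = c *\<^sub>C f x) \<and>
     (\<forall>x\<in>S. \<forall>y\<in>S. f (x * y) = f x * f y) \<and>
     (\<forall>x\<in>S. f (star x) = star (f x)) \<and>
     f 1 = 1 \<and>
     continuous_on S f"

section \<open>Flows and ground states\<close>

definition flow :: "(real \<Rightarrow> 'a::cstar_algebra \<Rightarrow> 'a) \<Rightarrow> bool" where
  "flow \<alpha> \<longleftrightarrow>
     (\<forall>t. star_hom_on UNIV (\<alpha> t) \<and> bij (\<alpha> t)) \<and>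
     \<alpha> 0 = id \<and>
     (\<forall>s t. \<alpha> (s + t) = \<alpha> s \<circ> \<alpha> t) \<and>
     (\<forall>a. continuous_on UNIV (\<lambda>t. \<alpha> t a))"

definition generator_domain :: "(real \<Rightarrow> 'a::cstar_algebra \<Rightarrow> 'a) \<Rightarrow> 'a set" where
  "generator_domain \<alpha> = {a. \<exists>d. ((\<lambda>t. \<alpha> t a) has_vector_derivative d) (at 0)}"

definition generator :: "(real \<Rightarrow> 'a::cstar_algebra \<Rightarrow> 'a) \<Rightarrow> 'a \<Rightarrow> 'a" where
  "generator \<alpha> a = vector_derivative (\<lambda>t. \<alpha> t a) (at 0)"

definition ground_states :: "(real \<Rightarrow> 'a::cstar_algebra \<Rightarrow> 'a) \<Rightarrow> ('a \<Rightarrow> complex) set" where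
  "ground_states \<alpha> = {\<omega> \<in> state_space.
     \<forall>a \<in> generator_domain \<alpha>. - \<i> * \<omega> (star a * generator \<alpha> a) \<in> \<real>\<^sub>\<ge>\<^sub>0}"

definition fixed_point_algebra :: "(real \<Rightarrow> 'a::cstar_algebra \<Rightarrow> 'a) \<Rightarrow> 'a set" where
  "fixed_point_algebra \<alpha> = {a. \<forall>t. \<alpha> t a = a}"

definition mean_expectation :: "(real \<Rightarrow> 'a::cstar_algebra \<Rightarrow> 'a) \<Rightarrow> 'a \<Rightarrow> 'a" where
  "mean_expectation \<alpha> a =
     Lim at_top (\<lambda>T::real. (1 / T) *\<^sub>R integral {0..T} (\<lambda>t. \<alpha> t a))"

section \<open>Bratteli diagrams\<close>

locale bratteli_diagram = wf_digraph Br for Br :: "('v, 'e) pre_digraph" +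
  fixes level :: "nat \<Rightarrow> 'v set" and v0 :: 'v
  assumes verts_eq_levels: "verts Br = (\<Union>n. level n)"
    and disjoint_levels: "disjoint_family level"
    and finite_level: "finite (level n)"
    and level_0: "level 0 = {v0}"
    and emits: "v \<in> verts Br \<Longrightarrow> out_arcs Br v \<noteq> {}"
    and emits_finite: "v \<in> verts Br \<Longrightarrow> finite (out_arcs Br v)"
    and arcs_level: "a \<in> arcs Br \<Longrightarrow> tail Br a \<in> level n \<Longrightarrow> head Br a \<in> level (Suc n)"
    and only_source: "{v \<in> verts Br. in_arcs Br v = {}} = {v0}"

text \<open>The paths of length \<open>n\<close> starting at the root, as lists of arrows.\<close>

definition paths :: "('v, 'e) pre_digraph \<Rightarrow> 'v \<Rightarrow> nat \<Rightarrow> 'e list set" where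
  "paths Br v0 n = {\<mu>. length \<mu> = n \<and> (\<exists>v. pre_digraph.awalk Br v0 \<mu> v)}"

abbreviation path_range :: "('v, 'e) pre_digraph \<Rightarrow> 'v \<Rightarrow> 'e list \<Rightarrow> 'v" where
  "path_range Br v0 \<mu> \<equiv> pre_digraph.awlast Br v0 \<mu>"

text \<open>An infinite path \<open>p\<^sub>1p\<^sub>2\<cdots>\<close> is the sequence \<open>p\<close> with \<open>p i = p\<^sub>i\<^sub>+\<^sub>1\<close>.\<close>

definition infinite_paths :: "('v, 'e) pre_digraph \<Rightarrow> 'v \<Rightarrow> (nat \<Rightarrow> 'e) set" where
  "infinite_paths Br v0 = {p. (\<forall>i. p i \<in> arcs Br) \<and> tail Br (p 0) = v0 \<and>
     (\<forall>i. head Br (p i) = tail Br (p (Suc i)))}"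

definition path_prefix :: "(nat \<Rightarrow> 'e) \<Rightarrow> nat \<Rightarrow> 'e list" where
  "path_prefix p n = map p [0..<n]"

definition path_potential :: "('e \<Rightarrow> real) \<Rightarrow> 'e list \<Rightarrow> real" where
  "path_potential F \<mu> = sum_list (map F \<mu>)"

definition geodesics ::
    "('v, 'e) pre_digraph \<Rightarrow> 'v \<Rightarrow> ('e \<Rightarrow> real) \<Rightarrow> (nat \<Rightarrow> 'e) set" where
  "geodesics Br v0 F = {p \<in> infinite_paths Br v0.
     \<forall>n\<ge>1. \<forall>\<mu> \<in> paths Br v0 n.
       path_range Br v0 \<mu> = head Br (p (n - 1)) \<longrightarrow>
       path_potential F (path_prefix p n) \<le> path_potential F \<mu>}"

definition geodesic_subdiagram ::
    "('v, 'e) pre_digraph \<Rightarrow> 'v \<Rightarrow> ('e \<Rightarrow> real) \<Rightarrow> ('v, 'e) pre_digraph" where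
  "geodesic_subdiagram Br v0 F =
     \<lparr> verts = {v0} \<union> {head Br (p n) | p n. p \<in> geodesics Br v0 F},
       arcs = {p n | p n. p \<in> geodesics Br v0 F},
       tail = tail Br,
       head = head Br \<rparr>"

section \<open>The AF-algebra of a Bratteli diagram\<close>

text \<open>
  The level \<open>n\<close> of a matrix unit \<open>E\<^sup>n \<mu> \<mu>'\<close> is the length of \<open>\<mu>\<close>, hence
  a system of matrix units is a function of the two paths only.
\<close>

definition unit_indices :: "('v, 'e) pre_digraph \<Rightarrow> 'v \<Rightarrow> nat \<Rightarrow> ('e list \<times> 'e list) set" where
  "unit_indices Br v0 n =
     {(\<mu>, \<mu>'). \<mu> \<in> paths Br v0 n \<and> \<mu>' \<in> paths Br v0 n \<and>
              path_range Br v0 \<mu> = path_range Br v0 \<mu>'}"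

definition unit_combination ::
    "('v, 'e) pre_digraph \<Rightarrow> 'v \<Rightarrow> ('e list \<Rightarrow> 'e list \<Rightarrow> 'a::cstar_algebra) \<Rightarrow> nat \<Rightarrow>
     ('e list \<Rightarrow> 'e list \<Rightarrow> complex) \<Rightarrow> 'a" where
  "unit_combination Br v0 E n c = (\<Sum>(\<mu>, \<mu>')\<in>unit_indices Br v0 n. c \<mu> \<mu>' *\<^sub>C E \<mu> \<mu>')"

definition AF_level ::
    "('v, 'e) pre_digraph \<Rightarrow> 'v \<Rightarrow> ('e list \<Rightarrow> 'e list \<Rightarrow> 'a::cstar_algebra) \<Rightarrow> nat \<Rightarrow> 'a set" where
  "AF_level Br v0 E n = range (unit_combination Br v0 E n)"

text \<open>
  The C*-algebra \<open>'a\<close>, with the matrix units \<open>E\<close>, is the AF-algebra of \<open>Br\<close>.  These conditions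
  determine \<open>'a\<close> up to an isomorphism respecting the matrix units.
\<close>

locale AF_algebra =
  fixes Br :: "('v, 'e) pre_digraph" and v0 :: 'v
    and E :: "'e list \<Rightarrow> 'e list \<Rightarrow> 'a::cstar_algebra"
  assumes units_independent:
      "unit_combination Br v0 E n c = 0 \<Longrightarrow> (\<mu>, \<mu>') \<in> unit_indices Br v0 n \<Longrightarrow> c \<mu> \<mu>' = 0"
    and units_mult:
      "(\<mu>, \<mu>') \<in> unit_indices Br v0 n \<Longrightarrow> (\<nu>, \<nu>') \<in> unit_indices Br v0 n \<Longrightarrow>
       E \<mu> \<mu>' * E \<nu> \<nu>' = (if \<mu>' = \<nu> then E \<mu> \<nu>' else 0)"
    and units_star:
      "(\<mu>, \<mu>') \<in> unit_indices Br v0 n \<Longrightarrow> star (E \<mu> \<mu>') = E \<mu>' \<mu>"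
    and units_sum: "(\<Sum>\<mu>\<in>paths Br v0 n. E \<mu> \<mu>) = 1"
    and units_refine:
      "(\<mu>, \<mu>') \<in> unit_indices Br v0 n \<Longrightarrow>
       E \<mu> \<mu>' = (\<Sum>a\<in>out_arcs Br (path_range Br v0 \<mu>). E (\<mu> @ [a]) (\<mu>' @ [a]))"
    and dense_levels: "closure (\<Union>n. AF_level Br v0 E n) = UNIV"

section \<open>Generalized gauge actions and the map \<open>Q\<^sub>F\<close>\<close>

definition gauge_action ::
    "('v, 'e) pre_digraph \<Rightarrow> 'v \<Rightarrow> ('e list \<Rightarrow> 'e list \<Rightarrow> 'a::cstar_algebra) \<Rightarrow> ('e \<Rightarrow> real) \<Rightarrow>
     real \<Rightarrow> 'a \<Rightarrow> 'a" where
  "gauge_action Br v0 E F = (THE \<alpha>. flow \<alpha> \<and>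
     (\<forall>t n. \<forall>(\<mu>, \<mu>') \<in> unit_indices Br v0 n.
        \<alpha> t (E \<mu> \<mu>') =
          exp (\<i> * of_real (t * (path_potential F \<mu> - path_potential F \<mu>'))) *\<^sub>C E \<mu> \<mu>'))"

definition geodesic_projection ::
    "('v, 'e) pre_digraph \<Rightarrow> 'v \<Rightarrow> ('e list \<Rightarrow> 'e list \<Rightarrow> 'a::cstar_algebra) \<Rightarrow> ('e \<Rightarrow> real) \<Rightarrow>
     nat \<Rightarrow> 'a" where
  "geodesic_projection Br v0 E F n = (\<Sum>\<mu>\<in>paths (geodesic_subdiagram Br v0 F) v0 n. E \<mu> \<mu>)"

text \<open>
  \<open>E\<close> and \<open>E'\<close> are the matrix units of the AF-algebras of \<open>Br\<close> and of the geodesic subdiagram.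
  The identification of the corner \<open>Q\<^sub>n AF\<^sub>n(Br) Q\<^sub>n\<close> with \<open>AF\<^sub>n\<close> of the
  subdiagram takes a linear combination of the \<open>E \<mu> \<mu>'\<close>, with \<open>\<mu>\<close> and \<open>\<mu>'\<close> in
  the subdiagram, to the combination of the \<open>E' \<mu> \<mu>'\<close> with the same coefficients.
  As \<open>q\<^sub>F\<close> is only defined on the fixed point algebra, it is taken to be
  \<open>undefined\<close> outside.
\<close>

definition corner_hom ::
    "('v, 'e) pre_digraph \<Rightarrow> 'v \<Rightarrow> ('e list \<Rightarrow> 'e list \<Rightarrow> 'a::cstar_algebra) \<Rightarrow>
     ('e list \<Rightarrow> 'e list \<Rightarrow> 'b::cstar_algebra) \<Rightarrow> ('e \<Rightarrow> real) \<Rightarrow> 'a \<Rightarrow> 'b" where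
  "corner_hom Br v0 E E' F =
     (let Fix = fixed_point_algebra (gauge_action Br v0 E F);
          Br' = geodesic_subdiagram Br v0 F;
          Q = geodesic_projection Br v0 E F
      in THE q. q \<in> extensional Fix \<and> star_hom_on Fix q \<and> q ` Fix = UNIV \<and>
           (\<forall>n. \<forall>a \<in> AF_level Br v0 E n \<inter> Fix.
              \<exists>c. Q n * a * Q n = unit_combination Br' v0 E n c \<and>
                  q a = unit_combination Br' v0 E' n c))"

definition geodesic_map ::
    "('v, 'e) pre_digraph \<Rightarrow> 'v \<Rightarrow> ('e list \<Rightarrow> 'e list \<Rightarrow> 'a::cstar_algebra) \<Rightarrow>
     ('e list \<Rightarrow> 'e list \<Rightarrow> 'b::cstar_algebra) \<Rightarrow> ('e \<Rightarrow> real) \<Rightarrow> 'a \<Rightarrow> 'b" where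
  "geodesic_map Br v0 E E' F =
     corner_hom Br v0 E E' F \<circ> mean_expectation (gauge_action Br v0 E F)"

end

theory Submission
  imports Defs
begin

text \<open>
  A ground state \<open>\<phi>\<close> gives the projection \<open>E \<mu> \<mu>\<close> of a finite path \<open>\<mu>\<close> a weight.  Testing the ground
  state condition on \<open>E \<nu> \<mu>\<close>, whose generator eigenvalue is \<open>\<i> (F \<nu> - F \<mu>)\<close>, yields
  \<open>(F \<nu> - F \<mu>) \<phi> (E \<mu> \<mu>) \<ge> 0\<close>, so a path of positive weight has least potential among the paths with
  its length and range.  The weight of a path is the sum of the weights of its one-step extensions;
  hence a path of positive weight continues to an infinite path all of whose initial pieces have
  positive weight, and this is a geodesic.  So a ground state vanishes on \<open>E \<mu> \<mu>\<close> for every \<open>\<mu>\<close>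
  outside the geodesic subdiagram, and by the Cauchy-Schwarz inequality \<open>\<phi> a\<close> depends only on the
  compressions of \<open>a\<close> to the geodesic paths of each level.

  These compressions fit together.  Taking \<open>uc E n c\<close> to the combination of the units \<open>E'\<close> of the
  subdiagram with the same coefficients is contractive on each level, because two systems of matrix
  units of the same shape span isometric algebras (\<open>matrix_units_isometric\<close>), and it is compatible
  with refinement; so it extends to a contraction \<open>compression\<close> of the whole AF-algebra
  (\<open>contraction_extension\<close>).  Geodesic paths with a common range have equal potential, so \<open>compression\<close>
  does not see the coefficients that the mean expectation removes.  A path with the range and the
  potential of a geodesic path is geodesic (\<open>geodesic_path_exchange\<close>), so on fixed elements \<open>compression\<close>
  is multiplicative.  It follows that \<open>compression\<close> is the map \<open>Q\<^sub>F\<close> (\<open>geodesic_map_eq\<close>), and that it is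
  onto.

  Conversely, let \<open>\<omega>\<close> be a state of the algebra of the subdiagram.  For \<open>a\<close> in a level,
  \<open>- \<i> \<omega> (compression (a\<^sup>* \<delta> a))\<close> is a sum of terms \<open>\<omega> (b\<^sup>* b)\<close> with weights \<open>F \<mu> - m\<close>, where \<open>m\<close> is the
  least potential at the range of \<open>\<mu>\<close>; so it is nonnegative
  (\<open>state_compression_weighted_nonneg\<close>).  The levels form a core of the generator (\<open>generator_core\<close>),
  which gives the ground state condition for all \<open>a\<close>.

  Thus the ground states are exactly the states \<open>\<omega> \<circ> compression\<close>, and exactly the states with
  \<open>\<phi> (E \<mu> \<mu>) = 0\<close> for \<open>\<mu>\<close> outside the subdiagram.  The second description shows a closed set and,
  since states are nonnegative on projections, a face.  In the first, \<open>\<omega>\<close> is recovered from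
  \<open>\<omega> \<circ> compression\<close> by evaluation at preimages, which is continuous for pointwise convergence.
\<close>

section \<open>Elementary C*-algebra theory\<close>

lemma scaleC_zero_left [simp]: "0 *\<^sub>C x = (0::'a::cstar_algebra)"
  using scaleC_add_left[of 0 0 x] by simp

lemma scaleC_zero_right [simp]: "c *\<^sub>C 0 = (0::'a::cstar_algebra)"
  using scaleC_add_right[of c 0 "0::'a"] by simp

lemma scaleC_one [simp]: "1 *\<^sub>C x = (x::'a::cstar_algebra)"
  using scaleC_of_real[of 1 x] by simp

lemma scaleC_minus_left: "(- c) *\<^sub>C x = - (c *\<^sub>C (x::'a::cstar_algebra))"
  using scaleC_add_left[of c "- c" x] by (simp add: eq_neg_iff_add_eq_0 add.commute)

lemma scaleC_diff_left: "(c - d) *\<^sub>C x = c *\<^sub>C x - d *\<^sub>C (x::'a::cstar_algebra)"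
  using scaleC_add_left[of c "- d" x] by (simp add: scaleC_minus_left)

lemma scaleR_eq_scaleC: "r *\<^sub>R x = complex_of_real r *\<^sub>C (x::'a::cstar_algebra)"
  by (simp add: scaleC_of_real)

lemma bounded_linear_scaleC_left: "bounded_linear (\<lambda>c. c *\<^sub>C (x::'a::cstar_algebra))"
  by (rule bounded_linear_intro[where K = "norm x"])
    (simp_all add: scaleC_add_left norm_scaleC scaleR_eq_scaleC scaleC_scaleC scaleR_conv_of_real)

lemma bounded_linear_scaleC_right: "bounded_linear (\<lambda>x::'a::cstar_algebra. c *\<^sub>C x)"
  by (rule bounded_linear_intro[where K = "cmod c"])
    (simp_all add: scaleC_add_right norm_scaleC scaleR_eq_scaleC scaleC_scaleC mult.commute)

lemmas tendsto_scaleC_left = bounded_linear.tendsto[OF bounded_linear_scaleC_left]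

lemma scaleC_sum_right: "c *\<^sub>C sum f A = (\<Sum>a\<in>A. c *\<^sub>C (f a::'a::cstar_algebra))"
  using linear_sum[OF bounded_linear.linear[OF bounded_linear_scaleC_right]] .

lemma scaleC_sum_left: "sum f A *\<^sub>C x = (\<Sum>a\<in>A. f a *\<^sub>C (x::'a::cstar_algebra))"
  using linear_sum[OF bounded_linear.linear[OF bounded_linear_scaleC_left]] .

lemma norm_star [simp]: "norm (star x) = norm (x::'a::cstar_algebra)"
proof -
  have le: "norm x \<le> norm (star x)" for x :: 'a
  proof (cases "x = 0")
    case False
    have "(norm x)\<^sup>2 \<le> norm (star x) * norm x"
      by (metis cstar_identity norm_mult_ineq)
    then show ?thesis using False by (simp add: power2_eq_square)
  qed simp
  show ?thesis using le[of x] le[of "star x"] by (simp add: star_star)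
qed

lemma bounded_linear_star: "bounded_linear (star :: 'a::cstar_algebra \<Rightarrow> 'a)"
  by (rule bounded_linear_intro[where K = 1])
    (simp_all add: star_add scaleR_eq_scaleC star_scaleC)

lemmas tendsto_star = bounded_linear.tendsto[OF bounded_linear_star]

lemmas star_simps =
  linear_0[OF bounded_linear.linear[OF bounded_linear_star]]
  linear_diff[OF bounded_linear.linear[OF bounded_linear_star]]
  linear_sum[OF bounded_linear.linear[OF bounded_linear_star]]
  star_add star_star star_mult star_scaleC

lemma star_one [simp]: "star 1 = (1::'a::cstar_algebra)"
  by (metis mult.right_neutral star_mult star_star)

subsection \<open>Bounded *-homomorphisms are contractive\<close>

lemma norm_self_adjoint_power:
  fixes h :: "'a::cstar_algebra"
  assumes "star h = h"
  shows "norm (h ^ 2 ^ k) = norm h ^ 2 ^ k"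
proof -
  have sa: "star (h ^ n) = h ^ n" for n
    by (induction n) (simp_all add: star_mult assms power_commutes)
  show ?thesis
  proof (induction k)
    case (Suc k)
    have "norm (h ^ 2 ^ Suc k) = norm (star (h ^ 2 ^ k) * h ^ 2 ^ k)"
      by (simp add: sa mult_2 power_add)
    also have "\<dots> = norm h ^ 2 ^ Suc k"
      by (simp add: cstar_identity Suc.IH flip: power_mult) (simp add: mult.commute)
    finally show ?case .
  qed simp
qed

text \<open>
  Applied to the powers \<open>2 ^ k\<close> of \<open>x\<^sup>* x\<close>, a bound \<open>K\<close> for a *-homomorphism becomes, through the
  C*-identity, the bound \<open>K\<close> to the power \<open>1 / 2 ^ (k + 1)\<close>, which tends to 1.  Both algebras are
  parametrised by a common set with its own product and adjoint, so that the homomorphism need not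
  be given as a map between them and the comparison can be read in both directions.
\<close>

lemma star_hom_contractive:
  fixes f :: "'c \<Rightarrow> 'a::cstar_algebra" and g :: "'c \<Rightarrow> 'b::cstar_algebra"
  assumes f: "\<And>c d. f (m c d) = f c * f d" "\<And>c. f (s c) = star (f c)"
    and g: "\<And>c d. g (m c d) = g c * g d" "\<And>c. g (s c) = star (g c)"
    and bound: "\<And>c. norm (g c) \<le> K * norm (f c)"
  shows "norm (g c) \<le> norm (f c)"
proof (rule ccontr)
  assume less: "\<not> norm (g c) \<le> norm (f c)"
  define pw where "pw k = ((\<lambda>d. m d d) ^^ k) (m (s c) c)" for k
  have pw: "f (pw k) = (star (f c) * f c) ^ 2 ^ k \<and> g (pw k) = (star (g c) * g c) ^ 2 ^ k" for k
    by (induction k) (simp_all add: pw_def f g mult_2 power_add)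
  have norm_pw: "norm ((star x * x) ^ 2 ^ k) = norm x ^ 2 ^ Suc k" for x :: "'z::cstar_algebra" and k
  proof -
    have "norm ((star x * x) ^ 2 ^ k) = norm (star x * x) ^ 2 ^ k"
      by (rule norm_self_adjoint_power) (simp add: star_simps)
    then show ?thesis by (simp add: cstar_identity flip: power_mult)
  qed
  have le: "norm (g c) ^ 2 ^ Suc k \<le> K * norm (f c) ^ 2 ^ Suc k" for k
    using bound[of "pw k"] by (simp only: pw norm_pw)
  have fpos: "norm (f c) > 0"
    using less bound[of c] by (metis mult_eq_0_iff norm_ge_zero not_less order_le_less)
  define r where "r = norm (g c) / norm (f c)"
  have "r > 1" using less fpos by (simp add: r_def)
  then obtain n where n: "r ^ n > K" using real_arch_pow by blast
  have "n \<le> 2 ^ Suc n" using less_exp[of "Suc n"] by linarith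
  then have "r ^ n \<le> r ^ 2 ^ Suc n" using \<open>r > 1\<close> by (intro power_increasing) auto
  also have "\<dots> \<le> K"
    using le[of n] fpos by (simp add: r_def power_divide divide_le_eq)
  finally show False using n by simp
qed

subsection \<open>Square roots and boundedness of states\<close>

text \<open>
  The equation \<open>(1 - z)\<^sup>2 = 1 - h\<close> says that \<open>z\<close> is a fixed point of \<open>z \<mapsto> (h + z\<^sup>2) / 2\<close>, which is a
  contraction of the ball of radius \<open>1 - sqrt (1 - \<parallel>h\<parallel>)\<close>, the fixed point of the corresponding scalar
  map.
\<close>

lemma self_adjoint_sqrt_one_minus:
  fixes h :: "'a::cstar_algebra"
  assumes sa: "star h = h" and less: "norm h < 1"
  obtains y where "star y = y" "y * y = 1 - h"
proof -
  define r where "r = 1 - sqrt (1 - norm h)"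
  have r: "0 \<le> r" "r < 1" "norm h + r\<^sup>2 = 2 * r"
    using less by (simp_all add: r_def power2_diff)
  define S where "S = {z::'a. norm z \<le> r \<and> star z = z}"
  define f where "f z = (1/2) *\<^sub>R (h + z * z)" for z
  have "closed {z::'a. star z = z}"
    by (intro closed_Collect_eq continuous_on_id
        linear_continuous_on[OF bounded_linear_star])
  moreover have "closed {z::'a. norm z \<le> r}"
    by (intro closed_Collect_le continuous_intros)
  ultimately have "complete S"
    unfolding S_def complete_eq_closed by (simp add: closed_Collect_conj)
  moreover have "S \<noteq> {}" using r by (auto simp: S_def star_simps intro!: exI[of _ 0])
  moreover have "f ` S \<subseteq> S"
  proof safe
    fix z assume z: "z \<in> S"
    have "norm (z * z) \<le> r\<^sup>2"
      using z norm_mult_ineq[of z z] mult_mono[of "norm z" r "norm z" r] r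
      by (auto simp: S_def power2_eq_square)
    then have "norm (h + z * z) \<le> 2 * r"
      using norm_triangle_ineq[of h "z * z"] r by linarith
    moreover have "star (f z) = f z"
      using z sa by (simp add: f_def S_def star_simps scaleR_eq_scaleC)
    ultimately show "f z \<in> S" by (simp add: S_def f_def)
  qed
  moreover have "dist (f z) (f w) \<le> r * dist z w" if "z \<in> S" "w \<in> S" for z w
  proof -
    have "f z - f w = (1/2) *\<^sub>R (z * (z - w) + (z - w) * w)"
      by (simp add: f_def algebra_simps)
    then have "norm (f z - f w) \<le> (1/2) * (norm z * norm (z - w) + norm (z - w) * norm w)"
      by (simp, smt (verit) norm_triangle_ineq norm_mult_ineq)
    also have "\<dots> \<le> (1/2) * (r * norm (z - w) + norm (z - w) * r)"
      using that by (intro mult_left_mono add_mono mult_right_mono) (auto simp: S_def)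
    finally show ?thesis by (simp add: dist_norm mult.commute)
  qed
  ultimately obtain z where z: "z \<in> S" "f z = z"
    using Banach_fix[of S r f] r by auto
  have "2 *\<^sub>R z = 2 *\<^sub>R f z" using z by simp
  then have "z + z = h + z * z" by (simp add: f_def scaleR_2)
  then have "(1 - z) * (1 - z) = 1 - h" by (simp add: algebra_simps)
  moreover have "star (1 - z) = 1 - z" using z by (simp add: S_def star_simps)
  ultimately show ?thesis using that by blast
qed

lemma
  assumes "\<omega> \<in> state_space"
  shows state_add: "\<omega> (x + y) = \<omega> x + \<omega> y"
    and state_scaleC: "\<omega> (c *\<^sub>C x) = c * \<omega> x"
    and state_nonneg: "\<omega> (star x * x) \<in> \<real>\<^sub>\<ge>\<^sub>0"
    and state_one: "\<omega> 1 = 1"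
  using assms by (auto simp: state_space_def)

lemma state_zero: "\<omega> \<in> state_space \<Longrightarrow> \<omega> 0 = 0"
  using state_scaleC[of \<omega> 0 0] by simp

lemma state_diff: "\<omega> \<in> state_space \<Longrightarrow> \<omega> (x - y) = \<omega> x - \<omega> y"
  using state_add[of \<omega> "x - y" y] by simp

lemma state_sum: "\<omega> \<in> state_space \<Longrightarrow> \<omega> (sum f A) = (\<Sum>a\<in>A. \<omega> (f a))"
  by (induction A rule: infinite_finite_induct) (simp_all add: state_zero state_add)

lemma state_hermitian_form:
  assumes \<omega>: "\<omega> \<in> state_space"
  shows "\<omega> (star y * x) = cnj (\<omega> (star x * y))"
proof -
  have "\<omega> (star (x + c *\<^sub>C y) * (x + c *\<^sub>C y)) =
      \<omega> (star x * x) + c * \<omega> (star x * y) + cnj c * \<omega> (star y * x) + cnj c * c * \<omega> (star y * y)" for c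
    by (simp add: star_simps algebra_simps mult_scaleC_left mult_scaleC_right scaleC_scaleC
        state_add[OF \<omega>] state_scaleC[OF \<omega>])
  then have "Im (\<omega> (star x * x) + c * \<omega> (star x * y) + cnj c * \<omega> (star y * x)
      + cnj c * c * \<omega> (star y * y)) = 0" for c
    using state_nonneg[OF \<omega>, of "x + c *\<^sub>C y"] by (simp add: complex_nonneg_Reals_iff)
  from this[of 1] this[of \<i>] show ?thesis
    using state_nonneg[OF \<omega>, of x] state_nonneg[OF \<omega>, of y]
    by (simp add: complex_nonneg_Reals_iff complex_eq_iff)
qed

text \<open>
  With \<open>w = \<omega> (x\<^sup>* y)\<close>, positivity at \<open>x - s (cnj w) y\<close> is a real quadratic inequality in \<open>s\<close>.
\<close>

lemma state_Cauchy_Schwarz: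
  assumes \<omega>: "\<omega> \<in> state_space"
  shows "(cmod (\<omega> (star x * y)))\<^sup>2 \<le> Re (\<omega> (star x * x)) * Re (\<omega> (star y * y))"
proof -
  define w where "w = \<omega> (star x * y)"
  define A C where "A = Re (\<omega> (star x * x))" and "C = Re (\<omega> (star y * y))"
  have AC: "\<omega> (star x * x) = of_real A" "\<omega> (star y * y) = of_real C" "A \<ge> 0" "C \<ge> 0"
    using state_nonneg[OF \<omega>, of x] state_nonneg[OF \<omega>, of y]
    by (auto simp: A_def C_def complex_nonneg_Reals_iff complex_eq_iff)
  have quad: "0 \<le> A - 2 * s * (cmod w)\<^sup>2 + s\<^sup>2 * (cmod w)\<^sup>2 * C" for s :: real
  proof -
    define c where "c = - of_real s * cnj w"
    have "\<omega> (star (x + c *\<^sub>C y) * (x + c *\<^sub>C y)) = of_real A + c * w + cnj c * cnj w + cnj c * c * of_real C"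
      by (simp add: star_simps algebra_simps mult_scaleC_left mult_scaleC_right scaleC_scaleC
        state_add[OF \<omega>] state_scaleC[OF \<omega>] AC w_def state_hermitian_form[OF \<omega>, of y x])
    also have "\<dots> = of_real (A - 2 * s * (cmod w)\<^sup>2 + s\<^sup>2 * (cmod w)\<^sup>2 * C)"
      by (simp add: c_def complex_eq_iff cmod_power2) (simp add: power2_eq_square algebra_simps)
    finally show ?thesis
      using state_nonneg[OF \<omega>, of "x + c *\<^sub>C y"] by (simp add: complex_nonneg_Reals_iff)
  qed
  have "(cmod w)\<^sup>2 \<le> A * C"
  proof (cases "C = 0")
    case True
    have "w = 0"
    proof (rule ccontr)
      assume "w \<noteq> 0"
      then have "0 \<le> A - (A + 1)"
        using quad[of "(A + 1) / (2 * (cmod w)\<^sup>2)"] True by simp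
      then show False by simp
    qed
    then show ?thesis using True by simp
  next
    case False
    then have "C > 0" using AC by simp
    then show ?thesis using quad[of "1 / C"] by (simp add: field_simps power2_eq_square)
  qed
  then show ?thesis by (simp add: w_def A_def C_def)
qed

text \<open>
  If the norm of \<open>x\<close> is below 1, then \<open>1 - x\<^sup>* x\<close> is a square, hence \<open>\<omega> (x\<^sup>* x) \<le> 1\<close>, and
  \<open>\<omega> x\<close> is bounded by the Cauchy-Schwarz inequality with 1.
\<close>

lemma state_norm_le:
  assumes \<omega>: "\<omega> \<in> state_space"
  shows "cmod (\<omega> x) \<le> norm x"
proof -
  have small: "cmod (\<omega> x) \<le> 1" if "norm x < 1" for x
  proof -
    have "norm (star x * x) < 1"
      using that by (simp add: cstar_identity power_less_one_iff)
    then obtain y where y: "star y = y" "y * y = 1 - star x * x"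
      using self_adjoint_sqrt_one_minus[of "star x * x"] by (auto simp: star_simps)
    have "\<omega> (1 - star x * x) \<in> \<real>\<^sub>\<ge>\<^sub>0"
      using state_nonneg[OF \<omega>, of y] y by simp
    then have "Re (\<omega> (star x * x)) \<le> 1"
      by (simp add: state_diff[OF \<omega>] state_one[OF \<omega>] complex_nonneg_Reals_iff)
    moreover have "(cmod (\<omega> x))\<^sup>2 \<le> Re (\<omega> (star x * x))"
      using state_Cauchy_Schwarz[OF \<omega>, of 1 x] by (simp add: state_one[OF \<omega>])
    ultimately show ?thesis using abs_square_le_1[of "cmod (\<omega> x)"] by simp
  qed
  show ?thesis
  proof (rule dense_ge)
    fix b assume b: "norm x < b"
    then have "b > 0" using norm_ge_zero[of x] by linarith
    then have "cmod (\<omega> (complex_of_real (1 / b) *\<^sub>C x)) \<le> 1"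
      using b by (intro small) (simp add: norm_scaleC norm_divide)
    then show "cmod (\<omega> x) \<le> b"
      using \<open>b > 0\<close> by (simp add: state_scaleC[OF \<omega>] norm_mult norm_divide field_simps)
  qed
qed

lemma state_tendsto:
  assumes "\<omega> \<in> state_space" "(f \<longlongrightarrow> l) net"
  shows "((\<lambda>x. \<omega> (f x)) \<longlongrightarrow> \<omega> l) net"
proof -
  have "((\<lambda>x. norm (f x - l)) \<longlongrightarrow> 0) net"
    using assms(2) by (simp add: tendsto_norm_zero_iff LIM_zero_iff)
  then have "((\<lambda>x. \<omega> (f x - l)) \<longlongrightarrow> 0) net"
    by (rule Lim_null_comparison[rotated]) (simp add: state_norm_le[OF assms(1)])
  then show ?thesis
    by (simp add: state_diff[OF assms(1)] LIM_zero_iff)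
qed

lemma state_space_convex:
  assumes "\<phi> \<in> state_space" "\<psi> \<in> state_space" "0 \<le> u" "0 \<le> v" "u + v = 1"
  shows "u *\<^sub>R \<phi> + v *\<^sub>R \<psi> \<in> state_space"
proof -
  have app: "(u *\<^sub>R \<phi> + v *\<^sub>R \<psi>) x = of_real u * \<phi> x + of_real v * \<psi> x" for x
    by (simp add: plus_fun_def scaleR_fun_def scaleR_conv_of_real)
  have "of_real u * \<phi> (star x * x) + of_real v * \<psi> (star x * x) \<in> \<real>\<^sub>\<ge>\<^sub>0" for x
    using assms(3,4) state_nonneg[OF assms(1), of x] state_nonneg[OF assms(2), of x]
    by (simp add: complex_nonneg_Reals_iff)
  moreover have "of_real u + of_real v = (1::complex)"
    using assms(5) by (metis of_real_add of_real_1)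
  ultimately show ?thesis
    unfolding state_space_def mem_Collect_eq app
    by (simp add: state_add[OF assms(1)] state_add[OF assms(2)] state_scaleC[OF assms(1)]
        state_scaleC[OF assms(2)] state_one[OF assms(1)] state_one[OF assms(2)] algebra_simps)
qed

lemma continuous_map_precompose:
  fixes h :: "'x \<Rightarrow> 'y" and S :: "('y \<Rightarrow> 'z::topological_space) set"
  assumes "\<And>\<omega>. \<omega> \<in> S \<Longrightarrow> \<omega> \<circ> h \<in> T"
  shows "continuous_map (top_of_set S) (top_of_set T) (\<lambda>\<omega>. \<omega> \<circ> h)"
proof -
  have "continuous_on S (\<lambda>\<omega>. \<omega> \<circ> h)"
  proof (rule continuous_on_coordinatewise_then_product)
    show "continuous_on S (\<lambda>\<omega>. (\<omega> \<circ> h) i)" for i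
      unfolding o_apply by (rule continuous_on_subset[OF continuous_on_product_coordinates]) simp
  qed
  then show ?thesis using assms by (simp add: continuous_map_in_subtopology image_subset_iff Pi_iff)
qed

section \<open>Finite systems of matrix units\<close>

definition range_pairs :: "'p set \<Rightarrow> ('p \<Rightarrow> 'v) \<Rightarrow> ('p \<times> 'p) set" where
  "range_pairs X r = {(\<mu>, \<nu>). \<mu> \<in> X \<and> \<nu> \<in> X \<and> r \<mu> = r \<nu>}"

definition comb ::
    "'p set \<Rightarrow> ('p \<Rightarrow> 'v) \<Rightarrow> ('p \<Rightarrow> 'p \<Rightarrow> 'a::cstar_algebra) \<Rightarrow> ('p \<Rightarrow> 'p \<Rightarrow> complex) \<Rightarrow> 'a" where
  "comb X r E c = (\<Sum>(\<mu>, \<nu>)\<in>range_pairs X r. c \<mu> \<nu> *\<^sub>C E \<mu> \<nu>)"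

text \<open>
  The product of coefficient matrices in the direct sum of full matrix algebras, one for each value
  of \<open>r\<close>.
\<close>

definition matrix_times ::
    "'p set \<Rightarrow> ('p \<Rightarrow> 'v) \<Rightarrow> ('p \<Rightarrow> 'p \<Rightarrow> complex) \<Rightarrow> ('p \<Rightarrow> 'p \<Rightarrow> complex) \<Rightarrow> 'p \<Rightarrow> 'p \<Rightarrow> complex" where
  "matrix_times X r c d \<mu> \<nu> = (\<Sum>\<kappa>\<in>X. if r \<kappa> = r \<mu> then c \<mu> \<kappa> * d \<kappa> \<nu> else 0)"

definition adjoint_matrix :: "('p \<Rightarrow> 'p \<Rightarrow> complex) \<Rightarrow> 'p \<Rightarrow> 'p \<Rightarrow> complex" where
  "adjoint_matrix c \<mu> \<nu> = cnj (c \<nu> \<mu>)"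

lemma comb_cong:
  assumes "\<And>\<mu> \<nu>. \<mu> \<in> X \<Longrightarrow> \<nu> \<in> X \<Longrightarrow> r \<mu> = r \<nu> \<Longrightarrow> c \<mu> \<nu> *\<^sub>C E \<mu> \<nu> = d \<mu> \<nu> *\<^sub>C E' \<mu> \<nu>"
  shows "comb X r E c = comb X r E' d"
  unfolding comb_def by (rule sum.cong) (auto simp: range_pairs_def assms)

lemma comb_add: "comb X r E c + comb X r E d = comb X r E (\<lambda>\<mu> \<nu>. c \<mu> \<nu> + d \<mu> \<nu>)"
  by (simp add: comb_def scaleC_add_left sum.distrib case_prod_unfold)

lemma comb_diff: "comb X r E c - comb X r E d = comb X r E (\<lambda>\<mu> \<nu>. c \<mu> \<nu> - d \<mu> \<nu>)"
  by (simp add: comb_def scaleC_diff_left sum_subtractf case_prod_unfold)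

lemma comb_scaleC: "z *\<^sub>C comb X r E c = comb X r E (\<lambda>\<mu> \<nu>. z * c \<mu> \<nu>)"
  by (simp add: comb_def scaleC_sum_right scaleC_scaleC case_prod_unfold)

lemma comb_sum: "(\<Sum>i\<in>A. comb X r U (c i)) = comb X r U (\<lambda>\<mu> \<nu>. \<Sum>i\<in>A. c i \<mu> \<nu>)"
  unfolding comb_def case_prod_unfold scaleC_sum_left by (rule sum.swap)

lemma comb_additive:
  fixes X :: "'p set"
  assumes "\<And>x y. f (x + y) = f x + f y" "\<And>z x. f (z *\<^sub>C x) = z *\<^sub>C f x"
  shows "f (comb X r E c) = comb X r (\<lambda>\<mu> \<nu>. f (E \<mu> \<nu>)) c"
proof -
  have "f 0 = 0" using assms(2)[of 0 0] by simp
  then have "f (sum g A) = (\<Sum>a\<in>A. f (g a))" for g and A :: "('p \<times> 'p) set"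
    by (induction A rule: infinite_finite_induct) (simp_all add: assms)
  then show ?thesis by (simp add: comb_def case_prod_unfold assms)
qed

text \<open>
  Free summation over all pairs makes interchanging and collapsing sums a matter of rewriting.
\<close>

lemma comb_double_sum:
  assumes "finite X"
  shows "comb X r E c = (\<Sum>\<mu>\<in>X. \<Sum>\<nu>\<in>X. if r \<mu> = r \<nu> then c \<mu> \<nu> *\<^sub>C E \<mu> \<nu> else 0)"
proof -
  have "comb X r E c = (\<Sum>p\<in>X \<times> X. if r (fst p) = r (snd p) then c (fst p) (snd p) *\<^sub>C E (fst p) (snd p) else 0)"
    unfolding comb_def using assms
    by (intro sum.mono_neutral_cong_left) (auto simp: range_pairs_def)
  then show ?thesis by (simp add: sum.cartesian_product case_prod_unfold)
qed

locale matrix_units =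
  fixes X :: "'p set" and r :: "'p \<Rightarrow> 'v" and E :: "'p \<Rightarrow> 'p \<Rightarrow> 'a::cstar_algebra"
  assumes finite_labels: "finite X"
    and mult_unit: "\<mu> \<in> X \<Longrightarrow> \<mu>' \<in> X \<Longrightarrow> r \<mu> = r \<mu>' \<Longrightarrow> \<nu> \<in> X \<Longrightarrow> \<nu>' \<in> X \<Longrightarrow> r \<nu> = r \<nu>' \<Longrightarrow>
      E \<mu> \<mu>' * E \<nu> \<nu>' = (if \<mu>' = \<nu> then E \<mu> \<nu>' else 0)"
    and star_unit: "\<mu> \<in> X \<Longrightarrow> \<mu>' \<in> X \<Longrightarrow> r \<mu> = r \<mu>' \<Longrightarrow> star (E \<mu> \<mu>') = E \<mu>' \<mu>"
    and unit_nonzero: "\<mu> \<in> X \<Longrightarrow> E \<mu> \<mu> \<noteq> 0"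
begin

lemma finite_range_pairs: "finite (range_pairs X r)"
  by (rule finite_subset[of _ "X \<times> X"]) (auto simp: range_pairs_def finite_labels)

lemma comb_star: "star (comb X r E c) = comb X r E (adjoint_matrix c)"
proof -
  have "star (comb X r E c) = (\<Sum>\<mu>\<in>X. \<Sum>\<nu>\<in>X. if r \<mu> = r \<nu> then cnj (c \<mu> \<nu>) *\<^sub>C E \<nu> \<mu> else 0)"
    unfolding comb_double_sum[OF finite_labels] star_simps
    by (intro sum.cong refl) (auto simp: star_simps star_unit)
  also have "\<dots> = comb X r E (adjoint_matrix c)"
    unfolding comb_double_sum[OF finite_labels]
    by (subst sum.swap, intro sum.cong refl) (auto simp: adjoint_matrix_def)
  finally show ?thesis .
qed

lemma comb_mult: "comb X r E c * comb X r E d = comb X r E (matrix_times X r c d)"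
proof -
  define e where "e b \<mu> \<nu> = (if r \<mu> = r \<nu> then b \<mu> \<nu> *\<^sub>C E \<mu> \<nu> else 0)" for b \<mu> \<nu>
  have e: "e c \<mu> \<kappa> * e d \<kappa>' \<nu> =
      (if \<kappa>' = \<kappa> then if r \<kappa> = r \<mu> \<and> r \<mu> = r \<nu> then (c \<mu> \<kappa> * d \<kappa> \<nu>) *\<^sub>C E \<mu> \<nu> else 0 else 0)"
    if "\<mu> \<in> X" "\<kappa> \<in> X" "\<kappa>' \<in> X" "\<nu> \<in> X" for \<mu> \<kappa> \<kappa>' \<nu>
  proof (cases "r \<mu> = r \<kappa> \<and> r \<kappa>' = r \<nu>")
    case True
    then have "e c \<mu> \<kappa> * e d \<kappa>' \<nu> = (c \<mu> \<kappa> * d \<kappa>' \<nu>) *\<^sub>C (E \<mu> \<kappa> * E \<kappa>' \<nu>)"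
      by (simp add: e_def mult_scaleC_left mult_scaleC_right scaleC_scaleC mult.commute[of "d _ _"])
    also have "E \<mu> \<kappa> * E \<kappa>' \<nu> = (if \<kappa> = \<kappa>' then E \<mu> \<nu> else 0)"
      using that True by (intro mult_unit) auto
    finally show ?thesis using True by auto
  next
    case False
    then have "e c \<mu> \<kappa> = 0 \<or> e d \<kappa>' \<nu> = 0" by (simp add: e_def)
    moreover have "\<not> (\<kappa>' = \<kappa> \<and> r \<kappa> = r \<mu> \<and> r \<mu> = r \<nu>)" using False by metis
    ultimately show ?thesis by (smt (verit) mult_zero_left mult_zero_right)
  qed
  have "comb X r E c * comb X r E d = (\<Sum>\<mu>\<in>X. \<Sum>\<kappa>\<in>X. e c \<mu> \<kappa>) * (\<Sum>\<kappa>'\<in>X. \<Sum>\<nu>\<in>X. e d \<kappa>' \<nu>)"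
    unfolding comb_double_sum[OF finite_labels] e_def ..
  also have "\<dots> = (\<Sum>\<mu>\<in>X. \<Sum>\<kappa>\<in>X. \<Sum>\<kappa>'\<in>X. \<Sum>\<nu>\<in>X. e c \<mu> \<kappa> * e d \<kappa>' \<nu>)"
    by (simp only: sum_distrib_right) (simp only: sum_distrib_left)
  also have "\<dots> = (\<Sum>\<mu>\<in>X. \<Sum>\<kappa>\<in>X. \<Sum>\<nu>\<in>X. \<Sum>\<kappa>'\<in>X. e c \<mu> \<kappa> * e d \<kappa>' \<nu>)"
    by (intro sum.cong refl sum.swap)
  also have "\<dots> = (\<Sum>\<mu>\<in>X. \<Sum>\<kappa>\<in>X. \<Sum>\<nu>\<in>X.
      if r \<kappa> = r \<mu> \<and> r \<mu> = r \<nu> then (c \<mu> \<kappa> * d \<kappa> \<nu>) *\<^sub>C E \<mu> \<nu> else 0)"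
    using finite_labels by (intro sum.cong refl) (simp add: e)
  also have "\<dots> = (\<Sum>\<mu>\<in>X. \<Sum>\<nu>\<in>X. \<Sum>\<kappa>\<in>X.
      if r \<kappa> = r \<mu> \<and> r \<mu> = r \<nu> then (c \<mu> \<kappa> * d \<kappa> \<nu>) *\<^sub>C E \<mu> \<nu> else 0)"
    by (intro sum.cong refl sum.swap)
  also have "\<dots> = comb X r E (matrix_times X r c d)"
    unfolding comb_double_sum[OF finite_labels]
    by (intro sum.cong refl) (auto simp: matrix_times_def scaleC_sum_left intro!: sum.cong)
  finally show ?thesis .
qed

lemma norm_unit:
  assumes "\<mu> \<in> X" "\<nu> \<in> X" "r \<mu> = r \<nu>"
  shows "norm (E \<mu> \<nu>) = 1"
proof -
  have "norm (E \<nu> \<nu>) = (norm (E \<nu> \<nu>))\<^sup>2"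
    using assms(2) cstar_identity[of "E \<nu> \<nu>"] by (simp add: star_unit mult_unit)
  then have "norm (E \<nu> \<nu>) = 1"
    using unit_nonzero[OF assms(2)] by (simp add: power2_eq_square)
  then have "(norm (E \<mu> \<nu>))\<^sup>2 = 1"
    using assms cstar_identity[of "E \<mu> \<nu>"] by (simp add: star_unit mult_unit)
  then show ?thesis by (simp add: power2_eq_1_iff) (smt (verit) norm_ge_zero)
qed

lemma unit_eq_comb:
  assumes "\<mu> \<in> X" "\<nu> \<in> X" "r \<mu> = r \<nu>"
  shows "E \<mu> \<nu> = comb X r E (\<lambda>\<kappa> \<eta>. if \<kappa> = \<mu> \<and> \<eta> = \<nu> then 1 else 0)"
proof -
  have "comb X r E (\<lambda>\<kappa> \<eta>. if \<kappa> = \<mu> \<and> \<eta> = \<nu> then 1 else 0) =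
      (\<Sum>p\<in>range_pairs X r. if p = (\<mu>, \<nu>) then E \<mu> \<nu> else 0)"
    unfolding comb_def by (intro sum.cong) (auto split: if_splits)
  then show ?thesis
    using assms finite_range_pairs by (simp add: range_pairs_def)
qed

text \<open>
  The corner cut out by \<open>E \<mu> \<mu>\<close> and \<open>E \<nu> \<nu>\<close> is the single coefficient, and units have norm 1.
\<close>

lemma coefficient_le_norm_comb:
  assumes "\<mu> \<in> X" "\<nu> \<in> X" "r \<mu> = r \<nu>"
  shows "cmod (c \<mu> \<nu>) \<le> norm (comb X r E c)"
proof -
  let ?\<delta> = "\<lambda>\<mu> \<nu> \<kappa> \<eta>. if \<kappa> = \<mu> \<and> \<eta> = \<nu> then 1 else 0 :: complex"
  have left: "matrix_times X r (?\<delta> \<mu> \<mu>) c \<kappa> \<eta> = (if \<kappa> = \<mu> then c \<mu> \<eta> else 0)" for \<kappa> \<eta>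
  proof -
    have "matrix_times X r (?\<delta> \<mu> \<mu>) c \<kappa> \<eta> = (\<Sum>\<kappa>'\<in>X. if \<kappa>' = \<mu> then (if \<kappa> = \<mu> then c \<mu> \<eta> else 0) else 0)"
      unfolding matrix_times_def by (rule sum.cong) auto
    then show ?thesis using assms(1) finite_labels by simp
  qed
  have right: "matrix_times X r d (?\<delta> \<nu> \<nu>) \<kappa> \<eta> = (if \<eta> = \<nu> \<and> r \<kappa> = r \<nu> then d \<kappa> \<nu> else 0)" for d \<kappa> \<eta>
  proof -
    have "matrix_times X r d (?\<delta> \<nu> \<nu>) \<kappa> \<eta> = (\<Sum>\<kappa>'\<in>X. if \<kappa>' = \<nu> then (if \<eta> = \<nu> \<and> r \<kappa> = r \<nu> then d \<kappa> \<nu> else 0) else 0)"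
      unfolding matrix_times_def by (rule sum.cong) auto
    then show ?thesis using assms(2) finite_labels by simp
  qed
  have "E \<mu> \<mu> * comb X r E c * E \<nu> \<nu> = c \<mu> \<nu> *\<^sub>C comb X r E (?\<delta> \<mu> \<nu>)"
    unfolding unit_eq_comb[OF assms(1) assms(1) refl] unit_eq_comb[OF assms(2) assms(2) refl]
      comb_mult comb_scaleC
    by (intro comb_cong) (auto simp: left right)
  then have "norm (c \<mu> \<nu> *\<^sub>C E \<mu> \<nu>) = norm (E \<mu> \<mu> * comb X r E c * E \<nu> \<nu>)"
    using unit_eq_comb[OF assms] by simp
  also have "\<dots> \<le> norm (E \<mu> \<mu>) * norm (comb X r E c) * norm (E \<nu> \<nu>)"
    by (meson mult_right_mono norm_ge_zero norm_mult_ineq order_trans)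
  finally show ?thesis
    using assms by (simp add: norm_scaleC norm_unit)
qed

lemma comb_coefficients_unique:
  assumes "comb X r E c = comb X r E d" "\<mu> \<in> X" "\<nu> \<in> X" "r \<mu> = r \<nu>"
  shows "c \<mu> \<nu> = d \<mu> \<nu>"
proof -
  have "comb X r E (\<lambda>\<mu> \<nu>. c \<mu> \<nu> - d \<mu> \<nu>) = 0"
    using assms(1) comb_diff[of X r E c d] by simp
  then show ?thesis
    using coefficient_le_norm_comb[of \<mu> \<nu> "\<lambda>\<mu> \<nu>. c \<mu> \<nu> - d \<mu> \<nu>"] assms(2-4) by simp
qed

lemma norm_comb_le_sum: "norm (comb X r E c) \<le> (\<Sum>(\<mu>, \<nu>)\<in>range_pairs X r. cmod (c \<mu> \<nu>))"
  unfolding comb_def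
  by (intro sum_norm_le) (auto simp: norm_scaleC norm_unit range_pairs_def)

end

text \<open>
  A finite-dimensional \<open>*\<close>-algebra carries only one C*-norm: both norms dominate the coefficients
  and are dominated by their sum, so the identification is bounded in both directions, and hence
  isometric.
\<close>

lemma matrix_units_isometric:
  assumes E: "matrix_units X r E" and E': "matrix_units X r E'"
  shows "norm (comb X r E' c) = norm (comb X r E c)"
proof -
  have le: "norm (comb X r U' c) \<le> norm (comb X r U c)"
    if U: "matrix_units X r U" and U': "matrix_units X r U'"
    for U :: "'a \<Rightarrow> 'a \<Rightarrow> 'y::cstar_algebra" and U' :: "'a \<Rightarrow> 'a \<Rightarrow> 'z::cstar_algebra"
  proof (rule star_hom_contractive[where m = "matrix_times X r" and s = adjoint_matrix
        and f = "comb X r U" and g = "comb X r U'" and K = "real (card (range_pairs X r))"])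
    fix c
    have "norm (comb X r U' c) \<le> (\<Sum>(\<mu>, \<nu>)\<in>range_pairs X r. cmod (c \<mu> \<nu>))"
      by (rule matrix_units.norm_comb_le_sum[OF U'])
    also have "\<dots> \<le> (\<Sum>p\<in>range_pairs X r. norm (comb X r U c))"
      by (intro sum_mono) (auto simp: range_pairs_def matrix_units.coefficient_le_norm_comb[OF U])
    finally show "norm (comb X r U' c) \<le> real (card (range_pairs X r)) * norm (comb X r U c)"
      by simp
  qed (simp_all add: matrix_units.comb_mult[OF U] matrix_units.comb_mult[OF U']
      matrix_units.comb_star[OF U] matrix_units.comb_star[OF U'])
  show ?thesis using le[OF E E'] le[OF E' E] by simp
qed

section \<open>Paths\<close>

lemma path_range_snoc [simp]: "path_range G u (\<mu> @ [a]) = head G a"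
  by (simp add: pre_digraph.awalk_verts_conv)

lemma path_range_Nil [simp]: "path_range G u [] = u"
  by (simp add: pre_digraph.awalk_verts_conv)

lemma cas_snoc: "pre_digraph.cas G u (\<mu> @ [a]) v \<longleftrightarrow> pre_digraph.cas G u \<mu> (tail G a) \<and> head G a = v"
  by (induction \<mu> arbitrary: u) (auto simp: pre_digraph.cas.simps)

lemma cas_path_range: "pre_digraph.cas G u \<mu> v \<Longrightarrow> path_range G u \<mu> = v"
  by (cases \<mu> rule: rev_cases) (auto simp: cas_snoc pre_digraph.cas.simps)

lemma paths_0: "v0 \<in> verts G \<Longrightarrow> paths G v0 0 = {[]}"
  by (auto simp: paths_def pre_digraph.awalk_def pre_digraph.cas.simps)

lemma length_paths: "\<mu> \<in> paths G v0 n \<Longrightarrow> length \<mu> = n"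
  by (simp add: paths_def)

lemma mem_paths:
  "\<mu> \<in> paths G v0 n \<longleftrightarrow> length \<mu> = n \<and> v0 \<in> verts G \<and> set \<mu> \<subseteq> arcs G \<and>
    pre_digraph.cas G v0 \<mu> (path_range G v0 \<mu>)"
  unfolding paths_def pre_digraph.awalk_def mem_Collect_eq by (metis cas_path_range)

lemma snoc_in_paths:
  "\<mu> @ [a] \<in> paths G v0 (Suc n) \<longleftrightarrow>
    \<mu> \<in> paths G v0 n \<and> a \<in> arcs G \<and> tail G a = path_range G v0 \<mu>"
proof -
  have "pre_digraph.cas G v0 \<mu> (tail G a) \<longleftrightarrow>
      pre_digraph.cas G v0 \<mu> (path_range G v0 \<mu>) \<and> tail G a = path_range G v0 \<mu>"
    using cas_path_range[of G v0 \<mu> "tail G a"] by metis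
  then show ?thesis by (auto simp: mem_paths cas_snoc)
qed

lemma paths_SucE:
  assumes "\<mu> \<in> paths G v0 (Suc n)"
  obtains \<nu> a where "\<mu> = \<nu> @ [a]" "\<nu> \<in> paths G v0 n" "a \<in> arcs G" "tail G a = path_range G v0 \<nu>"
proof (cases \<mu> rule: rev_cases)
  case Nil
  then show ?thesis using assms by (simp add: mem_paths)
next
  case (snoc \<nu> a)
  then show ?thesis using assms that[of \<nu> a] by (simp add: snoc_in_paths)
qed

lemma paths_Suc:
  "paths G v0 (Suc n) = (\<lambda>(\<mu>, a). \<mu> @ [a]) ` (SIGMA \<mu>:paths G v0 n. out_arcs G (path_range G v0 \<mu>))"
proof (intro equalityI subsetI)
  fix \<mu> assume "\<mu> \<in> paths G v0 (Suc n)"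
  then obtain \<nu> a where "\<mu> = \<nu> @ [a]" "\<nu> \<in> paths G v0 n" "a \<in> arcs G" "tail G a = path_range G v0 \<nu>"
    by (rule paths_SucE)
  then show "\<mu> \<in> (\<lambda>(\<mu>, a). \<mu> @ [a]) ` (SIGMA \<mu>:paths G v0 n. out_arcs G (path_range G v0 \<mu>))"
    by (intro image_eqI[of _ _ "(\<nu>, a)"]) simp_all
next
  fix \<mu> assume "\<mu> \<in> (\<lambda>(\<mu>, a). \<mu> @ [a]) ` (SIGMA \<mu>:paths G v0 n. out_arcs G (path_range G v0 \<mu>))"
  then obtain \<nu> a where "\<mu> = \<nu> @ [a]" "\<nu> \<in> paths G v0 n" "a \<in> out_arcs G (path_range G v0 \<nu>)"
    by (auto simp del: in_out_arcs_conv)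
  then show "\<mu> \<in> paths G v0 (Suc n)" by (simp add: snoc_in_paths)
qed

lemma path_potential_snoc [simp]: "path_potential F (\<mu> @ [a]) = path_potential F \<mu> + F a"
  by (simp add: path_potential_def)

context bratteli_diagram
begin

lemma root_in_verts: "v0 \<in> verts Br"
  using level_0 verts_eq_levels by blast

lemma path_range_level: "\<mu> \<in> paths Br v0 n \<Longrightarrow> path_range Br v0 \<mu> \<in> level n"
proof (induction n arbitrary: \<mu>)
  case 0
  then show ?case by (simp add: paths_0[OF root_in_verts] level_0)
next
  case (Suc n)
  obtain \<nu> a where *: "\<mu> = \<nu> @ [a]" "\<nu> \<in> paths Br v0 n" "a \<in> arcs Br" "tail Br a = path_range Br v0 \<nu>"
    using Suc.prems by (rule paths_SucE)
  have "tail Br a \<in> level n" unfolding *(4) by (rule Suc.IH[OF *(2)])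
  then have "head Br a \<in> level (Suc n)" by (rule arcs_level[OF *(3)])
  then show ?case unfolding *(1) path_range_snoc .
qed

lemma path_range_in_verts: "\<mu> \<in> paths Br v0 n \<Longrightarrow> path_range Br v0 \<mu> \<in> verts Br"
  using path_range_level[of \<mu> n] unfolding verts_eq_levels by blast

lemma finite_paths: "finite (paths Br v0 n)"
proof (induction n)
  case 0
  then show ?case by (simp add: paths_0[OF root_in_verts])
next
  case (Suc n)
  then show ?case
    unfolding paths_Suc by (intro finite_imageI finite_SigmaI) (auto simp: emits_finite path_range_in_verts)
qed

end

section \<open>Linear contractions out of an AF-algebra\<close>

lemma unit_indices_eq: "unit_indices G v0 n = range_pairs (paths G v0 n) (path_range G v0)"
  by (auto simp: unit_indices_def range_pairs_def)

lemma unit_combination_eq: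
  "unit_combination G v0 E n c = comb (paths G v0 n) (path_range G v0) E c"
  by (simp add: unit_combination_def comb_def unit_indices_eq)

lemma mem_unit_indices:
  "(\<mu>, \<nu>) \<in> unit_indices G v0 n \<longleftrightarrow>
    \<mu> \<in> paths G v0 n \<and> \<nu> \<in> paths G v0 n \<and> path_range G v0 \<mu> = path_range G v0 \<nu>"
  by (simp add: unit_indices_def)

lemmas unit_combination_add = comb_add[of "paths G v0 n" "path_range G v0" for G v0 n, folded unit_combination_eq]
lemmas unit_combination_diff = comb_diff[of "paths G v0 n" "path_range G v0" for G v0 n, folded unit_combination_eq]
lemmas unit_combination_scaleC = comb_scaleC[of _ "paths G v0 n" "path_range G v0" for G v0 n, folded unit_combination_eq]

lemma unit_combination_cong:
  assumes "\<And>\<mu> \<nu>. (\<mu>, \<nu>) \<in> unit_indices G v0 n \<Longrightarrow> c \<mu> \<nu> *\<^sub>C E \<mu> \<nu> = d \<mu> \<nu> *\<^sub>C E' \<mu> \<nu>"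
  shows "unit_combination G v0 E n c = unit_combination G v0 E' n d"
  unfolding unit_combination_eq using assms by (intro comb_cong) (simp add: mem_unit_indices)

lemma unit_combination_linear:
  assumes "\<And>x y. f (x + y) = f x + f y" "\<And>z x. f (z *\<^sub>C x) = z *\<^sub>C f x"
    and "\<And>\<mu> \<nu>. (\<mu>, \<nu>) \<in> unit_indices G v0 n \<Longrightarrow> f (E \<mu> \<nu>) = W \<mu> \<nu>"
  shows "f (unit_combination G v0 E n c) = unit_combination G v0 W n c"
  unfolding unit_combination_eq comb_additive[of f, OF assms(1,2)]
  by (intro comb_cong) (simp add: assms(3) mem_unit_indices)

lemma AF_algebra_matrix_units:
  assumes AF: "AF_algebra G v0 E" and fin: "finite (paths G v0 n)"
  shows "matrix_units (paths G v0 n) (path_range G v0) E"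
proof
  fix \<mu> assume \<mu>: "\<mu> \<in> paths G v0 n"
  show "E \<mu> \<mu> \<noteq> 0"
  proof
    assume 0: "E \<mu> \<mu> = 0"
    define c where "c \<kappa> \<eta> = (if \<kappa> = \<mu> \<and> \<eta> = \<mu> then 1 else 0 :: complex)" for \<kappa> \<eta>
    have "unit_combination G v0 E n c = 0"
      unfolding unit_combination_def by (intro sum.neutral) (auto simp: c_def 0)
    then have "c \<mu> \<mu> = 0"
      using AF_algebra.units_independent[OF AF, of n c \<mu> \<mu>] \<mu> by (simp add: mem_unit_indices)
    then show False by (simp add: c_def)
  qed
qed (use AF_algebra.units_mult[OF AF] AF_algebra.units_star[OF AF] fin in
    \<open>simp_all add: mem_unit_indices\<close>)

definition linear_contraction :: "('a::cstar_algebra \<Rightarrow> 'b::cstar_algebra) \<Rightarrow> bool" where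
  "linear_contraction T \<longleftrightarrow>
     (\<forall>x y. T (x + y) = T x + T y) \<and> (\<forall>c x. T (c *\<^sub>C x) = c *\<^sub>C T x) \<and> (\<forall>x. norm (T x) \<le> norm x)"

lemma
  assumes "linear_contraction T"
  shows linear_contraction_add: "T (x + y) = T x + T y"
    and linear_contraction_scaleC: "T (c *\<^sub>C x) = c *\<^sub>C T x"
    and linear_contraction_norm: "norm (T x) \<le> norm x"
  using assms by (auto simp: linear_contraction_def)

lemma linear_contraction_bounded_linear: "linear_contraction T \<Longrightarrow> bounded_linear T"
  by (rule bounded_linear_intro[where K = 1]) (auto simp: linear_contraction_def scaleR_eq_scaleC)

lemmas linear_contraction_diff = linear_diff[OF bounded_linear.linear[OF linear_contraction_bounded_linear]]

lemmas linear_contraction_zero = linear_0[OF bounded_linear.linear[OF linear_contraction_bounded_linear]]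

lemmas linear_contraction_tendsto = bounded_linear.tendsto[OF linear_contraction_bounded_linear]

lemmas linear_contraction_continuous = linear_continuous_on[OF linear_contraction_bounded_linear]

lemma linear_contraction_unit_combination:
  assumes "linear_contraction T" "\<And>\<mu> \<nu>. (\<mu>, \<nu>) \<in> unit_indices G v0 n \<Longrightarrow> T (E \<mu> \<nu>) = W \<mu> \<nu>"
  shows "T (unit_combination G v0 E n c) = unit_combination G v0 W n c"
  using assms by (intro unit_combination_linear) (auto simp: linear_contraction_def)

text \<open>
  Refinement turns \<open>E \<mu> \<nu>\<close> into the sum of the \<open>E (\<mu> @ [a]) (\<nu> @ [a])\<close>, with the same last arrow on both
  sides; these are the coefficients at the next level.
\<close>

definition refine_matrix :: "('e list \<Rightarrow> 'e list \<Rightarrow> complex) \<Rightarrow> 'e list \<Rightarrow> 'e list \<Rightarrow> complex" where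
  "refine_matrix c \<mu> \<nu> = (if last \<mu> = last \<nu> then c (butlast \<mu>) (butlast \<nu>) else 0)"

definition refines :: "('v, 'e) pre_digraph \<Rightarrow> 'v \<Rightarrow> ('e list \<Rightarrow> 'e list \<Rightarrow> 'a::cstar_algebra) \<Rightarrow> bool" where
  "refines G v0 W \<longleftrightarrow> (\<forall>n. \<forall>(\<mu>, \<nu>)\<in>unit_indices G v0 n.
     W \<mu> \<nu> = (\<Sum>a\<in>out_arcs G (path_range G v0 \<mu>). W (\<mu> @ [a]) (\<nu> @ [a])))"

lemma refinesD:
  assumes "refines G v0 W" "(\<mu>, \<nu>) \<in> unit_indices G v0 n"
  shows "(\<Sum>a\<in>out_arcs G (path_range G v0 \<mu>). W (\<mu> @ [a]) (\<nu> @ [a])) = W \<mu> \<nu>"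
  using bspec[OF spec[OF assms(1)[unfolded refines_def]] assms(2)] unfolding prod.case by (rule sym)

locale bratteli_AF = bratteli_diagram Br level v0 + AF_algebra Br v0 E
  for Br :: "('v, 'e) pre_digraph" and level v0 and E :: "'e list \<Rightarrow> 'e list \<Rightarrow> 'a::cstar_algebra"
begin

text \<open>
  The family of units stays an argument of \<open>uc\<close>: the values of a linear map on the units form such a
  family, and the map takes \<open>uc E n c\<close> to the combination of its values.
\<close>

abbreviation "uc \<equiv> unit_combination Br v0"

lemma matrix_units_level: "matrix_units (paths Br v0 n) (path_range Br v0) E"
  by (rule AF_algebra_matrix_units[OF _ finite_paths]) unfold_locales

lemma finite_unit_indices: "finite (unit_indices Br v0 n)"
  unfolding unit_indices_eq using matrix_units.finite_range_pairs[OF matrix_units_level] .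

lemma uc_mult:
  "uc E n c * uc E n d = uc E n (matrix_times (paths Br v0 n) (path_range Br v0) c d)"
  unfolding unit_combination_eq by (rule matrix_units.comb_mult[OF matrix_units_level])

lemma uc_star: "star (uc E n c) = uc E n (adjoint_matrix c)"
  unfolding unit_combination_eq by (rule matrix_units.comb_star[OF matrix_units_level])

lemma unit_eq_uc:
  "(\<mu>, \<nu>) \<in> unit_indices Br v0 n \<Longrightarrow> E \<mu> \<nu> = uc E n (\<lambda>\<kappa> \<eta>. if \<kappa> = \<mu> \<and> \<eta> = \<nu> then 1 else 0)"
  unfolding unit_combination_eq mem_unit_indices
  by (rule matrix_units.unit_eq_comb[OF matrix_units_level]) auto

lemma refines_E: "refines Br v0 E"
  unfolding refines_def using units_refine by blast

lemma uc_refine: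
  assumes "refines Br v0 W"
  shows "uc W n c = uc W (Suc n) (refine_matrix c)"
proof -
  let ?I = "unit_indices Br v0"
  let ?S = "SIGMA p:?I n. out_arcs Br (path_range Br v0 (fst p))"
  let ?h = "\<lambda>(p, a). (fst p @ [a], snd p @ [a])"
  let ?g = "\<lambda>p. refine_matrix c (fst p) (snd p) *\<^sub>C W (fst p) (snd p)"
  have fin: "finite (out_arcs Br (path_range Br v0 (fst p)))" if "p \<in> ?I n" for p
    using that by (auto simp: unit_indices_def emits_finite path_range_in_verts)
  have W: "(\<Sum>a\<in>out_arcs Br (path_range Br v0 (fst p)). W (fst p @ [a]) (snd p @ [a])) = W (fst p) (snd p)"
    if "p \<in> ?I n" for p
    using refinesD[OF assms, of "fst p" "snd p" n] that by simp
  have inj: "inj_on ?h ?S" by (auto simp: inj_on_def)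
  have sub: "?h ` ?S \<subseteq> ?I (Suc n)"
    by (auto simp: unit_indices_def snoc_in_paths)
  have zero: "?g p = 0" if "p \<in> ?I (Suc n) - ?h ` ?S" for p
  proof -
    obtain \<mu> \<nu> where p: "p = (\<mu>, \<nu>)" by (cases p)
    with that have "\<mu> \<in> paths Br v0 (Suc n)" "\<nu> \<in> paths Br v0 (Suc n)"
      by (auto simp: unit_indices_def)
    then obtain \<mu>' a \<nu>' b where *: "\<mu> = \<mu>' @ [a]" "\<nu> = \<nu>' @ [b]" "\<mu>' \<in> paths Br v0 n" "\<nu>' \<in> paths Br v0 n"
      "a \<in> arcs Br" "tail Br a = path_range Br v0 \<mu>'" "tail Br b = path_range Br v0 \<nu>'"
      by (metis paths_SucE)
    have "a \<noteq> b"
    proof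
      assume "a = b"
      then have "p = ?h ((\<mu>', \<nu>'), a)" "((\<mu>', \<nu>'), a) \<in> ?S"
        using * by (auto simp: p unit_indices_def)
      then show False using that by blast
    qed
    then show ?thesis by (simp add: p * refine_matrix_def)
  qed
  have "uc W (Suc n) (refine_matrix c) = sum ?g (?I (Suc n))"
    by (simp add: unit_combination_def case_prod_unfold)
  also have "\<dots> = sum ?g (?h ` ?S)"
    using zero sub finite_unit_indices by (intro sum.mono_neutral_right) auto
  also have "\<dots> = sum (?g \<circ> ?h) ?S" by (rule sum.reindex[OF inj])
  also have "\<dots> = (\<Sum>(p, a)\<in>?S. c (fst p) (snd p) *\<^sub>C W (fst p @ [a]) (snd p @ [a]))"
    by (intro sum.cong refl) (auto simp: refine_matrix_def)
  also have "\<dots> = (\<Sum>p\<in>?I n. \<Sum>a\<in>out_arcs Br (path_range Br v0 (fst p)).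
      c (fst p) (snd p) *\<^sub>C W (fst p @ [a]) (snd p @ [a]))"
    using fin finite_unit_indices by (intro sum.Sigma[symmetric]) auto
  also have "\<dots> = (\<Sum>p\<in>?I n. c (fst p) (snd p) *\<^sub>C W (fst p) (snd p))"
    by (intro sum.cong refl) (simp add: W flip: scaleC_sum_right)
  finally show ?thesis by (simp add: unit_combination_def case_prod_unfold)
qed

lemma uc_raise:
  assumes "n \<le> m" and W: "refines Br v0 W"
  shows "\<exists>d. uc W n c = uc W m d \<and> uc E n c = uc E m d"
  using assms(1)
proof (induction m rule: dec_induct)
  case base
  then show ?case by blast
next
  case (step m)
  then obtain d where d: "uc W n c = uc W m d" "uc E n c = uc E m d" by blast
  have "uc W n c = uc W (Suc m) (refine_matrix d)" "uc E n c = uc E (Suc m) (refine_matrix d)"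
    using d uc_refine[OF W, of m d] uc_refine[OF refines_E, of m d] by (simp_all only:)
  then show ?case by (intro exI conjI)
qed

lemma AF_closed_induct:
  assumes "closed {x. P x}" "\<And>n c. P (uc E n c)"
  shows "P x"
proof -
  have "closure (\<Union>n. AF_level Br v0 E n) \<subseteq> {x. P x}"
    using assms by (intro closure_minimal) (auto simp: AF_level_def)
  then show ?thesis using dense_levels by auto
qed

text \<open>
  Any two elements of the dense subalgebra lie in a common level.
\<close>

lemma AF_closed_induct2:
  assumes "\<And>y. closed {x. P x y}" "\<And>x. closed {y. P x y}" "\<And>n c d. P (uc E n c) (uc E n d)"
  shows "P x y"
proof (rule AF_closed_induct[of "\<lambda>x. P x y"], rule assms(1))
  fix n c
  show "P (uc E n c) y"
  proof (rule AF_closed_induct[of "P (uc E n c)"], rule assms(2))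
    fix m d
    obtain c' where "uc E n c = uc E (max n m) c'"
      using uc_raise[of n "max n m" E c, OF max.cobounded1 refines_E] by (elim exE conjE)
    moreover obtain d' where "uc E m d = uc E (max n m) d'"
      using uc_raise[of m "max n m" E d, OF max.cobounded2 refines_E] by (elim exE conjE)
    ultimately show "P (uc E n c) (uc E m d)" using assms(3) by simp
  qed
qed

lemma AF_sequence:
  obtains n :: "nat \<Rightarrow> nat" and c where "(\<lambda>k. uc E (n k) (c k)) \<longlonglongrightarrow> x"
proof -
  have "x \<in> closure (\<Union>n. AF_level Br v0 E n)" using dense_levels by simp
  then obtain X where X: "\<And>k. X k \<in> (\<Union>n. AF_level Br v0 E n)" "X \<longlonglongrightarrow> x"
    unfolding closure_sequential by blast
  then have "\<forall>k. \<exists>n c. X k = uc E n c" unfolding AF_level_def by blast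
  then obtain n c where "\<And>k. X k = uc E (n k) (c k)" by metis
  then have "X = (\<lambda>k. uc E (n k) (c k))" by (rule ext)
  then show ?thesis using X(2) that[of n c] by simp
qed

text \<open>
  Compatibility with refinement makes the values on different levels agree, contractivity makes the
  map on the dense subalgebra well defined and uniformly continuous.  The flow, its mean and the
  compression to the geodesics all arise in this way.
\<close>

lemma contraction_extension:
  fixes W :: "'e list \<Rightarrow> 'e list \<Rightarrow> 'c::cstar_algebra"
  assumes W: "refines Br v0 W" and le: "\<And>n c. norm (uc W n c) \<le> norm (uc E n c)"
  shows "\<exists>T. linear_contraction T \<and> (\<forall>n c. T (uc E n c) = uc W n c)"
proof -
  define D where "D = (\<Union>n. AF_level Br v0 E n)"
  have D: "x \<in> D \<longleftrightarrow> (\<exists>n c. x = uc E n c)" for x by (auto simp: D_def AF_level_def)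
  have lip: "norm (uc W n c - uc W m d) \<le> norm (uc E n c - uc E m d)" for n c m d
  proof -
    obtain c' where c': "uc W n c = uc W (max n m) c'" "uc E n c = uc E (max n m) c'"
      using uc_raise[of n "max n m" W c, OF max.cobounded1 W] by (elim exE conjE)
    obtain d' where d': "uc W m d = uc W (max n m) d'" "uc E m d = uc E (max n m) d'"
      using uc_raise[of m "max n m" W d, OF max.cobounded2 W] by (elim exE conjE)
    show ?thesis unfolding c' d' unit_combination_diff by (rule le)
  qed
  define f where "f x = (SOME y. \<exists>n c. x = uc E n c \<and> y = uc W n c)" for x
  have f: "f (uc E n c) = uc W n c" for n c
  proof -
    have "\<exists>m d. uc E n c = uc E m d \<and> f (uc E n c) = uc W m d"
      unfolding f_def by (rule someI_ex) blast
    then obtain m d where md: "uc E n c = uc E m d" "f (uc E n c) = uc W m d" by blast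
    then show ?thesis using lip[of m d n c] by simp
  qed
  have "dist (f x) (f y) \<le> dist x y" if "x \<in> D" "y \<in> D" for x y
    using that lip unfolding D by (auto simp: dist_norm f)
  then have "uniformly_continuous_on D f"
    unfolding uniformly_continuous_on_def by (meson order_le_less_trans)
  then obtain T where T: "uniformly_continuous_on (closure D) T" "\<And>x. x \<in> D \<Longrightarrow> f x = T x"
    by (rule uniformly_continuous_on_extension_on_closure) blast
  have closure: "closure D = UNIV" by (simp add: D_def dense_levels)
  have contT: "continuous_on UNIV T" using T(1) closure uniformly_continuous_imp_continuous by auto
  have Tuc: "T (uc E n c) = uc W n c" for n c using T(2) f D by metis
  have cont: "continuous_on UNIV (\<lambda>x. T (h x))" if "continuous_on UNIV h" for h :: "'a \<Rightarrow> 'a"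
    using continuous_on_compose2[OF contT that] by simp
  note cont_scale = linear_continuous_on[OF bounded_linear_scaleC_right]
  have add: "T (x + y) = T x + T y" for x y
  proof (rule AF_closed_induct2[of "\<lambda>x y. T (x + y) = T x + T y"])
    show "closed {x. T (x + y) = T x + T y}" for y
      by (intro closed_Collect_eq continuous_on_add cont continuous_on_id continuous_on_const)
    show "closed {y. T (x + y) = T x + T y}" for x
      by (intro closed_Collect_eq continuous_on_add cont continuous_on_id continuous_on_const)
    show "T (uc E n c + uc E n d) = T (uc E n c) + T (uc E n d)" for n c d
      by (simp add: unit_combination_add Tuc)
  qed
  have scale: "T (c *\<^sub>C x) = c *\<^sub>C T x" for c x
  proof (rule AF_closed_induct[of "\<lambda>x. T (c *\<^sub>C x) = c *\<^sub>C T x"])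
    show "closed {x. T (c *\<^sub>C x) = c *\<^sub>C T x}"
      by (intro closed_Collect_eq cont cont_scale continuous_on_compose2[OF cont_scale contT]) auto
    show "T (c *\<^sub>C uc E n d) = c *\<^sub>C T (uc E n d)" for n d
      by (simp add: unit_combination_scaleC Tuc)
  qed
  have "norm (T x) \<le> norm x" for x
  proof (rule AF_closed_induct[of "\<lambda>x. norm (T x) \<le> norm x"])
    show "closed {x. norm (T x) \<le> norm x}"
      by (intro closed_Collect_le continuous_intros contT)
    show "norm (T (uc E n c)) \<le> norm (uc E n c)" for n c by (simp add: Tuc le)
  qed
  then show ?thesis using add scale Tuc unfolding linear_contraction_def by blast
qed

end

section \<open>The gauge flow\<close>

locale gauge_system = bratteli_AF Br level v0 E
  for Br :: "('v, 'e) pre_digraph" and level v0 and E :: "'e list \<Rightarrow> 'e list \<Rightarrow> 'a::cstar_algebra" +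
  fixes F :: "'e \<Rightarrow> real"
begin

definition freq :: "'e list \<Rightarrow> 'e list \<Rightarrow> real" where
  "freq \<mu> \<nu> = path_potential F \<mu> - path_potential F \<nu>"

definition phase :: "real \<Rightarrow> 'e list \<Rightarrow> 'e list \<Rightarrow> complex" where
  "phase t \<mu> \<nu> = exp (\<i> * of_real (t * freq \<mu> \<nu>))"

lemma freq_snoc [simp]: "freq (\<mu> @ [a]) (\<nu> @ [a]) = freq \<mu> \<nu>"
  by (simp add: freq_def)

lemma phase_snoc [simp]: "phase t (\<mu> @ [a]) (\<nu> @ [a]) = phase t \<mu> \<nu>"
  by (simp add: phase_def)

lemma phase_refl [simp]: "phase t \<mu> \<mu> = 1"
  by (simp add: phase_def freq_def)

lemma phase_0 [simp]: "phase 0 \<mu> \<nu> = 1"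
  by (simp add: phase_def)

lemma phase_add: "phase (s + t) \<mu> \<nu> = phase s \<mu> \<nu> * phase t \<mu> \<nu>"
  by (simp add: phase_def algebra_simps flip: exp_add)

lemma phase_trans: "phase t \<mu> \<kappa> * phase t \<kappa> \<nu> = phase t \<mu> \<nu>"
  by (simp add: phase_def freq_def algebra_simps flip: exp_add)

lemma cnj_phase: "cnj (phase t \<mu> \<nu>) = phase t \<nu> \<mu>"
  by (simp add: phase_def freq_def exp_cnj algebra_simps)

lemma norm_phase [simp]: "cmod (phase t \<mu> \<nu>) = 1"
  by (simp add: phase_def)

lemma uc_weight:
  "uc (\<lambda>\<mu> \<nu>. w \<mu> \<nu> *\<^sub>C E \<mu> \<nu>) n c = uc E n (\<lambda>\<mu> \<nu>. w \<mu> \<nu> * c \<mu> \<nu>)"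
  by (rule unit_combination_cong) (simp add: scaleC_scaleC mult.commute)

text \<open>
  Schur multipliers: the weights must not change when both paths are extended by the same arrow.
\<close>

lemma multiplier_extension:
  assumes w: "\<And>\<mu> \<nu> a. w (\<mu> @ [a]) (\<nu> @ [a]) = w \<mu> \<nu>"
    and le: "\<And>n c. norm (uc E n (\<lambda>\<mu> \<nu>. w \<mu> \<nu> * c \<mu> \<nu>)) \<le> norm (uc E n c)"
  shows "\<exists>T. linear_contraction T \<and> (\<forall>n c. T (uc E n c) = uc E n (\<lambda>\<mu> \<nu>. w \<mu> \<nu> * c \<mu> \<nu>))"
proof -
  let ?W = "\<lambda>\<mu> \<nu>. w \<mu> \<nu> *\<^sub>C E \<mu> \<nu>"
  have "refines Br v0 ?W"
    unfolding refines_def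
  proof safe
    fix n \<mu> \<nu> assume "(\<mu>, \<nu>) \<in> unit_indices Br v0 n"
    then show "w \<mu> \<nu> *\<^sub>C E \<mu> \<nu> =
        (\<Sum>a\<in>out_arcs Br (path_range Br v0 \<mu>). w (\<mu> @ [a]) (\<nu> @ [a]) *\<^sub>C E (\<mu> @ [a]) (\<nu> @ [a]))"
      using refinesD[OF refines_E, of \<mu> \<nu> n] by (simp add: w flip: scaleC_sum_right)
  qed
  from contraction_extension[OF this] le show ?thesis
    by (simp add: uc_weight)
qed

text \<open>
  The twisted matrix units are again matrix units, so twisting is isometric on each level.
\<close>

lemma norm_uc_phase: "norm (uc E n (\<lambda>\<mu> \<nu>. phase t \<mu> \<nu> * c \<mu> \<nu>)) = norm (uc E n c)"
proof -
  interpret M: matrix_units "paths Br v0 n" "path_range Br v0" E by (rule matrix_units_level)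
  have "matrix_units (paths Br v0 n) (path_range Br v0) (\<lambda>\<mu> \<nu>. phase t \<mu> \<nu> *\<^sub>C E \<mu> \<nu>)"
  proof
    fix \<mu> \<mu>' \<nu> \<nu>'
    assume *: "\<mu> \<in> paths Br v0 n" "\<mu>' \<in> paths Br v0 n" "path_range Br v0 \<mu> = path_range Br v0 \<mu>'"
      "\<nu> \<in> paths Br v0 n" "\<nu>' \<in> paths Br v0 n" "path_range Br v0 \<nu> = path_range Br v0 \<nu>'"
    have "phase t \<mu> \<mu>' *\<^sub>C E \<mu> \<mu>' * phase t \<nu> \<nu>' *\<^sub>C E \<nu> \<nu>' =
        (phase t \<mu> \<mu>' * phase t \<nu> \<nu>') *\<^sub>C (E \<mu> \<mu>' * E \<nu> \<nu>')"
      by (simp add: mult_scaleC_left mult_scaleC_right scaleC_scaleC mult.commute[of "phase t \<nu> \<nu>'"])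
    then show "phase t \<mu> \<mu>' *\<^sub>C E \<mu> \<mu>' * phase t \<nu> \<nu>' *\<^sub>C E \<nu> \<nu>' =
        (if \<mu>' = \<nu> then phase t \<mu> \<nu>' *\<^sub>C E \<mu> \<nu>' else 0)"
      by (simp only: M.mult_unit[OF *]) (simp add: phase_trans)
  qed (simp_all add: M.finite_labels M.star_unit M.unit_nonzero star_scaleC cnj_phase)
  from matrix_units_isometric[OF matrix_units_level this, of c] show ?thesis
    by (simp flip: unit_combination_eq add: uc_weight)
qed

definition flow_map :: "real \<Rightarrow> 'a \<Rightarrow> 'a" where
  "flow_map t = (SOME T. linear_contraction T \<and>
     (\<forall>n c. T (uc E n c) = uc E n (\<lambda>\<mu> \<nu>. phase t \<mu> \<nu> * c \<mu> \<nu>)))"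

lemma linear_contraction_flow_map: "linear_contraction (flow_map t)"
  and flow_map_uc: "flow_map t (uc E n c) = uc E n (\<lambda>\<mu> \<nu>. phase t \<mu> \<nu> * c \<mu> \<nu>)"
proof -
  have "\<exists>T. linear_contraction T \<and> (\<forall>n c. T (uc E n c) = uc E n (\<lambda>\<mu> \<nu>. phase t \<mu> \<nu> * c \<mu> \<nu>))"
    by (rule multiplier_extension) (simp_all add: norm_uc_phase)
  from someI_ex[OF this, folded flow_map_def]
  show "linear_contraction (flow_map t)"
    "flow_map t (uc E n c) = uc E n (\<lambda>\<mu> \<nu>. phase t \<mu> \<nu> * c \<mu> \<nu>)" by blast+
qed

lemma one_eq_uc: "1 = uc E 0 (\<lambda>\<mu> \<nu>. 1)"
proof -
  have "unit_indices Br v0 0 = {([], [])}"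
    by (auto simp: unit_indices_def paths_0[OF root_in_verts])
  then show ?thesis
    using units_sum[of 0] by (simp add: unit_combination_def paths_0[OF root_in_verts])
qed

text \<open>
  This is what makes the flow with prescribed values on the units unique.
\<close>

lemma AF_maps_eq:
  assumes f: "continuous_on UNIV f" "\<And>x y. f (x + y) = f x + f y" "\<And>c x. f (c *\<^sub>C x) = c *\<^sub>C f x"
    and g: "linear_contraction (g :: 'a \<Rightarrow> 'a)"
    and eq: "\<And>n \<mu> \<nu>. (\<mu>, \<nu>) \<in> unit_indices Br v0 n \<Longrightarrow> f (E \<mu> \<nu>) = g (E \<mu> \<nu>)"
  shows "f x = g x"
proof (rule AF_closed_induct[of "\<lambda>x. f x = g x"])
  show "closed {x. f x = g x}"
    by (intro closed_Collect_eq f(1) linear_contraction_continuous g)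
  show "f (uc E n c) = g (uc E n c)" for n c
    using unit_combination_linear[of f, OF f(2,3) eq]
      linear_contraction_unit_combination[OF g, of Br v0 n E "\<lambda>\<mu> \<nu>. g (E \<mu> \<nu>)"] by simp
qed

lemma flow_map_unit:
  assumes "(\<mu>, \<nu>) \<in> unit_indices Br v0 n"
  shows "flow_map t (E \<mu> \<nu>) = phase t \<mu> \<nu> *\<^sub>C E \<mu> \<nu>"
proof -
  have "flow_map t (E \<mu> \<nu>) = uc E n (\<lambda>\<kappa> \<eta>. phase t \<mu> \<nu> * (if \<kappa> = \<mu> \<and> \<eta> = \<nu> then 1 else 0))"
    unfolding unit_eq_uc[OF assms] flow_map_uc by (rule unit_combination_cong) simp
  then show ?thesis
    by (simp only: unit_combination_scaleC[symmetric] unit_eq_uc[OF assms, symmetric])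
qed

lemma flow_map_mult: "flow_map t (x * y) = flow_map t x * flow_map t y"
proof (rule AF_closed_induct2[of "\<lambda>x y. flow_map t (x * y) = flow_map t x * flow_map t y"])
  note cont = linear_contraction_continuous[OF linear_contraction_flow_map]
  show "closed {x. flow_map t (x * y) = flow_map t x * flow_map t y}" for y
    by (intro closed_Collect_eq continuous_on_mult cont continuous_on_compose2[OF cont] continuous_on_id
        continuous_on_const) auto
  show "closed {y. flow_map t (x * y) = flow_map t x * flow_map t y}" for x
    by (intro closed_Collect_eq continuous_on_mult cont continuous_on_compose2[OF cont] continuous_on_id
        continuous_on_const) auto
  show "flow_map t (uc E n c * uc E n d) = flow_map t (uc E n c) * flow_map t (uc E n d)" for n c d
    unfolding uc_mult flow_map_uc
  proof (rule unit_combination_cong)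
    fix \<mu> \<nu>
    show "(phase t \<mu> \<nu> * matrix_times (paths Br v0 n) (path_range Br v0) c d \<mu> \<nu>) *\<^sub>C E \<mu> \<nu> =
      matrix_times (paths Br v0 n) (path_range Br v0) (\<lambda>\<mu> \<nu>. phase t \<mu> \<nu> * c \<mu> \<nu>)
        (\<lambda>\<mu> \<nu>. phase t \<mu> \<nu> * d \<mu> \<nu>) \<mu> \<nu> *\<^sub>C E \<mu> \<nu>"
      unfolding matrix_times_def sum_distrib_left
    proof (intro arg_cong[where f = "\<lambda>z. z *\<^sub>C E \<mu> \<nu>"] sum.cong refl)
      fix \<kappa>
      have "phase t \<mu> \<nu> = phase t \<mu> \<kappa> * phase t \<kappa> \<nu>" by (simp add: phase_trans)
      then show "phase t \<mu> \<nu> * (if path_range Br v0 \<kappa> = path_range Br v0 \<mu> then c \<mu> \<kappa> * d \<kappa> \<nu> else 0) =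
          (if path_range Br v0 \<kappa> = path_range Br v0 \<mu>
           then phase t \<mu> \<kappa> * c \<mu> \<kappa> * (phase t \<kappa> \<nu> * d \<kappa> \<nu>) else 0)"
        by simp
    qed
  qed
qed

lemma flow_map_star: "flow_map t (star x) = star (flow_map t x)"
proof (rule AF_closed_induct[of "\<lambda>x. flow_map t (star x) = star (flow_map t x)"])
  note cont = linear_contraction_continuous[OF linear_contraction_flow_map]
  note star = linear_continuous_on[OF bounded_linear_star]
  show "closed {x. flow_map t (star x) = star (flow_map t x)}"
    by (intro closed_Collect_eq continuous_on_compose2[OF cont star] continuous_on_compose2[OF star cont]) auto
  show "flow_map t (star (uc E n c)) = star (flow_map t (uc E n c))" for n c
    unfolding uc_star flow_map_uc
    by (rule unit_combination_cong) (simp add: adjoint_matrix_def cnj_phase)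
qed

lemma flow_map_one: "flow_map t 1 = 1"
proof -
  have "flow_map t 1 = uc E 0 (\<lambda>\<mu> \<nu>. phase t \<mu> \<nu> * 1)" unfolding one_eq_uc flow_map_uc ..
  also have "\<dots> = uc E 0 (\<lambda>\<mu> \<nu>. 1)"
    by (rule unit_combination_cong) (simp add: unit_indices_def paths_0[OF root_in_verts])
  finally show ?thesis using one_eq_uc by simp
qed

lemma flow_map_0: "flow_map 0 x = x"
  by (rule AF_closed_induct[of "\<lambda>x. flow_map 0 x = x"])
    (intro closed_Collect_eq continuous_on_id linear_contraction_continuous linear_contraction_flow_map,
      simp add: flow_map_uc)

lemma flow_map_add: "flow_map (s + t) x = flow_map s (flow_map t x)"
proof (rule AF_closed_induct[of "\<lambda>x. flow_map (s + t) x = flow_map s (flow_map t x)"])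
  note cont = linear_contraction_continuous[OF linear_contraction_flow_map]
  show "closed {x. flow_map (s + t) x = flow_map s (flow_map t x)}"
    by (intro closed_Collect_eq cont continuous_on_compose2[OF cont cont]) auto
  show "flow_map (s + t) (uc E n c) = flow_map s (flow_map t (uc E n c))" for n c
    unfolding flow_map_uc by (rule unit_combination_cong) (simp add: phase_add mult.assoc)
qed

lemma flow_map_diff: "flow_map t (x - y) = flow_map t x - flow_map t y"
  by (rule linear_contraction_diff[OF linear_contraction_flow_map])

lemma norm_flow_map_le: "norm (flow_map t x) \<le> norm x"
  by (rule linear_contraction_norm[OF linear_contraction_flow_map])

text \<open>
  The orbit of an element of a level is trigonometric, and by contractivity a general orbit is a
  uniform limit of such orbits.
\<close>

lemma continuous_flow_map: "continuous_on UNIV (\<lambda>t. flow_map t x)"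
proof -
  obtain n c where X: "(\<lambda>k. uc E (n k) (c k)) \<longlonglongrightarrow> x" by (rule AF_sequence)
  have level: "continuous_on UNIV (\<lambda>t. flow_map t (uc E m d))" for m d
    unfolding flow_map_uc
    unfolding unit_combination_def case_prod_unfold phase_def
    by (intro continuous_on_sum linear_continuous_on[OF bounded_linear_scaleC_left, THEN continuous_on_compose2]
        continuous_intros) auto
  have "uniform_limit UNIV (\<lambda>k t. flow_map t (uc E (n k) (c k))) (\<lambda>t. flow_map t x) sequentially"
  proof (rule uniform_limitI)
    fix e :: real assume "e > 0"
    then have "\<forall>\<^sub>F k in sequentially. dist (uc E (n k) (c k)) x < e" using X tendstoD by blast
    then show "\<forall>\<^sub>F k in sequentially. \<forall>t\<in>UNIV. dist (flow_map t (uc E (n k) (c k))) (flow_map t x) < e"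
      by eventually_elim
        (metis dist_norm flow_map_diff norm_flow_map_le order_le_less_trans)
  qed
  then show ?thesis
    by (rule uniform_limit_theorem[rotated]) (simp_all add: level)
qed

lemma flow_flow_map: "flow flow_map"
  unfolding flow_def
proof (intro conjI allI)
  fix t
  show "star_hom_on UNIV (flow_map t)"
    unfolding star_hom_on_def
    using linear_contraction_flow_map[of t]
    by (auto simp: linear_contraction_add linear_contraction_scaleC flow_map_mult flow_map_star
        flow_map_one linear_contraction_continuous)
  show "bij (flow_map t)"
    by (rule bij_betw_byWitness[where f' = "flow_map (- t)"])
      (simp_all add: flow_map_0 flip: flow_map_add)
  show "flow_map 0 = id" by (simp add: fun_eq_iff flow_map_0)
  show "flow_map (s + t) = flow_map s \<circ> flow_map t" for s
    by (simp add: fun_eq_iff flow_map_add)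
qed (rule continuous_flow_map)

lemma gauge_action_eq: "gauge_action Br v0 E F = flow_map"
  unfolding gauge_action_def
proof (rule the_equality)
  show "flow flow_map \<and> (\<forall>t n. \<forall>(\<mu>, \<mu>')\<in>unit_indices Br v0 n. flow_map t (E \<mu> \<mu>') =
      exp (\<i> * of_real (t * (path_potential F \<mu> - path_potential F \<mu>'))) *\<^sub>C E \<mu> \<mu>')"
    using flow_flow_map by (auto simp: flow_map_unit phase_def freq_def)
next
  fix \<beta> :: "real \<Rightarrow> 'a \<Rightarrow> 'a"
  assume \<beta>: "flow \<beta> \<and> (\<forall>t n. \<forall>(\<mu>, \<mu>')\<in>unit_indices Br v0 n. \<beta> t (E \<mu> \<mu>') =
      exp (\<i> * of_real (t * (path_potential F \<mu> - path_potential F \<mu>'))) *\<^sub>C E \<mu> \<mu>')"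
  show "\<beta> = flow_map"
  proof (intro ext)
    fix t x
    have "star_hom_on UNIV (\<beta> t)" using \<beta> by (simp add: flow_def)
    then have "continuous_on UNIV (\<beta> t)" "\<And>x y. \<beta> t (x + y) = \<beta> t x + \<beta> t y"
      "\<And>c x. \<beta> t (c *\<^sub>C x) = c *\<^sub>C \<beta> t x"
      unfolding star_hom_on_def by blast+
    then show "\<beta> t x = flow_map t x"
    proof (rule AF_maps_eq[OF _ _ _ linear_contraction_flow_map])
      fix n \<mu> \<nu> assume *: "(\<mu>, \<nu>) \<in> unit_indices Br v0 n"
      then have "\<beta> t (E \<mu> \<nu>) = exp (\<i> * of_real (t * (path_potential F \<mu> - path_potential F \<nu>))) *\<^sub>C E \<mu> \<nu>"
        using \<beta> by blast
      then show "\<beta> t (E \<mu> \<nu>) = flow_map t (E \<mu> \<nu>)"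
        using * by (simp add: flow_map_unit phase_def freq_def)
    qed
  qed
qed

end

section \<open>Time averages of the gauge flow\<close>

context gauge_system
begin

text \<open>
  Averages over long times give the mean expectation, averages over short times smooth an element
  without leaving its level.
\<close>

definition average :: "real \<Rightarrow> 'a \<Rightarrow> 'a" where
  "average T x = (1 / T) *\<^sub>R integral {0..T} (\<lambda>t. flow_map t x)"

lemma flow_map_integrable: "(\<lambda>t. flow_map t x) integrable_on {0..T}"
  by (rule integrable_continuous_real) (rule continuous_on_subset[OF continuous_flow_map], simp)

lemma average_diff: "average T (x - y) = average T x - average T y"
  by (simp add: average_def flow_map_diff integral_diff flow_map_integrable scaleR_diff_right)

lemma norm_average_diff_le:
  assumes "T > 0" "\<And>t. 0 \<le> t \<Longrightarrow> t \<le> T \<Longrightarrow> norm (flow_map t x - y) \<le> e"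
  shows "norm (average T x - y) \<le> e"
proof -
  have "(\<lambda>t. y) integrable_on {0..T}" by (rule integrable_continuous_real) simp
  then have "integral {0..T} (\<lambda>t. flow_map t x - y) = integral {0..T} (\<lambda>t. flow_map t x) - T *\<^sub>R y"
    using assms(1) by (simp add: integral_diff flow_map_integrable)
  moreover have "norm (integral {0..T} (\<lambda>t. flow_map t x - y)) \<le> e * (T - 0)"
    using assms by (intro integral_bound continuous_intros continuous_on_subset[OF continuous_flow_map]) auto
  moreover have "average T x - y = (1 / T) *\<^sub>R (integral {0..T} (\<lambda>t. flow_map t x) - T *\<^sub>R y)"
    using assms(1) by (simp add: average_def scaleR_diff_right)
  ultimately have "norm (average T x - y) \<le> (1 / T) * (e * (T - 0))"
    using assms(1) by (simp only: norm_scaleR) (simp add: pos_divide_le_eq)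
  then show ?thesis using assms(1) by simp
qed

lemma norm_average_le: "T > 0 \<Longrightarrow> norm (average T x) \<le> norm x"
  using norm_average_diff_le[of T x 0 "norm x"] norm_flow_map_le by simp

text \<open>The average of \<open>phase\<close> over the interval from 0 to \<open>T > 0\<close>.\<close>

definition mean_weight :: "real \<Rightarrow> 'e list \<Rightarrow> 'e list \<Rightarrow> complex" where
  "mean_weight T \<mu> \<nu> = (if freq \<mu> \<nu> = 0 then 1 else (phase T \<mu> \<nu> - 1) / (\<i> * of_real (T * freq \<mu> \<nu>)))"

lemma phase_has_integral:
  assumes "T > 0"
  shows "((\<lambda>t. phase t \<mu> \<nu>) has_integral of_real T * mean_weight T \<mu> \<nu>) {0..T}"
proof (cases "freq \<mu> \<nu> = 0")
  case True
  then show ?thesis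
    using has_integral_const_real[of "1::complex" 0 T] assms
    by (simp add: phase_def mean_weight_def scaleR_conv_of_real)
next
  case False
  let ?d = "freq \<mu> \<nu>"
  let ?G = "\<lambda>t. exp (\<i> * of_real (t * ?d)) / (\<i> * of_real ?d)"
  have "(?G has_vector_derivative exp (\<i> * of_real (t * ?d))) (at t within {0..T})" for t
  proof -
    have "((\<lambda>z. exp (\<i> * (z * of_real ?d)) / (\<i> * of_real ?d)) has_field_derivative
        exp (\<i> * (of_real t * of_real ?d))) (at (of_real t))"
      using False by (auto intro!: derivative_eq_intros simp: field_simps)
    then have "((\<lambda>t. exp (\<i> * (of_real t * of_real ?d)) / (\<i> * of_real ?d)) has_vector_derivative
        exp (\<i> * (of_real t * of_real ?d))) (at t within {0..T})"
      by (rule has_vector_derivative_real_field)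
    then show ?thesis by simp
  qed
  then have "((\<lambda>t. exp (\<i> * of_real (t * ?d))) has_integral (?G T - ?G 0)) {0..T}"
    using assms by (intro fundamental_theorem_of_calculus) auto
  moreover have "?G T - ?G 0 = of_real T * mean_weight T \<mu> \<nu>"
    using False assms by (simp add: mean_weight_def phase_def field_simps)
  ultimately show ?thesis by (simp add: phase_def)
qed

lemma average_uc:
  assumes "T > 0"
  shows "average T (uc E n c) = uc E n (\<lambda>\<mu> \<nu>. mean_weight T \<mu> \<nu> * c \<mu> \<nu>)"
proof -
  have "((\<lambda>t. flow_map t (uc E n c)) has_integral
      (\<Sum>p\<in>unit_indices Br v0 n. (of_real T * mean_weight T (fst p) (snd p) * c (fst p) (snd p)) *\<^sub>C E (fst p) (snd p))) {0..T}"
    unfolding flow_map_uc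
    unfolding unit_combination_def case_prod_unfold
  proof (intro has_integral_sum finite_unit_indices)
    fix p
    have "bounded_linear (\<lambda>z. (z * c (fst p) (snd p)) *\<^sub>C E (fst p) (snd p))"
      using bounded_linear_compose[OF bounded_linear_scaleC_left bounded_linear_mult_left] .
    from has_integral_linear[OF phase_has_integral[OF assms] this]
    show "((\<lambda>t. (phase t (fst p) (snd p) * c (fst p) (snd p)) *\<^sub>C E (fst p) (snd p)) has_integral
       (of_real T * mean_weight T (fst p) (snd p) * c (fst p) (snd p)) *\<^sub>C E (fst p) (snd p)) {0..T}"
      by (simp add: o_def)
  qed
  then have "average T (uc E n c) = complex_of_real (1 / T) *\<^sub>C
      uc E n (\<lambda>\<mu> \<nu>. of_real T * mean_weight T \<mu> \<nu> * c \<mu> \<nu>)"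
    unfolding average_def scaleR_eq_scaleC
    by (simp add: integral_unique unit_combination_def case_prod_unfold)
  also have "\<dots> = uc E n (\<lambda>\<mu> \<nu>. mean_weight T \<mu> \<nu> * c \<mu> \<nu>)"
    unfolding unit_combination_scaleC using assms by (intro unit_combination_cong) simp
  finally show ?thesis .
qed

subsection \<open>The mean expectation\<close>

text \<open>The limit of \<open>mean_weight T\<close> for \<open>T\<close> tending to infinity.\<close>

definition resonant :: "'e list \<Rightarrow> 'e list \<Rightarrow> complex" where
  "resonant \<mu> \<nu> = (if freq \<mu> \<nu> = 0 then 1 else 0)"

lemma mean_weight_tendsto: "((\<lambda>T. mean_weight T \<mu> \<nu>) \<longlongrightarrow> resonant \<mu> \<nu>) at_top"
proof (cases "freq \<mu> \<nu> = 0")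
  case True
  then show ?thesis by (simp add: mean_weight_def resonant_def)
next
  case False
  have "\<forall>\<^sub>F T in at_top. norm (mean_weight T \<mu> \<nu>) \<le> 2 / \<bar>freq \<mu> \<nu>\<bar> * (1 / T)"
    using eventually_gt_at_top[of 0]
  proof eventually_elim
    case (elim T)
    have "norm (phase T \<mu> \<nu> - 1) \<le> 2"
      using norm_triangle_ineq4[of "phase T \<mu> \<nu>" 1] by simp
    then show ?case
      using False elim by (simp add: mean_weight_def norm_divide norm_mult abs_mult divide_right_mono field_simps)
  qed
  moreover have "((\<lambda>T::real. 2 / \<bar>freq \<mu> \<nu>\<bar> * (1 / T)) \<longlongrightarrow> 0) at_top"
    by (intro tendsto_mult_right_zero tendsto_divide_0[OF tendsto_const]
        filterlim_at_top_imp_at_infinity filterlim_ident)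
  ultimately have "((\<lambda>T. mean_weight T \<mu> \<nu>) \<longlongrightarrow> 0) at_top"
    by (rule Lim_null_comparison)
  then show ?thesis using False by (simp add: resonant_def)
qed

lemma average_uc_tendsto:
  "((\<lambda>T. average T (uc E n c)) \<longlongrightarrow> uc E n (\<lambda>\<mu> \<nu>. resonant \<mu> \<nu> * c \<mu> \<nu>)) at_top"
proof -
  have "((\<lambda>T. uc E n (\<lambda>\<mu> \<nu>. mean_weight T \<mu> \<nu> * c \<mu> \<nu>)) \<longlongrightarrow> uc E n (\<lambda>\<mu> \<nu>. resonant \<mu> \<nu> * c \<mu> \<nu>)) at_top"
    unfolding unit_combination_def case_prod_unfold
    by (intro tendsto_sum tendsto_scaleC_left tendsto_mult mean_weight_tendsto tendsto_const)
  moreover have "\<forall>\<^sub>F T in at_top. uc E n (\<lambda>\<mu> \<nu>. mean_weight T \<mu> \<nu> * c \<mu> \<nu>) = average T (uc E n c)"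
    using eventually_gt_at_top[of 0] by eventually_elim (simp add: average_uc)
  ultimately show ?thesis by (rule Lim_transform_eventually)
qed

definition mean_map :: "'a \<Rightarrow> 'a" where
  "mean_map = (SOME T. linear_contraction T \<and>
     (\<forall>n c. T (uc E n c) = uc E n (\<lambda>\<mu> \<nu>. resonant \<mu> \<nu> * c \<mu> \<nu>)))"

lemma linear_contraction_mean_map: "linear_contraction mean_map"
  and mean_map_uc: "mean_map (uc E n c) = uc E n (\<lambda>\<mu> \<nu>. resonant \<mu> \<nu> * c \<mu> \<nu>)"
proof -
  have "\<exists>T. linear_contraction T \<and> (\<forall>n c. T (uc E n c) = uc E n (\<lambda>\<mu> \<nu>. resonant \<mu> \<nu> * c \<mu> \<nu>))"
  proof (rule multiplier_extension)
    fix n c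
    have "\<forall>\<^sub>F T in at_top. norm (average T (uc E n c)) \<le> norm (uc E n c)"
      using eventually_gt_at_top[of 0] by eventually_elim (rule norm_average_le)
    then show "norm (uc E n (\<lambda>\<mu> \<nu>. resonant \<mu> \<nu> * c \<mu> \<nu>)) \<le> norm (uc E n c)"
      by (rule tendsto_upperbound[OF tendsto_norm[OF average_uc_tendsto]]) simp
  qed (simp add: resonant_def)
  from someI_ex[OF this, folded mean_map_def]
  show "linear_contraction mean_map"
    "mean_map (uc E n c) = uc E n (\<lambda>\<mu> \<nu>. resonant \<mu> \<nu> * c \<mu> \<nu>)" by blast+
qed

text \<open>
  The averages and the limit map are contractions, so convergence on the levels suffices.
\<close>

lemma average_tendsto: "((\<lambda>T. average T x) \<longlongrightarrow> mean_map x) at_top"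
proof (rule tendstoI)
  fix e :: real assume "e > 0"
  obtain n c where "(\<lambda>k. uc E (n k) (c k)) \<longlonglongrightarrow> x" by (rule AF_sequence)
  then have "\<forall>\<^sub>F k in sequentially. dist (uc E (n k) (c k)) x < e / 3"
    using \<open>e > 0\<close> by (intro tendstoD) auto
  then obtain k where k: "norm (x - uc E (n k) (c k)) < e / 3"
    unfolding eventually_sequentially by (auto simp: dist_norm norm_minus_commute)
  define y where "y = uc E (n k) (c k)"
  have "\<forall>\<^sub>F T in at_top. dist (average T y) (mean_map y) < e / 3"
    unfolding y_def mean_map_uc using \<open>e > 0\<close> by (intro tendstoD[OF average_uc_tendsto]) auto
  then show "\<forall>\<^sub>F T in at_top. dist (average T x) (mean_map x) < e"
    using eventually_gt_at_top[of 0]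
  proof eventually_elim
    case (elim T)
    have "average T x - mean_map x =
        average T (x - y) + (average T y - mean_map y) - mean_map (x - y)"
      by (simp add: average_diff linear_contraction_diff[OF linear_contraction_mean_map])
    then have "norm (average T x - mean_map x) \<le>
        norm (average T (x - y)) + norm (average T y - mean_map y) + norm (mean_map (x - y))"
      using norm_triangle_ineq4[of "average T (x - y) + (average T y - mean_map y)" "mean_map (x - y)"]
        norm_triangle_ineq[of "average T (x - y)" "average T y - mean_map y"] by simp
    moreover have "norm (average T (x - y)) < e / 3" "norm (mean_map (x - y)) < e / 3"
      using norm_average_le[OF elim(2), of "x - y"] k
        linear_contraction_norm[OF linear_contraction_mean_map, of "x - y"]
      by (auto simp: y_def)
    ultimately show ?case using elim(1) by (simp add: dist_norm)
  qed
qed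

lemma mean_expectation_eq: "mean_expectation flow_map = mean_map"
proof
  fix x show "mean_expectation flow_map x = mean_map x"
    unfolding mean_expectation_def
    by (rule tendsto_Lim[OF _ average_tendsto[unfolded average_def]]) simp
qed

abbreviation "Fix \<equiv> fixed_point_algebra flow_map"

lemma mean_map_in_Fix: "mean_map x \<in> Fix"
proof -
  have "flow_map t (mean_map x) = mean_map x" for t
  proof (rule AF_closed_induct[of "\<lambda>x. flow_map t (mean_map x) = mean_map x"])
    note cont = linear_contraction_continuous[OF linear_contraction_mean_map]
    show "closed {x. flow_map t (mean_map x) = mean_map x}"
      by (intro closed_Collect_eq cont continuous_on_compose2[OF
            linear_contraction_continuous[OF linear_contraction_flow_map] cont]) auto
    show "flow_map t (mean_map (uc E n c)) = mean_map (uc E n c)" for n c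
      unfolding mean_map_uc flow_map_uc
      by (rule unit_combination_cong) (simp add: resonant_def phase_def)
  qed
  then show ?thesis by (simp add: fixed_point_algebra_def)
qed

lemma mean_map_fixed:
  assumes "x \<in> Fix"
  shows "mean_map x = x"
proof -
  have "norm (average T x - x) \<le> 0" if "T > 0" for T
    using that assms by (intro norm_average_diff_le) (auto simp: fixed_point_algebra_def)
  then have "x = average T x" if "T > 0" for T
    using that by simp
  then have "\<forall>\<^sub>F T in at_top. x = average T x"
    by (rule eventually_mono[OF eventually_gt_at_top])
  with tendsto_const have "((\<lambda>T. average T x) \<longlongrightarrow> x) at_top"
    by (rule Lim_transform_eventually)
  then show ?thesis
    using average_tendsto tendsto_unique trivial_limit_at_top_linorder by blast
qed

text \<open>
  The mean expectation fixes the fixed elements and deletes the coefficients of nonzero frequency.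
\<close>

lemma uc_in_Fix_iff: "uc E n c \<in> Fix \<longleftrightarrow> (\<forall>(\<mu>, \<nu>)\<in>unit_indices Br v0 n. freq \<mu> \<nu> \<noteq> 0 \<longrightarrow> c \<mu> \<nu> = 0)"
proof
  assume "uc E n c \<in> Fix"
  then have "uc E n (\<lambda>\<mu> \<nu>. resonant \<mu> \<nu> * c \<mu> \<nu>) = uc E n c"
    using mean_map_fixed[of "uc E n c"] by (simp add: mean_map_uc)
  then have "resonant \<mu> \<nu> * c \<mu> \<nu> = c \<mu> \<nu>" if "(\<mu>, \<nu>) \<in> unit_indices Br v0 n" for \<mu> \<nu>
    using that matrix_units.comb_coefficients_unique[OF matrix_units_level, of n "\<lambda>\<mu> \<nu>. resonant \<mu> \<nu> * c \<mu> \<nu>" c \<mu> \<nu>]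
    by (simp add: unit_combination_eq mem_unit_indices)
  then show "\<forall>(\<mu>, \<nu>)\<in>unit_indices Br v0 n. freq \<mu> \<nu> \<noteq> 0 \<longrightarrow> c \<mu> \<nu> = 0"
    by (fastforce simp: resonant_def)
next
  assume *: "\<forall>(\<mu>, \<nu>)\<in>unit_indices Br v0 n. freq \<mu> \<nu> \<noteq> 0 \<longrightarrow> c \<mu> \<nu> = 0"
  have "uc E n c = mean_map (uc E n c)"
    unfolding mean_map_uc by (rule unit_combination_cong) (use * in \<open>auto simp: resonant_def\<close>)
  then show "uc E n c \<in> Fix" using mean_map_in_Fix by metis
qed

text \<open>
  The mean expectation preserves the levels, so it carries approximations in the levels to fixed ones.
\<close>

lemma Fix_sequence:
  assumes "x \<in> Fix"
  obtains n c where "(\<lambda>k. uc E (n k) (c k)) \<longlonglongrightarrow> x" "\<forall>k. uc E (n k) (c k) \<in> Fix"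
proof -
  obtain n c where "(\<lambda>k. uc E (n k) (c k)) \<longlonglongrightarrow> x" by (rule AF_sequence)
  from linear_contraction_tendsto[OF linear_contraction_mean_map this]
  have "(\<lambda>k. uc E (n k) (\<lambda>\<mu> \<nu>. resonant \<mu> \<nu> * c k \<mu> \<nu>)) \<longlonglongrightarrow> x"
    using mean_map_fixed[OF assms] by (simp add: mean_map_uc)
  moreover have "\<forall>k. uc E (n k) (\<lambda>\<mu> \<nu>. resonant \<mu> \<nu> * c k \<mu> \<nu>) \<in> Fix"
    using mean_map_in_Fix mean_map_uc by metis
  ultimately show ?thesis by (rule that)
qed

lemma closed_Fix: "closed Fix"
  unfolding fixed_point_algebra_def
  by (intro closed_Collect_all closed_Collect_eq linear_contraction_continuous
      linear_contraction_flow_map continuous_on_id)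

lemma
  shows Fix_add: "x \<in> Fix \<Longrightarrow> y \<in> Fix \<Longrightarrow> x + y \<in> Fix"
    and Fix_scaleC: "x \<in> Fix \<Longrightarrow> c *\<^sub>C x \<in> Fix"
    and Fix_mult: "x \<in> Fix \<Longrightarrow> y \<in> Fix \<Longrightarrow> x * y \<in> Fix"
    and Fix_star: "x \<in> Fix \<Longrightarrow> star x \<in> Fix"
    and Fix_one: "1 \<in> Fix"
  using linear_contraction_flow_map
  by (auto simp: fixed_point_algebra_def linear_contraction_add linear_contraction_scaleC
      flow_map_mult flow_map_star flow_map_one)

subsection \<open>A core for the generator\<close>

lemma generator_unit:
  assumes "(\<mu>, \<nu>) \<in> unit_indices Br v0 n"
  shows "E \<mu> \<nu> \<in> generator_domain flow_map"
    and "generator flow_map (E \<mu> \<nu>) = (\<i> * of_real (freq \<mu> \<nu>)) *\<^sub>C E \<mu> \<nu>"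
proof -
  have "((\<lambda>z. exp (\<i> * (z * of_real (freq \<mu> \<nu>)))) has_field_derivative \<i> * of_real (freq \<mu> \<nu>)) (at (of_real 0))"
    by (auto intro!: derivative_eq_intros)
  then have "((\<lambda>t. exp (\<i> * (of_real t * of_real (freq \<mu> \<nu>)))) has_vector_derivative \<i> * of_real (freq \<mu> \<nu>)) (at 0)"
    by (rule has_vector_derivative_real_field)
  then have "((\<lambda>t. phase t \<mu> \<nu>) has_vector_derivative \<i> * of_real (freq \<mu> \<nu>)) (at 0)"
    by (simp add: phase_def)
  from bounded_linear.has_vector_derivative[OF bounded_linear_scaleC_left this, of "E \<mu> \<nu>"]
  have *: "((\<lambda>t. flow_map t (E \<mu> \<nu>)) has_vector_derivative (\<i> * of_real (freq \<mu> \<nu>)) *\<^sub>C E \<mu> \<nu>) (at 0)"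
    by (simp add: flow_map_unit[OF assms])
  then show "E \<mu> \<nu> \<in> generator_domain flow_map" by (auto simp: generator_domain_def)
  show "generator flow_map (E \<mu> \<nu>) = (\<i> * of_real (freq \<mu> \<nu>)) *\<^sub>C E \<mu> \<nu>"
    unfolding generator_def by (rule vector_derivative_at[OF *])
qed

text \<open>
  Let \<open>x\<close> be an element of a level close to \<open>a\<close>, and \<open>y\<close> its average over a short time \<open>T\<close>.  Then \<open>y\<close> is
  close to \<open>a\<close>, and the generator takes \<open>y\<close> to the difference quotient \<open>(flow_map T x - x) / T\<close>.  With
  \<open>T\<close> chosen first, and \<open>x\<close> close to \<open>a\<close> even on the scale of \<open>T\<close>, that is close to the difference
  quotient of \<open>a\<close>, and so to \<open>d\<close>.
\<close>

lemma generator_approx: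
  assumes a: "((\<lambda>t. flow_map t a) has_vector_derivative d) (at 0)" and "e > 0"
  shows "\<exists>n c. norm (uc E n c - a) < e \<and>
    norm (uc E n (\<lambda>\<mu> \<nu>. \<i> * of_real (freq \<mu> \<nu>) * c \<mu> \<nu>) - d) < e"
proof -
  have "(\<lambda>h. norm (flow_map (0 + h) a - flow_map 0 a - h *\<^sub>R d) / norm h) \<midarrow>0\<rightarrow> 0"
    using a unfolding has_vector_derivative_def has_derivative_at by blast
  from LIM_D[OF this, of "e / 2"] \<open>e > 0\<close>
  obtain r where r: "r > 0"
    "\<And>h. h \<noteq> 0 \<Longrightarrow> \<bar>h\<bar> < r \<Longrightarrow> norm (flow_map h a - a - h *\<^sub>R d) / \<bar>h\<bar> < e / 2"
    by (auto simp: flow_map_0)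
  have "isCont (\<lambda>t. flow_map t a) 0"
    using continuous_flow_map by (simp add: continuous_on_eq_continuous_at)
  then obtain s where s: "s > 0" "\<And>t. \<bar>t\<bar> < s \<Longrightarrow> norm (flow_map t a - a) < e / 3"
    using LIM_D[of "\<lambda>t. flow_map t a" "flow_map 0 a" 0 "e / 3"] \<open>e > 0\<close>
    unfolding isCont_def flow_map_0 by (metis diff_zero real_norm_def flow_map_0 norm_zero diff_self
        zero_less_divide_iff zero_less_numeral)
  define T where "T = min r s / 2"
  have T: "T > 0" "T < r" "T < s" using r(1) s(1) by (auto simp: T_def)
  \<comment> \<open>The difference quotient over \<open>T\<close> magnifies an error by the factor \<open>2 / T\<close>.\<close>
  define \<eta> where "\<eta> = min (e / 3) (e * T / 4)"
  have "\<eta> > 0" using \<open>e > 0\<close> T(1) by (simp add: \<eta>_def)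
  obtain n' c' where "(\<lambda>k. uc E (n' k) (c' k)) \<longlonglongrightarrow> a" by (rule AF_sequence)
  then have "\<forall>\<^sub>F k in sequentially. dist (uc E (n' k) (c' k)) a < \<eta>"
    using \<open>\<eta> > 0\<close> by (intro tendstoD) auto
  then obtain n c where x: "norm (uc E n c - a) < \<eta>"
    unfolding eventually_sequentially dist_norm by blast
  define x where "x = uc E n c"
  define c'' where "c'' = (\<lambda>\<mu> \<nu>. mean_weight T \<mu> \<nu> * c \<mu> \<nu>)"
  have y: "uc E n c'' = average T x"
    using average_uc[OF T(1), of n c] by (simp add: x_def c''_def)
  have "norm (average T a - a) \<le> e / 3"
    using s(2) T by (intro norm_average_diff_le) (auto intro: less_imp_le)
  moreover have "norm (average T (x - a)) < e / 3"
    using norm_average_le[OF T(1), of "x - a"] x by (simp add: x_def \<eta>_def)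
  moreover have "uc E n c'' - a = average T (x - a) + (average T a - a)"
    by (simp add: y average_diff)
  then have "norm (uc E n c'' - a) \<le> norm (average T (x - a)) + norm (average T a - a)"
    by (simp only: norm_triangle_ineq)
  ultimately have 1: "norm (uc E n c'' - a) < e"
    using \<open>e > 0\<close> by linarith
  have "uc E n (\<lambda>\<mu> \<nu>. \<i> * of_real (freq \<mu> \<nu>) * c'' \<mu> \<nu>) =
      uc E n (\<lambda>\<mu> \<nu>. of_real (1 / T) * (phase T \<mu> \<nu> * c \<mu> \<nu> - c \<mu> \<nu>))"
  proof (rule unit_combination_cong)
    fix \<mu> \<nu>
    have "\<i> * of_real (freq \<mu> \<nu>) * mean_weight T \<mu> \<nu> = of_real (1 / T) * (phase T \<mu> \<nu> - 1)"
      using T(1) by (simp add: mean_weight_def phase_def)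
    then have "\<i> * of_real (freq \<mu> \<nu>) * mean_weight T \<mu> \<nu> * c \<mu> \<nu> = of_real (1 / T) * (phase T \<mu> \<nu> - 1) * c \<mu> \<nu>"
      by (simp only:)
    then have "\<i> * of_real (freq \<mu> \<nu>) * c'' \<mu> \<nu> = of_real (1 / T) * (phase T \<mu> \<nu> * c \<mu> \<nu> - c \<mu> \<nu>)"
      by (simp only: c''_def mult.assoc) (simp add: algebra_simps)
    then show "(\<i> * of_real (freq \<mu> \<nu>) * c'' \<mu> \<nu>) *\<^sub>C E \<mu> \<nu> =
        (of_real (1 / T) * (phase T \<mu> \<nu> * c \<mu> \<nu> - c \<mu> \<nu>)) *\<^sub>C E \<mu> \<nu>" by simp
  qed
  also have "\<dots> = (1 / T) *\<^sub>R (flow_map T x - x)"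
    by (simp only: unit_combination_scaleC[symmetric] unit_combination_diff[symmetric]
        flow_map_uc[symmetric] x_def scaleR_eq_scaleC)
  finally have "uc E n (\<lambda>\<mu> \<nu>. \<i> * of_real (freq \<mu> \<nu>) * c'' \<mu> \<nu>) - d =
      (1 / T) *\<^sub>R (flow_map T (x - a) - (x - a)) + (1 / T) *\<^sub>R (flow_map T a - a - T *\<^sub>R d)"
    using T(1) by (simp add: flow_map_diff algebra_simps)
  then have "norm (uc E n (\<lambda>\<mu> \<nu>. \<i> * of_real (freq \<mu> \<nu>) * c'' \<mu> \<nu>) - d) \<le>
      norm ((1 / T) *\<^sub>R (flow_map T (x - a) - (x - a))) + norm ((1 / T) *\<^sub>R (flow_map T a - a - T *\<^sub>R d))"
    by (simp only: norm_triangle_ineq)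
  moreover have "norm ((1 / T) *\<^sub>R (flow_map T a - a - T *\<^sub>R d)) < e / 2"
    using r(2)[of T] T by simp
  moreover have "norm ((1 / T) *\<^sub>R (flow_map T (x - a) - (x - a))) < e / 2"
  proof -
    have "norm (flow_map T (x - a) - (x - a)) \<le> 2 * norm (x - a)"
      using norm_triangle_ineq4[of "flow_map T (x - a)" "x - a"] norm_flow_map_le[of T "x - a"] by linarith
    also have "\<dots> < e * T / 2" using x by (simp add: x_def \<eta>_def)
    finally show ?thesis
      using T(1) unfolding norm_scaleR by (simp add: pos_divide_less_eq)
  qed
  ultimately have "norm (uc E n (\<lambda>\<mu> \<nu>. \<i> * of_real (freq \<mu> \<nu>) * c'' \<mu> \<nu>) - d) < e"
    by linarith
  with 1 show ?thesis by blast
qed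

lemma generator_core:
  assumes "a \<in> generator_domain flow_map"
  obtains n c where "(\<lambda>k. uc E (n k) (c k)) \<longlonglongrightarrow> a"
    "(\<lambda>k. uc E (n k) (\<lambda>\<mu> \<nu>. \<i> * of_real (freq \<mu> \<nu>) * c k \<mu> \<nu>)) \<longlonglongrightarrow> generator flow_map a"
proof -
  have a: "((\<lambda>t. flow_map t a) has_vector_derivative generator flow_map a) (at 0)"
    using assms by (auto simp: generator_domain_def generator_def vector_derivative_at)
  define P where "P k n c \<longleftrightarrow> norm (uc E n c - a) < inverse (real (Suc k)) \<and>
      norm (uc E n (\<lambda>\<mu> \<nu>. \<i> * of_real (freq \<mu> \<nu>) * c \<mu> \<nu>) - generator flow_map a) < inverse (real (Suc k))"
    for k n c
  have "\<forall>k. \<exists>n c. P k n c"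
    unfolding P_def using generator_approx[OF a] by simp
  then obtain n c where "\<And>k. P k (n k) (c k)" by metis
  then have nc: "\<And>k. norm (uc E (n k) (c k) - a) < inverse (real (Suc k))"
    "\<And>k. norm (uc E (n k) (\<lambda>\<mu> \<nu>. \<i> * of_real (freq \<mu> \<nu>) * c k \<mu> \<nu>) - generator flow_map a) < inverse (real (Suc k))"
    unfolding P_def by blast+
  have lim: "X \<longlonglongrightarrow> l" if "\<And>k. norm (X k - l) < inverse (real (Suc k))" for X :: "nat \<Rightarrow> 'a" and l
    using that by (intro LIM_zero_cancel[OF Lim_null_comparison[OF _ LIMSEQ_inverse_real_of_nat]])
      (auto intro!: always_eventually less_imp_le)
  show ?thesis by (rule that; rule lim; rule nc)
qed

end

section \<open>Geodesics\<close>

lemma geodesic_subdiagram_simps [simp]: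
  "tail (geodesic_subdiagram Br v0 F) = tail Br"
  "head (geodesic_subdiagram Br v0 F) = head Br"
  "v0 \<in> verts (geodesic_subdiagram Br v0 F)"
  by (simp_all add: geodesic_subdiagram_def)

lemma mem_arcs_geodesic_subdiagram:
  "a \<in> arcs (geodesic_subdiagram Br v0 F) \<longleftrightarrow> (\<exists>p n. p \<in> geodesics Br v0 F \<and> a = p n)"
  by (auto simp: geodesic_subdiagram_def)

lemma path_range_geodesic_subdiagram [simp]:
  "path_range (geodesic_subdiagram Br v0 F) u \<mu> = path_range Br u \<mu>"
  by (cases \<mu> rule: rev_cases) simp_all

lemma cas_geodesic_subdiagram:
  "pre_digraph.cas (geodesic_subdiagram Br v0 F) u \<mu> v = pre_digraph.cas Br u \<mu> v"
  by (induction \<mu> arbitrary: u) (simp_all add: pre_digraph.cas.simps)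

lemma path_prefix_0: "path_prefix p 0 = []"
  by (simp add: path_prefix_def)

lemma path_prefix_Suc: "path_prefix p (Suc n) = path_prefix p n @ [p n]"
  by (simp add: path_prefix_def)

context bratteli_diagram
begin

definition minimal :: "('e \<Rightarrow> real) \<Rightarrow> 'e list \<Rightarrow> bool" where
  "minimal F \<mu> \<longleftrightarrow> \<mu> \<in> paths Br v0 (length \<mu>) \<and>
     (\<forall>\<nu>\<in>paths Br v0 (length \<mu>). path_range Br v0 \<nu> = path_range Br v0 \<mu> \<longrightarrow>
        path_potential F \<mu> \<le> path_potential F \<nu>)"

lemma minimalD:
  assumes "minimal F \<mu>"
  shows "\<mu> \<in> paths Br v0 (length \<mu>)"
    and "\<nu> \<in> paths Br v0 (length \<mu>) \<Longrightarrow> path_range Br v0 \<nu> = path_range Br v0 \<mu> \<Longrightarrow>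
      path_potential F \<mu> \<le> path_potential F \<nu>"
  using assms by (auto simp: minimal_def)

lemma minimal_Nil: "minimal F []"
  by (simp add: minimal_def paths_0[OF root_in_verts])

lemma path_prefix_in_paths:
  assumes "p \<in> infinite_paths Br v0"
  shows "path_prefix p n \<in> paths Br v0 n \<and> path_range Br v0 (path_prefix p n) = tail Br (p n)"
proof (induction n)
  case 0
  then show ?case using assms by (simp add: path_prefix_0 paths_0[OF root_in_verts] infinite_paths_def)
next
  case (Suc n)
  then show ?case using assms by (simp add: path_prefix_Suc snoc_in_paths infinite_paths_def)
qed

lemma geodesic_iff_minimal:
  assumes "p \<in> infinite_paths Br v0"
  shows "p \<in> geodesics Br v0 F \<longleftrightarrow> (\<forall>n. minimal F (path_prefix p n))"
proof -
  have head: "head Br (p (n - 1)) = path_range Br v0 (path_prefix p n)" if "n \<ge> 1" for n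
    using that by (cases n) (simp_all add: path_prefix_Suc)
  have len: "length (path_prefix p n) = n" for n by (simp add: path_prefix_def)
  have "minimal F (path_prefix p n) \<longleftrightarrow> (n \<ge> 1 \<longrightarrow> (\<forall>\<mu>\<in>paths Br v0 n. path_range Br v0 \<mu> = head Br (p (n - 1)) \<longrightarrow>
       path_potential F (path_prefix p n) \<le> path_potential F \<mu>))" for n
  proof (cases "n = 0")
    case True
    then show ?thesis by (simp add: path_prefix_0 minimal_Nil)
  next
    case False
    then have "n \<ge> 1" by simp
    then show ?thesis
      using path_prefix_in_paths[OF assms, of n] head[OF \<open>n \<ge> 1\<close>] unfolding minimal_def len by simp
  qed
  then show ?thesis using assms unfolding geodesics_def by blast
qed

lemma geodesic_arcs_subset: "arcs (geodesic_subdiagram Br v0 F) \<subseteq> arcs Br"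
  by (auto simp: mem_arcs_geodesic_subdiagram geodesics_def infinite_paths_def)

lemma geodesic_paths_iff:
  "\<mu> \<in> paths (geodesic_subdiagram Br v0 F) v0 n \<longleftrightarrow>
    \<mu> \<in> paths Br v0 n \<and> set \<mu> \<subseteq> arcs (geodesic_subdiagram Br v0 F)"
  unfolding mem_paths path_range_geodesic_subdiagram cas_geodesic_subdiagram
  using geodesic_arcs_subset root_in_verts by auto

text \<open>
  An arrow of the subdiagram comes with a geodesic through it, and the levels of its source and of its
  position on the geodesic agree.
\<close>

lemma geodesic_arc_level:
  assumes "a \<in> arcs (geodesic_subdiagram Br v0 F)" "tail Br a \<in> level n"
  obtains p where "p \<in> geodesics Br v0 F" "a = p n"
proof -
  obtain p k where p: "p \<in> geodesics Br v0 F" "a = p k"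
    using assms(1) unfolding mem_arcs_geodesic_subdiagram by blast
  then have "p \<in> infinite_paths Br v0" by (simp add: geodesics_def)
  from path_prefix_in_paths[OF this, of k] have "tail Br a \<in> level k"
    using path_range_level[of "path_prefix p k" k] p(2) by simp
  then have "k = n" using assms(2) disjoint_levels unfolding disjoint_family_on_def by blast
  then show ?thesis using that p by blast
qed

text \<open>
  The arrows of \<open>\<mu>\<close> may come from different geodesics.  If \<open>p\<close> is a geodesic through the last arrow,
  then by induction \<open>\<mu>\<close> without this arrow has no larger potential than the corresponding piece of \<open>p\<close>.
\<close>

lemma geodesic_path_minimal: "\<mu> \<in> paths (geodesic_subdiagram Br v0 F) v0 n \<Longrightarrow> minimal F \<mu>"
proof (induction n arbitrary: \<mu>)
  case 0
  then show ?case by (simp add: paths_0 minimal_Nil)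
next
  case (Suc n)
  obtain \<nu> a where *: "\<mu> = \<nu> @ [a]" "\<nu> \<in> paths (geodesic_subdiagram Br v0 F) v0 n"
      "a \<in> arcs (geodesic_subdiagram Br v0 F)" "tail Br a = path_range Br v0 \<nu>"
    using Suc.prems by (rule paths_SucE) simp
  have \<nu>: "minimal F \<nu>" "\<nu> \<in> paths Br v0 n" "length \<nu> = n"
    using Suc.IH[OF *(2)] *(2) by (auto simp: geodesic_paths_iff dest: length_paths)
  have "tail Br a \<in> level n" using path_range_level[OF \<nu>(2)] *(4) by simp
  from *(3) this obtain p where p: "p \<in> geodesics Br v0 F" "a = p n" by (rule geodesic_arc_level)
  then have inf: "p \<in> infinite_paths Br v0" by (simp add: geodesics_def)
  have q: "path_prefix p n \<in> paths Br v0 n" "path_range Br v0 (path_prefix p n) = path_range Br v0 \<nu>"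
    using path_prefix_in_paths[OF inf, of n] p *(4) by simp_all
  have "minimal F (path_prefix p n @ [a])"
    using geodesic_iff_minimal[OF inf] p path_prefix_Suc[of p n] by metis
  then have "path_potential F (path_prefix p n) + F a \<le> path_potential F \<xi>"
    if "\<xi> \<in> paths Br v0 (Suc n)" "path_range Br v0 \<xi> = head Br a" for \<xi>
    using minimalD(2)[of F "path_prefix p n @ [a]" \<xi>] that q(1) by (simp add: length_paths)
  moreover have "path_potential F \<nu> \<le> path_potential F (path_prefix p n)"
    using minimalD(2)[OF \<nu>(1), of "path_prefix p n"] q \<nu>(3) by simp
  moreover have "\<mu> \<in> paths Br v0 (Suc n)" using Suc.prems by (simp add: geodesic_paths_iff)
  ultimately show ?case
    unfolding minimal_def *(1) using \<nu>(3) by force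
qed

lemma minimal_butlast:
  assumes "minimal F (\<mu> @ [a])"
  shows "minimal F \<mu>"
proof -
  have *: "\<mu> \<in> paths Br v0 (length \<mu>)" "a \<in> arcs Br" "tail Br a = path_range Br v0 \<mu>"
    using minimalD(1)[OF assms] by (simp_all add: snoc_in_paths)
  have "path_potential F \<mu> \<le> path_potential F \<nu>"
    if "\<nu> \<in> paths Br v0 (length \<mu>)" "path_range Br v0 \<nu> = path_range Br v0 \<mu>" for \<nu>
    using minimalD(2)[OF assms, of "\<nu> @ [a]"] that * by (simp add: snoc_in_paths)
  then show ?thesis using * by (simp add: minimal_def)
qed

lemma minimal_append: "minimal F (\<mu> @ \<rho>) \<Longrightarrow> minimal F \<mu>"
proof (induction \<rho> rule: rev_induct)
  case (snoc a \<rho>)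
  then show ?case using minimal_butlast[of F "\<mu> @ \<rho>" a] by simp
qed simp

text \<open>
  An element of the tree \<open>S\<close> can be extended for ever inside \<open>S\<close>.  All initial pieces of the
  infinite path so obtained lie in \<open>S\<close>, hence are minimal, so it is a geodesic through the element.
\<close>

lemma geodesics_through_tree:
  assumes S: "\<And>\<mu>. \<mu> \<in> S \<Longrightarrow> minimal F \<mu>" "\<And>\<mu> a. \<mu> @ [a] \<in> S \<Longrightarrow> \<mu> \<in> S"
      "\<And>\<mu>. \<mu> \<in> S \<Longrightarrow> \<exists>a. \<mu> @ [a] \<in> S"
    and "\<mu> \<in> S"
  shows "\<mu> \<in> paths (geodesic_subdiagram Br v0 F) v0 (length \<mu>)"
proof -
  have prefix: "\<nu> @ \<rho> \<in> S \<Longrightarrow> \<nu> \<in> S" for \<nu> \<rho>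
  proof (induction \<rho> rule: rev_induct)
    case (snoc a \<rho>)
    then show ?case using S(2)[of "\<nu> @ \<rho>" a] by simp
  qed simp
  define next_arc where "next_arc \<nu> = (SOME a. \<nu> @ [a] \<in> S)" for \<nu>
  have ext: "\<nu> @ [next_arc \<nu>] \<in> S" if "\<nu> \<in> S" for \<nu>
    unfolding next_arc_def using someI_ex[OF S(3)[OF that]] .
  define L where "L k = ((\<lambda>\<nu>. \<nu> @ [next_arc \<nu>]) ^^ k) \<mu>" for k
  have L: "L k \<in> S \<and> length (L k) = length \<mu> + k" for k
    by (induction k) (simp_all add: L_def \<open>\<mu> \<in> S\<close> ext)
  have L_append: "\<exists>\<rho>. L k' = L k @ \<rho>" if "k \<le> k'" for k k'
    using that
  proof (induction k' rule: dec_induct)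
    case (step j)
    then show ?case by (auto simp: L_def)
  qed simp
  define p where "p i = L (Suc i) ! i" for i
  have prefix_p: "path_prefix p j = take j (L j)" for j
  proof (rule nth_equalityI)
    show "length (path_prefix p j) = length (take j (L j))"
      using L[of j] by (simp add: path_prefix_def)
    fix i assume "i < length (path_prefix p j)"
    then have i: "i < j" by (simp add: path_prefix_def)
    then obtain \<rho> where "L j = L (Suc i) @ \<rho>" using L_append[of "Suc i" j] by auto
    then show "path_prefix p j ! i = take j (L j) ! i"
      using i L[of "Suc i"] by (simp add: path_prefix_def p_def nth_append)
  qed
  have "path_prefix p j \<in> S" for j
    using L[of j] prefix[of "take j (L j)" "drop j (L j)"] by (simp add: prefix_p)
  then have min: "minimal F (path_prefix p j)" for j by (rule S(1))
  have "path_prefix p i @ [p i] \<in> paths Br v0 (Suc i)" for i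
    using minimalD(1)[OF min[of "Suc i"]] by (simp add: path_prefix_Suc path_prefix_def)
  then have arc: "p i \<in> arcs Br \<and> tail Br (p i) = path_range Br v0 (path_prefix p i)" for i
    by (simp add: snoc_in_paths)
  then have inf: "p \<in> infinite_paths Br v0"
    by (simp add: infinite_paths_def path_prefix_0 path_prefix_Suc)
  then have "p \<in> geodesics Br v0 F" using min by (simp add: geodesic_iff_minimal)
  then have "p i \<in> arcs (geodesic_subdiagram Br v0 F)" for i
    unfolding mem_arcs_geodesic_subdiagram by blast
  then have "set (path_prefix p (length \<mu>)) \<subseteq> arcs (geodesic_subdiagram Br v0 F)"
    by (auto simp: path_prefix_def)
  moreover have "path_prefix p (length \<mu>) = \<mu>"
  proof -
    obtain \<rho> where "L (length \<mu>) = L 0 @ \<rho>" using L_append by blast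
    then show ?thesis by (simp add: prefix_p L_def)
  qed
  ultimately show ?thesis
    using minimalD(1)[OF S(1)[OF \<open>\<mu> \<in> S\<close>]] by (simp add: geodesic_paths_iff)
qed

text \<open>
  A geodesic stays a geodesic when an initial piece is replaced by one of the same length, range and
  potential.  Of \<open>\<mu>\<close> it is known that its arrows lie on geodesics, not that a single geodesic starts
  with it, so the continuation is built arrow by arrow, along a geodesic through the last arrow.
\<close>

lemma geodesic_path_exchange:
  assumes \<mu>: "\<mu> \<in> paths (geodesic_subdiagram Br v0 F) v0 n" and \<nu>: "\<nu> \<in> paths Br v0 n"
    and range: "path_range Br v0 \<nu> = path_range Br v0 \<mu>"
    and pot: "path_potential F \<nu> = path_potential F \<mu>"
  shows "\<nu> \<in> paths (geodesic_subdiagram Br v0 F) v0 n"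
proof (cases "n = 0")
  case True
  then show ?thesis using \<nu> by (simp add: paths_0 paths_0[OF root_in_verts])
next
  case False
  \<comment> \<open>A tail \<open>\<rho>\<close> is allowed so that \<open>S\<close> contains the initial pieces of its elements.  The empty path is
     excluded as end point because an arrow of the subdiagram leaving it is found only by continuing a
     geodesic through a previous arrow.\<close>
  define S where "S = {\<nu>. \<exists>\<rho> \<mu>. \<nu> @ \<rho> \<noteq> [] \<and> minimal F (\<nu> @ \<rho>) \<and>
    \<mu> \<in> paths (geodesic_subdiagram Br v0 F) v0 (length (\<nu> @ \<rho>)) \<and> path_range Br v0 \<mu> = path_range Br v0 (\<nu> @ \<rho>)}"
  have S: "\<nu> \<in> S" if "\<nu> @ \<rho> \<noteq> []" "minimal F (\<nu> @ \<rho>)"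
    "\<mu> \<in> paths (geodesic_subdiagram Br v0 F) v0 (length (\<nu> @ \<rho>))" "path_range Br v0 \<mu> = path_range Br v0 (\<nu> @ \<rho>)"
    for \<nu> \<rho> \<mu>
    unfolding S_def using that by blast
  have len: "length \<nu> = n" "length \<mu> = n" using \<mu> \<nu> by (simp_all add: length_paths)
  have "minimal F \<mu>" by (rule geodesic_path_minimal[OF \<mu>])
  then have "minimal F \<nu>" using \<nu> range pot len by (simp add: minimal_def)
  then have "\<nu> \<in> S"
    using False \<mu> range len by (intro S[of \<nu> "[]" \<mu>]) auto
  have min_S: "minimal F \<kappa>" if "\<kappa> \<in> S" for \<kappa>
    using that unfolding S_def by (auto dest: minimal_append)
  have prefix_S: "\<kappa> \<in> S" if \<kappa>: "\<kappa> @ [a] \<in> S" for \<kappa> a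
  proof -
    obtain \<rho> \<xi> where "minimal F (\<kappa> @ a # \<rho>)" "\<xi> \<in> paths (geodesic_subdiagram Br v0 F) v0 (length (\<kappa> @ a # \<rho>))"
      "path_range Br v0 \<xi> = path_range Br v0 (\<kappa> @ a # \<rho>)"
      using \<kappa> unfolding S_def by auto
    then show ?thesis by (intro S[of \<kappa> "a # \<rho>" \<xi>]) auto
  qed
  have extend_S: "\<exists>a. \<kappa> @ [a] \<in> S" if \<kappa>: "\<kappa> \<in> S" for \<kappa>
  proof -
    obtain \<rho> \<xi> where \<rho>: "\<kappa> @ \<rho> \<noteq> []" "minimal F (\<kappa> @ \<rho>)"
      "\<xi> \<in> paths (geodesic_subdiagram Br v0 F) v0 (length (\<kappa> @ \<rho>))"
      "path_range Br v0 \<xi> = path_range Br v0 (\<kappa> @ \<rho>)"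
      using \<kappa> unfolding S_def by blast
    show ?thesis
    proof (cases \<rho>)
      case (Cons a \<rho>')
      then show ?thesis using S[of "\<kappa> @ [a]" \<rho>' \<xi>] \<rho> by auto
    next
      case Nil
      then obtain m where m: "length \<kappa> = Suc m" using \<rho>(1) by (cases \<kappa>) auto
      have \<xi>: "\<xi> \<in> paths (geodesic_subdiagram Br v0 F) v0 (Suc m)" using \<rho>(3) Nil m by simp
      obtain \<xi>' b where \<xi>': "\<xi> = \<xi>' @ [b]" "\<xi>' \<in> paths (geodesic_subdiagram Br v0 F) v0 m"
        "b \<in> arcs (geodesic_subdiagram Br v0 F)" "tail Br b = path_range Br v0 \<xi>'"
        using \<xi> by (rule paths_SucE) simp
      have "tail Br b \<in> level m"
        using path_range_level[of \<xi>' m] \<xi>' by (simp add: geodesic_paths_iff)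
      from \<xi>'(3) this obtain p where p: "p \<in> geodesics Br v0 F" "b = p m" by (rule geodesic_arc_level)
      define a where "a = p (Suc m)"
      have a: "a \<in> arcs (geodesic_subdiagram Br v0 F)"
        unfolding mem_arcs_geodesic_subdiagram a_def using p by blast
      have tail_a: "tail Br a = path_range Br v0 \<xi>"
        using p \<xi>'(1) by (simp add: a_def geodesics_def infinite_paths_def)
      have \<xi>a: "\<xi> @ [a] \<in> paths (geodesic_subdiagram Br v0 F) v0 (Suc (Suc m))"
        using \<xi> a tail_a by (simp add: snoc_in_paths)
      have \<kappa>m: "minimal F \<kappa>" "path_range Br v0 \<xi> = path_range Br v0 \<kappa>" using \<rho> Nil by simp_all
      have \<kappa>a: "\<kappa> @ [a] \<in> paths Br v0 (Suc (Suc m))"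
        using minimalD(1)[OF \<kappa>m(1)] m a tail_a \<kappa>m(2) geodesic_arcs_subset by (auto simp: snoc_in_paths)
      have "path_potential F \<kappa> \<le> path_potential F \<xi>"
        using minimalD(2)[OF \<kappa>m(1), of \<xi>] \<kappa>m(2) m \<xi> by (simp add: geodesic_paths_iff)
      then have "minimal F (\<kappa> @ [a])"
        using minimalD(2)[OF geodesic_path_minimal[OF \<xi>a]] \<kappa>a m length_paths[OF \<xi>a]
        by (force simp: minimal_def)
      then have "\<kappa> @ [a] \<in> S"
        using \<xi>a m by (intro S[of "\<kappa> @ [a]" "[]" "\<xi> @ [a]"]) auto
      then show ?thesis by blast
    qed
  qed
  show ?thesis
    using geodesics_through_tree[OF min_S prefix_S extend_S \<open>\<nu> \<in> S\<close>] unfolding len .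
qed

end

section \<open>The compression to the geodesics\<close>

locale geodesic_system = gauge_system Br level v0 E F +
    Sub: AF_algebra "geodesic_subdiagram Br v0 F" v0 E'
  for Br :: "('v, 'e) pre_digraph" and level v0 and E :: "'e list \<Rightarrow> 'e list \<Rightarrow> 'a::cstar_algebra"
    and F :: "'e \<Rightarrow> real" and E' :: "'e list \<Rightarrow> 'e list \<Rightarrow> 'b::cstar_algebra"
begin

abbreviation "Br' \<equiv> geodesic_subdiagram Br v0 F"

abbreviation "G \<equiv> paths Br' v0"

abbreviation "uc' \<equiv> unit_combination Br' v0"

lemma geodesic_in_paths: "\<mu> \<in> G n \<Longrightarrow> \<mu> \<in> paths Br v0 n"
  by (simp add: geodesic_paths_iff)

lemma finite_G: "finite (G n)"
  by (rule finite_subset[OF _ finite_paths[of n]]) (auto simp: geodesic_in_paths)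

lemma mem_unit_indices': "(\<mu>, \<nu>) \<in> unit_indices Br' v0 n \<longleftrightarrow>
    (\<mu>, \<nu>) \<in> unit_indices Br v0 n \<and> \<mu> \<in> G n \<and> \<nu> \<in> G n"
  by (auto simp: mem_unit_indices geodesic_in_paths)

lemma uc'_eq_comb: "uc' V n c = comb (G n) (path_range Br v0) V c"
  unfolding unit_combination_eq by (rule arg_cong[where f = "\<lambda>r. comb (G n) r V c"]) (simp add: fun_eq_iff)

lemma matrix_units_subdiagram: "matrix_units (G n) (path_range Br v0) E'"
proof -
  have "matrix_units (G n) (path_range Br' v0) E'"
    by (rule AF_algebra_matrix_units[OF _ finite_G]) unfold_locales
  then show ?thesis by simp
qed

text \<open>
  In both algebras the geodesic paths index matrix units with the same multiplication table.
\<close>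

lemma matrix_units_corner: "matrix_units (G n) (path_range Br v0) E"
proof -
  interpret M: matrix_units "paths Br v0 n" "path_range Br v0" E by (rule matrix_units_level)
  show ?thesis
    by unfold_locales (simp_all add: finite_G geodesic_in_paths M.mult_unit M.star_unit M.unit_nonzero)
qed

lemma norm_uc'_eq: "norm (uc' E' n c) = norm (uc' E n c)"
  unfolding uc'_eq_comb by (rule matrix_units_isometric[OF matrix_units_corner matrix_units_subdiagram])

lemma uc'_eq_uc: "uc' V n c = uc V n (\<lambda>\<mu> \<nu>. if \<mu> \<in> G n \<and> \<nu> \<in> G n then c \<mu> \<nu> else 0)"
proof -
  have "uc V n (\<lambda>\<mu> \<nu>. if \<mu> \<in> G n \<and> \<nu> \<in> G n then c \<mu> \<nu> else 0) =
      (\<Sum>p\<in>unit_indices Br' v0 n. c (fst p) (snd p) *\<^sub>C V (fst p) (snd p))"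
    unfolding unit_combination_def case_prod_unfold
    using finite_unit_indices by (intro sum.mono_neutral_cong_right) (auto simp: mem_unit_indices')
  then show ?thesis by (simp add: unit_combination_def case_prod_unfold)
qed

lemma potential_constant_on_geodesics:
  assumes "\<mu> \<in> G n" "\<nu> \<in> G n" "path_range Br v0 \<mu> = path_range Br v0 \<nu>"
  shows "freq \<mu> \<nu> = 0"
  using minimalD(2)[OF geodesic_path_minimal[OF assms(1)], of \<nu>]
    minimalD(2)[OF geodesic_path_minimal[OF assms(2)], of \<mu>] assms
  by (simp add: length_paths geodesic_in_paths freq_def)

abbreviation "Q \<equiv> geodesic_projection Br v0 E F"

lemma Q_eq_uc: "Q n = uc E n (\<lambda>\<mu> \<nu>. if \<mu> = \<nu> \<and> \<mu> \<in> G n then 1 else 0)"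
proof -
  have "uc E n (\<lambda>\<mu> \<nu>. if \<mu> = \<nu> \<and> \<mu> \<in> G n then 1 else 0) =
      (\<Sum>p\<in>(\<lambda>\<mu>. (\<mu>, \<mu>)) ` G n. E (fst p) (snd p))"
    unfolding unit_combination_def case_prod_unfold
    using finite_unit_indices
    by (intro sum.mono_neutral_cong_right) (auto simp: mem_unit_indices geodesic_in_paths)
  also have "\<dots> = (\<Sum>\<mu>\<in>G n. E \<mu> \<mu>)"
    by (subst sum.reindex) (auto simp: inj_on_def)
  finally show ?thesis by (simp add: geodesic_projection_def)
qed

lemma Q_compress: "Q n * uc E n c * Q n = uc' E n c"
  unfolding Q_eq_uc uc_mult uc'_eq_uc
proof (rule unit_combination_cong)
  let ?q = "\<lambda>\<mu> \<nu>. if \<mu> = \<nu> \<and> \<mu> \<in> G n then 1 else 0 :: complex"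
  let ?t = "matrix_times (paths Br v0 n) (path_range Br v0)"
  have left: "?t ?q d \<mu> \<nu> = (if \<mu> \<in> G n then d \<mu> \<nu> else 0)" if "\<mu> \<in> paths Br v0 n" for d \<mu> \<nu>
  proof -
    have "?t ?q d \<mu> \<nu> = (\<Sum>\<kappa>\<in>paths Br v0 n. if \<kappa> = \<mu> then (if \<mu> \<in> G n then d \<mu> \<nu> else 0) else 0)"
      unfolding matrix_times_def by (intro sum.cong refl) auto
    then show ?thesis using that finite_paths by simp
  qed
  have right: "?t d ?q \<mu> \<nu> = (if \<nu> \<in> G n then d \<mu> \<nu> else 0)" if "(\<mu>, \<nu>) \<in> unit_indices Br v0 n" for d \<mu> \<nu>
  proof -
    have "?t d ?q \<mu> \<nu> = (\<Sum>\<kappa>\<in>paths Br v0 n. if \<kappa> = \<nu> then (if \<nu> \<in> G n then d \<mu> \<nu> else 0) else 0)"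
      unfolding matrix_times_def using that by (intro sum.cong refl) (auto simp: mem_unit_indices)
    then show ?thesis using that finite_paths by (simp add: mem_unit_indices)
  qed
  fix \<mu> \<nu> assume *: "(\<mu>, \<nu>) \<in> unit_indices Br v0 n"
  then have "?t (?t ?q c) ?q \<mu> \<nu> = (if \<mu> \<in> G n \<and> \<nu> \<in> G n then c \<mu> \<nu> else 0)"
    using left[of \<mu> c \<nu>] by (simp add: right) (simp add: mem_unit_indices)
  then show "?t (?t ?q c) ?q \<mu> \<nu> *\<^sub>C E \<mu> \<nu> = (if \<mu> \<in> G n \<and> \<nu> \<in> G n then c \<mu> \<nu> else 0) *\<^sub>C E \<mu> \<nu>"
    by simp
qed

lemma norm_Q_le: "norm (Q n) \<le> 1"
proof -
  have "star (Q n) = Q n"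
    unfolding Q_eq_uc uc_star by (rule unit_combination_cong) (auto simp: adjoint_matrix_def)
  moreover have "Q n * Q n = Q n"
  proof -
    have "1 = uc E n (\<lambda>\<mu> \<nu>. if \<mu> = \<nu> then 1 else 0)"
    proof -
      have "uc E n (\<lambda>\<mu> \<nu>. if \<mu> = \<nu> then 1 else 0) =
          (\<Sum>p\<in>(\<lambda>\<mu>. (\<mu>, \<mu>)) ` paths Br v0 n. E (fst p) (snd p))"
        unfolding unit_combination_def case_prod_unfold
        using finite_unit_indices
        by (intro sum.mono_neutral_cong_right) (auto simp: mem_unit_indices)
      also have "\<dots> = (\<Sum>\<mu>\<in>paths Br v0 n. E \<mu> \<mu>)"
        by (subst sum.reindex) (auto simp: inj_on_def)
      finally show ?thesis by (simp add: units_sum)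
    qed
    then have "Q n * Q n = uc' E n (\<lambda>\<mu> \<nu>. if \<mu> = \<nu> then 1 else 0)"
      using Q_compress[of n "\<lambda>\<mu> \<nu>. if \<mu> = \<nu> then 1 else 0"] by simp
    also have "\<dots> = Q n"
      unfolding uc'_eq_uc Q_eq_uc by (rule unit_combination_cong) auto
    finally show ?thesis .
  qed
  ultimately have "norm (Q n) = (norm (Q n))\<^sup>2"
    using cstar_identity[of "Q n"] by simp
  then show ?thesis by (cases "norm (Q n) = 0") (simp_all add: power2_eq_square)
qed

text \<open>
  The right hand side dominates the norm of the corner cut out by \<open>Q n\<close>, and the identification of
  this corner with the algebra of the subdiagram is isometric.
\<close>

lemma norm_uc'_le: "norm (uc' E' n c) \<le> norm (uc E n c)"
proof -
  have "norm (Q n * uc E n c * Q n) \<le> norm (Q n) * norm (uc E n c) * norm (Q n)"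
    by (meson mult_right_mono norm_ge_zero norm_mult_ineq order_trans)
  also have "\<dots> \<le> 1 * norm (uc E n c) * 1"
    using norm_Q_le by (intro mult_mono) auto
  finally show ?thesis by (simp add: Q_compress norm_uc'_eq)
qed

text \<open>The map \<open>Q\<^sub>F\<close>, obtained on the whole algebra at once; see \<open>geodesic_map_eq\<close>.\<close>

definition compression :: "'a \<Rightarrow> 'b" where
  "compression = (SOME T. linear_contraction T \<and> (\<forall>n c. T (uc E n c) = uc' E' n c))"

lemma linear_contraction_compression: "linear_contraction compression"
  and compression_uc: "compression (uc E n c) = uc' E' n c"
proof -
  \<comment> \<open>Extensions of a geodesic path by arrows outside the subdiagram get the value 0, so refinement in
     the large diagram reduces to refinement in the subdiagram.\<close>
  define W where "W \<mu> \<nu> = (if \<mu> \<in> G (length \<mu>) \<and> \<nu> \<in> G (length \<nu>) then E' \<mu> \<nu> else 0)" for \<mu> \<nu>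
  have uc_W: "uc W n c = uc' E' n c" for n c
    unfolding uc'_eq_uc
  proof (rule unit_combination_cong)
    fix \<mu> \<nu> assume "(\<mu>, \<nu>) \<in> unit_indices Br v0 n"
    then have "length \<mu> = n" "length \<nu> = n" by (auto simp: mem_unit_indices dest: length_paths)
    then show "c \<mu> \<nu> *\<^sub>C W \<mu> \<nu> = (if \<mu> \<in> G n \<and> \<nu> \<in> G n then c \<mu> \<nu> else 0) *\<^sub>C E' \<mu> \<nu>"
      by (simp add: W_def)
  qed
  have "refines Br v0 W"
    unfolding refines_def
  proof safe
    fix n \<mu> \<nu> assume *: "(\<mu>, \<nu>) \<in> unit_indices Br v0 n"
    then have len: "length \<mu> = n" "length \<nu> = n"
      and paths: "\<mu> \<in> paths Br v0 n" "\<nu> \<in> paths Br v0 n" "path_range Br v0 \<mu> = path_range Br v0 \<nu>"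
      by (auto simp: mem_unit_indices dest: length_paths)
    have fin: "finite (out_arcs Br (path_range Br v0 \<mu>))"
      by (rule emits_finite[OF path_range_in_verts[OF paths(1)]])
    show "W \<mu> \<nu> = (\<Sum>a\<in>out_arcs Br (path_range Br v0 \<mu>). W (\<mu> @ [a]) (\<nu> @ [a]))"
    proof (cases "\<mu> \<in> G n \<and> \<nu> \<in> G n")
      case False
      then have "W (\<mu> @ [a]) (\<nu> @ [a]) = 0" for a
        using len by (auto simp: W_def snoc_in_paths)
      then show ?thesis using False len by (auto simp: W_def)
    next
      case True
      have "(\<Sum>a\<in>out_arcs Br (path_range Br v0 \<mu>). W (\<mu> @ [a]) (\<nu> @ [a])) =
          (\<Sum>a\<in>out_arcs Br' (path_range Br v0 \<mu>). E' (\<mu> @ [a]) (\<nu> @ [a]))"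
        using True len paths fin geodesic_arcs_subset[of F]
        by (intro sum.mono_neutral_cong_right) (auto simp: W_def snoc_in_paths)
      also have "\<dots> = E' \<mu> \<nu>"
        using Sub.units_refine[of \<mu> \<nu> n] * True by (simp add: mem_unit_indices')
      finally show ?thesis using True len by (simp add: W_def)
    qed
  qed
  moreover have "norm (uc W n c) \<le> norm (uc E n c)" for n c
    unfolding uc_W by (rule norm_uc'_le)
  ultimately have "\<exists>T. linear_contraction T \<and> (\<forall>n c. T (uc E n c) = uc' E' n c)"
    using contraction_extension[of W] unfolding uc_W by blast
  from someI_ex[OF this, folded compression_def]
  show "linear_contraction compression" "compression (uc E n c) = uc' E' n c" by blast+
qed

lemma compression_star: "compression (star x) = star (compression x)"
proof (rule AF_closed_induct[of "\<lambda>x. compression (star x) = star (compression x)"])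
  note cont = linear_contraction_continuous[OF linear_contraction_compression]
  note star = linear_continuous_on[OF bounded_linear_star]
  show "closed {x. compression (star x) = star (compression x)}"
    by (intro closed_Collect_eq continuous_on_compose2[OF cont star] continuous_on_compose2[OF star cont]) auto
  show "compression (star (uc E n c)) = star (compression (uc E n c))" for n c
    unfolding uc_star compression_uc uc'_eq_comb by (rule matrix_units.comb_star[OF matrix_units_subdiagram, symmetric])
qed

lemma compression_one: "compression 1 = 1"
proof -
  have "unit_indices Br' v0 0 = {([], [])}"
    by (auto simp: unit_indices_def paths_0)
  then have "uc' E' 0 (\<lambda>\<mu> \<nu>. 1) = 1"
    using Sub.units_sum[of 0] by (simp add: unit_combination_def paths_0)
  then show ?thesis unfolding one_eq_uc compression_uc .
qed

text \<open>
  Two geodesic paths with a common range have the same potential, so the mean expectation keeps the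
  coefficient of every pair of geodesic paths.
\<close>

lemma compression_mean_map: "compression (mean_map x) = compression x"
proof (rule AF_closed_induct[of "\<lambda>x. compression (mean_map x) = compression x"])
  note cont = linear_contraction_continuous
  show "closed {x. compression (mean_map x) = compression x}"
    by (intro closed_Collect_eq cont linear_contraction_compression linear_contraction_mean_map
        continuous_on_compose2[OF cont[OF linear_contraction_compression] cont[OF linear_contraction_mean_map]]) auto
  show "compression (mean_map (uc E n c)) = compression (uc E n c)" for n c
    unfolding mean_map_uc compression_uc
    by (rule unit_combination_cong) (auto simp: mem_unit_indices potential_constant_on_geodesics resonant_def)
qed

text \<open>
  A matrix coefficient of a fixed element couples a geodesic path only to paths of the same range and
  the same potential, and those are geodesic; so \<open>Q n\<close> commutes with the fixed elements of level \<open>n\<close>.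
\<close>

lemma compression_mult_uc:
  assumes c: "uc E n c \<in> Fix"
  shows "compression (uc E n c * uc E n d) = compression (uc E n c) * compression (uc E n d)"
proof -
  have "uc' E' n (matrix_times (paths Br v0 n) (path_range Br v0) c d) =
      uc' E' n (matrix_times (G n) (path_range Br v0) c d)"
  proof (rule unit_combination_cong)
    fix \<mu> \<nu> assume "(\<mu>, \<nu>) \<in> unit_indices Br' v0 n"
    then have \<mu>: "\<mu> \<in> G n" by (simp add: mem_unit_indices)
    have "c \<mu> \<kappa> = 0" if \<kappa>: "\<kappa> \<in> paths Br v0 n" "\<kappa> \<notin> G n" "path_range Br v0 \<kappa> = path_range Br v0 \<mu>" for \<kappa>
    proof -
      have "freq \<mu> \<kappa> \<noteq> 0"
        using geodesic_path_exchange[OF \<mu> \<kappa>(1) \<kappa>(3)] \<kappa>(2) by (auto simp: freq_def)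
      moreover have "(\<mu>, \<kappa>) \<in> unit_indices Br v0 n"
        using \<mu> \<kappa> by (simp add: mem_unit_indices geodesic_in_paths)
      ultimately show ?thesis using c unfolding uc_in_Fix_iff by blast
    qed
    then have "matrix_times (paths Br v0 n) (path_range Br v0) c d \<mu> \<nu> =
        matrix_times (G n) (path_range Br v0) c d \<mu> \<nu>"
      unfolding matrix_times_def
      by (intro sum.mono_neutral_right finite_paths) (auto simp: geodesic_in_paths)
    then show "matrix_times (paths Br v0 n) (path_range Br v0) c d \<mu> \<nu> *\<^sub>C E' \<mu> \<nu> =
        matrix_times (G n) (path_range Br v0) c d \<mu> \<nu> *\<^sub>C E' \<mu> \<nu>" by simp
  qed
  then show ?thesis
    unfolding uc_mult compression_uc
    by (simp add: uc'_eq_comb matrix_units.comb_mult[OF matrix_units_subdiagram])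
qed

lemma compression_mult:
  assumes "x \<in> Fix" "y \<in> Fix"
  shows "compression (x * y) = compression x * compression y"
proof -
  obtain n c where X: "(\<lambda>k. uc E (n k) (c k)) \<longlonglongrightarrow> x" "\<forall>k. uc E (n k) (c k) \<in> Fix"
    using assms(1) by (rule Fix_sequence)
  obtain m d where Y: "(\<lambda>k. uc E (m k) (d k)) \<longlonglongrightarrow> y" "\<forall>k. uc E (m k) (d k) \<in> Fix"
    using assms(2) by (rule Fix_sequence)
  have "compression (uc E (n k) (c k) * uc E (m k) (d k)) =
      compression (uc E (n k) (c k)) * compression (uc E (m k) (d k))" for k
  proof -
    obtain c' where c': "uc E (n k) (c k) = uc E (max (n k) (m k)) c'"
      using uc_raise[of "n k" "max (n k) (m k)" E "c k", OF max.cobounded1 refines_E] by (elim exE conjE)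
    obtain d' where d': "uc E (m k) (d k) = uc E (max (n k) (m k)) d'"
      using uc_raise[of "m k" "max (n k) (m k)" E "d k", OF max.cobounded2 refines_E] by (elim exE conjE)
    show ?thesis
      using compression_mult_uc X(2) unfolding c' d' by (metis c')
  qed
  moreover note lim = linear_contraction_tendsto[OF linear_contraction_compression]
  have "(\<lambda>k. compression (uc E (n k) (c k) * uc E (m k) (d k))) \<longlonglongrightarrow> compression (x * y)"
    by (intro lim tendsto_mult X(1) Y(1))
  moreover have "(\<lambda>k. compression (uc E (n k) (c k)) * compression (uc E (m k) (d k))) \<longlonglongrightarrow>
      compression x * compression y"
    by (intro lim tendsto_mult X(1) Y(1))
  ultimately show ?thesis by (simp add: LIMSEQ_unique)
qed

lemma compression_lift:
  shows "compression (uc' E n c) = uc' E' n c" and "uc' E n c \<in> Fix"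
proof -
  show "compression (uc' E n c) = uc' E' n c"
    unfolding uc'_eq_uc[of E] compression_uc
    by (rule unit_combination_cong) (simp add: mem_unit_indices)
  show "uc' E n c \<in> Fix"
    unfolding uc'_eq_uc uc_in_Fix_iff by (auto simp: mem_unit_indices potential_constant_on_geodesics)
qed

text \<open>
  On the dense subalgebra there are norm preserving lifts; the general element is reached by a
  series of lifts of ever better corrections.
\<close>

lemma compression_surj: "\<exists>a\<in>Fix. compression a = b"
proof -
  have approx: "\<exists>a. a \<in> Fix \<and> norm (b - compression a) < e \<and> norm a \<le> norm b + e" if "e > 0" for b e
  proof -
    have "b \<in> closure (\<Union>n. AF_level Br' v0 E' n)" using Sub.dense_levels by simp
    then obtain b' where "b' \<in> (\<Union>n. AF_level Br' v0 E' n)" and b': "dist b' b < e"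
      unfolding closure_approachable using \<open>e > 0\<close> by blast
    then obtain n c where b'_eq: "b' = uc' E' n c" unfolding AF_level_def by blast
    have "norm b' \<le> norm b + e"
      using b' norm_triangle_ineq[of b "b' - b"] by (simp add: dist_norm)
    then show ?thesis
      using b' b'_eq compression_lift[of n c] norm_uc'_eq[of n c]
      by (intro exI[of _ "uc' E n c"]) (simp add: dist_norm norm_minus_commute)
  qed
  define sel where "sel b k = (SOME a. a \<in> Fix \<and> norm (b - compression a) < (1/2)^k \<and> norm a \<le> norm b + (1/2)^k)"
    for b and k :: nat
  have sel: "sel b k \<in> Fix \<and> norm (b - compression (sel b k)) < (1/2)^k \<and> norm (sel b k) \<le> norm b + (1/2)^k" for b k
    unfolding sel_def by (rule someI_ex[OF approx]) simp
  define r where "r = rec_nat b (\<lambda>k bk. bk - compression (sel bk k))"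
  have r: "r 0 = b" "r (Suc k) = r k - compression (sel (r k) k)" for k by (simp_all add: r_def)
  have norm_r: "norm (r (Suc k)) \<le> (1/2)^k" for k using sel[of "r k" k] by (simp add: r)
  define s where "s k = (\<Sum>j<k. sel (r j) j)" for k
  have sel_le: "norm (sel (r (Suc k)) (Suc k)) \<le> 2 * (1/2)^k" for k
  proof -
    have "norm (sel (r (Suc k)) (Suc k)) \<le> norm (r (Suc k)) + (1/2)^(Suc k)" using sel by blast
    also have "\<dots> \<le> (1/2)^k + (1/2)^k"
      by (intro add_mono norm_r power_decreasing) auto
    finally show ?thesis by simp
  qed
  have "summable (\<lambda>k. 2 * (1/2::real)^k)" by (intro summable_mult summable_geometric) simp
  then have "summable (\<lambda>k. norm (sel (r (Suc k)) (Suc k)))"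
    by (rule summable_comparison_test'[where N = 0]) (simp only: real_norm_def abs_norm_cancel sel_le)
  then have "summable (\<lambda>k. sel (r (Suc k)) (Suc k))" by (rule summable_norm_cancel)
  then have "summable (\<lambda>k. sel (r k) k)" by (subst (asm) summable_Suc_iff)
  then obtain a where a: "s \<longlonglongrightarrow> a" unfolding summable_def sums_def s_def by blast
  have s_Fix: "s k \<in> Fix" for k
  proof (induction k)
    case 0
    then show ?case using Fix_scaleC[OF Fix_one, of 0] by (simp add: s_def)
  next
    case (Suc k)
    then show ?case using sel Fix_add by (simp add: s_def)
  qed
  have "a \<in> Fix" using closed_sequentially[OF closed_Fix] s_Fix a by blast
  have T_s: "compression (s k) = b - r k" for k
    by (induction k) (simp_all add: s_def r linear_contraction_zero[OF linear_contraction_compression]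
        linear_contraction_add[OF linear_contraction_compression])
  have "(\<lambda>k. r (Suc k)) \<longlonglongrightarrow> 0"
    by (rule Lim_null_comparison[OF always_eventually LIMSEQ_realpow_zero[of "1/2"]])
      (use norm_r in auto)
  then have "r \<longlonglongrightarrow> 0" by (simp add: filterlim_sequentially_Suc)
  then have "(\<lambda>k. compression (s k)) \<longlonglongrightarrow> b - 0" unfolding T_s by (intro tendsto_diff tendsto_const)
  moreover have "(\<lambda>k. compression (s k)) \<longlonglongrightarrow> compression a"
    by (rule linear_contraction_tendsto[OF linear_contraction_compression a])
  ultimately have "compression a = b" using LIMSEQ_unique by fastforce
  then show ?thesis using \<open>a \<in> Fix\<close> by blast
qed

text \<open>
  The elements of the levels are dense in the fixed point algebra, and on them the value is prescribed;
  so \<open>compression\<close> is the only candidate.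
\<close>

lemma corner_hom_eq: "corner_hom Br v0 E E' F = restrict compression Fix"
  unfolding corner_hom_def Let_def gauge_action_eq
proof (rule the_equality)
  let ?P = "\<lambda>q. q \<in> extensional Fix \<and> star_hom_on Fix q \<and> q ` Fix = UNIV \<and>
      (\<forall>n. \<forall>a\<in>AF_level Br v0 E n \<inter> Fix. \<exists>c. Q n * a * Q n = uc' E n c \<and> q a = uc' E' n c)"
  have "star_hom_on Fix (restrict compression Fix)"
    unfolding star_hom_on_def
  proof (intro conjI ballI allI)
    have "continuous_on Fix compression"
      by (rule linear_contraction_continuous[OF linear_contraction_compression])
    then show "continuous_on Fix (restrict compression Fix)" by (simp cong: continuous_on_cong)
  qed (simp_all add: Fix_add Fix_scaleC Fix_mult Fix_star Fix_one compression_mult compression_star compression_one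
      linear_contraction_add[OF linear_contraction_compression] linear_contraction_scaleC[OF linear_contraction_compression])
  moreover have "restrict compression Fix ` Fix = UNIV"
    using compression_surj by (auto simp: image_iff) metis
  moreover have "\<exists>c. Q n * a * Q n = uc' E n c \<and> restrict compression Fix a = uc' E' n c"
    if a: "a \<in> AF_level Br v0 E n \<inter> Fix" for n a
  proof -
    obtain c where "a = uc E n c" using a unfolding AF_level_def by blast
    then show ?thesis using a by (intro exI[of _ c]) (simp add: Q_compress compression_uc)
  qed
  ultimately show "?P (restrict compression Fix)" by (simp add: restrict_extensional)
  fix q assume q: "?P q"
  have level: "q (uc E n c) = compression (uc E n c)" if "uc E n c \<in> Fix" for n c
  proof -
    have "uc E n c \<in> AF_level Br v0 E n \<inter> Fix" using that by (auto simp: AF_level_def)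
    then obtain d where d: "Q n * uc E n c * Q n = uc' E n d" "q (uc E n c) = uc' E' n d"
      using q by blast
    then have "uc' E n c = uc' E n d" by (simp add: Q_compress)
    then have "uc' E n (\<lambda>\<mu> \<nu>. c \<mu> \<nu> - d \<mu> \<nu>) = 0" using unit_combination_diff[of Br' v0 E n c d] by simp
    then have "norm (uc' E' n (\<lambda>\<mu> \<nu>. c \<mu> \<nu> - d \<mu> \<nu>)) = 0" by (simp add: norm_uc'_eq)
    then have "uc' E' n c = uc' E' n d" using unit_combination_diff[of Br' v0 E' n c d] by simp
    then show ?thesis by (simp add: d compression_uc)
  qed
  have "q x = compression x" if "x \<in> Fix" for x
  proof -
    obtain n c where X: "(\<lambda>k. uc E (n k) (c k)) \<longlonglongrightarrow> x" "\<forall>k. uc E (n k) (c k) \<in> Fix"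
      using \<open>x \<in> Fix\<close> by (rule Fix_sequence)
    have "continuous_on Fix q" using q by (simp add: star_hom_on_def)
    then have "(\<lambda>k. q (uc E (n k) (c k))) \<longlonglongrightarrow> q x"
      using X(1) \<open>x \<in> Fix\<close> by (rule continuous_on_tendsto_compose) (simp add: X(2))
    moreover have "(\<lambda>k. q (uc E (n k) (c k))) \<longlonglongrightarrow> compression x"
      using linear_contraction_tendsto[OF linear_contraction_compression X(1)] by (simp add: level X(2))
    ultimately show ?thesis by (rule LIMSEQ_unique)
  qed
  then show "q = restrict compression Fix"
    using q by (intro extensionalityI[of q Fix]) auto
qed

lemma geodesic_map_eq: "geodesic_map Br v0 E E' F = compression"
  by (simp add: fun_eq_iff geodesic_map_def corner_hom_eq gauge_action_eq mean_expectation_eq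
      mean_map_in_Fix compression_mean_map)

end

section \<open>Ground states\<close>

context geodesic_system
begin

text \<open>
  Compressed to the geodesics, \<open>a\<^sup>* b\<close> is a sum over all paths \<open>\<mu>\<close> of the products of the rows of
  \<open>a\<close> and \<open>b\<close> with index \<open>\<mu>\<close>.  A row is moved into the algebra of the subdiagram by attaching it to
  an arbitrary geodesic path with the same range; the weights \<open>h \<mu>\<close> leave the sum positive.
\<close>

lemma state_compression_weighted_nonneg:
  assumes \<omega>: "\<omega> \<in> state_space"
    and g: "\<And>\<mu> \<nu>. (\<mu>, \<nu>) \<in> unit_indices Br v0 n \<Longrightarrow> \<nu> \<in> G n \<Longrightarrow> g \<mu> \<nu> = h \<mu> \<and> h \<mu> \<ge> (0::real)"
  shows "\<omega> (compression (star (uc E n c) * uc E n (\<lambda>\<mu> \<nu>. of_real (g \<mu> \<nu>) * c \<mu> \<nu>))) \<in> \<real>\<^sub>\<ge>\<^sub>0"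
proof -
  let ?r = "path_range Br v0"
  define M where "M = {\<mu> \<in> paths Br v0 n. \<exists>\<kappa>\<in>G n. ?r \<kappa> = ?r \<mu>}"
  have "finite M" by (rule finite_subset[OF _ finite_paths[of n]]) (auto simp: M_def)
  have "\<forall>\<mu>\<in>M. \<exists>\<kappa>. \<kappa> \<in> G n \<and> ?r \<kappa> = ?r \<mu>" by (auto simp: M_def)
  then obtain k where k: "\<And>\<mu>. \<mu> \<in> M \<Longrightarrow> k \<mu> \<in> G n \<and> ?r (k \<mu>) = ?r \<mu>" by metis
  define b where "b \<mu> = uc' E' n (\<lambda>\<kappa> \<nu>. if \<kappa> = k \<mu> then c \<mu> \<nu> else 0)" for \<mu>
  have bb: "star (b \<mu>) * b \<mu> = comb (G n) ?r E' (\<lambda>\<nu> \<nu>'. if ?r \<nu> = ?r \<mu> then cnj (c \<mu> \<nu>) * c \<mu> \<nu>' else 0)"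
    if \<mu>: "\<mu> \<in> M" for \<mu>
  proof -
    have "matrix_times (G n) ?r (adjoint_matrix (\<lambda>\<kappa> \<nu>. if \<kappa> = k \<mu> then c \<mu> \<nu> else 0))
        (\<lambda>\<kappa> \<nu>. if \<kappa> = k \<mu> then c \<mu> \<nu> else 0) \<nu> \<nu>' =
      (\<Sum>\<kappa>\<in>G n. if \<kappa> = k \<mu> then (if ?r \<nu> = ?r \<mu> then cnj (c \<mu> \<nu>) * c \<mu> \<nu>' else 0) else 0)" for \<nu> \<nu>'
      unfolding matrix_times_def adjoint_matrix_def using k[OF \<mu>] by (intro sum.cong refl) auto
    then have "matrix_times (G n) ?r (adjoint_matrix (\<lambda>\<kappa> \<nu>. if \<kappa> = k \<mu> then c \<mu> \<nu> else 0))
        (\<lambda>\<kappa> \<nu>. if \<kappa> = k \<mu> then c \<mu> \<nu> else 0) \<nu> \<nu>' =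
      (if ?r \<nu> = ?r \<mu> then cnj (c \<mu> \<nu>) * c \<mu> \<nu>' else 0)" for \<nu> \<nu>'
      using k[OF \<mu>] finite_G by simp
    then show ?thesis
      unfolding b_def uc'_eq_comb matrix_units.comb_star[OF matrix_units_subdiagram] matrix_units.comb_mult[OF matrix_units_subdiagram]
      by (intro comb_cong) simp
  qed
  have "compression (star (uc E n c) * uc E n (\<lambda>\<mu> \<nu>. of_real (g \<mu> \<nu>) * c \<mu> \<nu>)) =
      comb (G n) ?r E' (\<lambda>\<nu> \<nu>'. \<Sum>\<mu>\<in>M. of_real (h \<mu>) * (if ?r \<nu> = ?r \<mu> then cnj (c \<mu> \<nu>) * c \<mu> \<nu>' else 0))"
    unfolding uc_star uc_mult compression_uc uc'_eq_comb
  proof (rule comb_cong)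
    fix \<nu> \<nu>' assume *: "\<nu> \<in> G n" "\<nu>' \<in> G n" "?r \<nu> = ?r \<nu>'"
    have "(\<Sum>\<mu>\<in>M. of_real (h \<mu>) * (if ?r \<nu> = ?r \<mu> then cnj (c \<mu> \<nu>) * c \<mu> \<nu>' else 0)) =
        matrix_times (paths Br v0 n) ?r (adjoint_matrix c) (\<lambda>\<mu> \<nu>. of_real (g \<mu> \<nu>) * c \<mu> \<nu>) \<nu> \<nu>'"
      unfolding matrix_times_def adjoint_matrix_def
    proof (rule sum.mono_neutral_cong_left)
      fix \<mu> assume "\<mu> \<in> M"
      then have "g \<mu> \<nu>' = h \<mu>" if "?r \<nu> = ?r \<mu>"
        using that g[of \<mu> \<nu>'] * by (simp add: M_def mem_unit_indices geodesic_in_paths)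
      then show "of_real (h \<mu>) * (if ?r \<nu> = ?r \<mu> then cnj (c \<mu> \<nu>) * c \<mu> \<nu>' else 0) =
          (if ?r \<mu> = ?r \<nu> then cnj (c \<mu> \<nu>) * (of_real (g \<mu> \<nu>') * c \<mu> \<nu>') else 0)"
        by (cases "?r \<mu> = ?r \<nu>") simp_all
    next
      show "\<forall>\<mu>\<in>paths Br v0 n - M.
          (if ?r \<mu> = ?r \<nu> then cnj (c \<mu> \<nu>) * (of_real (g \<mu> \<nu>') * c \<mu> \<nu>') else 0) = 0"
        using * by (auto simp: M_def)
    qed (auto simp: M_def finite_paths)
    then show "matrix_times (paths Br v0 n) ?r (adjoint_matrix c) (\<lambda>\<mu> \<nu>. of_real (g \<mu> \<nu>) * c \<mu> \<nu>) \<nu> \<nu>' *\<^sub>C E' \<nu> \<nu>' =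
        (\<Sum>\<mu>\<in>M. of_real (h \<mu>) * (if ?r \<nu> = ?r \<mu> then cnj (c \<mu> \<nu>) * c \<mu> \<nu>' else 0)) *\<^sub>C E' \<nu> \<nu>'"
      by (simp only:)
  qed
  also have "\<dots> = (\<Sum>\<mu>\<in>M. of_real (h \<mu>) *\<^sub>C (star (b \<mu>) * b \<mu>))"
    unfolding comb_sum[symmetric] comb_scaleC[symmetric] by (intro sum.cong refl) (simp add: bb)
  finally have eq: "\<omega> (compression (star (uc E n c) * uc E n (\<lambda>\<mu> \<nu>. of_real (g \<mu> \<nu>) * c \<mu> \<nu>))) =
      (\<Sum>\<mu>\<in>M. of_real (h \<mu>) * \<omega> (star (b \<mu>) * b \<mu>))"
    by (simp add: state_sum[OF \<omega>] state_scaleC[OF \<omega>])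
  have "of_real (h \<mu>) * \<omega> (star (b \<mu>) * b \<mu>) \<in> \<real>\<^sub>\<ge>\<^sub>0" if \<mu>: "\<mu> \<in> M" for \<mu>
  proof -
    have "h \<mu> \<ge> 0" using g[of \<mu> "k \<mu>"] k[OF \<mu>] \<mu> by (simp add: M_def mem_unit_indices geodesic_in_paths)
    then show ?thesis by (intro nonneg_Reals_mult_I state_nonneg[OF \<omega>]) simp
  qed
  then show ?thesis unfolding eq by (induction M rule: infinite_finite_induct) (simp_all add: nonneg_Reals_add_I)
qed

lemma state_compression_tendsto:
  assumes "\<omega> \<in> state_space" "(f \<longlongrightarrow> l) net"
  shows "((\<lambda>k. \<omega> (compression (f k))) \<longlongrightarrow> \<omega> (compression l)) net"
  by (intro state_tendsto[OF assms(1)] linear_contraction_tendsto[OF linear_contraction_compression] assms(2))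

lemma compression_state:
  assumes \<omega>: "\<omega> \<in> state_space"
  shows "\<omega> \<circ> compression \<in> state_space"
proof -
  have "\<omega> (compression (star x * x)) \<in> \<real>\<^sub>\<ge>\<^sub>0" for x
  proof -
    obtain n c where X: "(\<lambda>k. uc E (n k) (c k)) \<longlonglongrightarrow> x" by (rule AF_sequence)
    have nonneg: "\<omega> (compression (star (uc E (n k) (c k)) * uc E (n k) (c k))) \<in> \<real>\<^sub>\<ge>\<^sub>0" for k
      using state_compression_weighted_nonneg[OF \<omega>, of "n k" "\<lambda>_ _. 1" "\<lambda>_. 1" "c k"] by simp
    have lim: "(\<lambda>k. \<omega> (compression (star (uc E (n k) (c k)) * uc E (n k) (c k)))) \<longlonglongrightarrow> \<omega> (compression (star x * x))"
      by (intro state_compression_tendsto \<omega> tendsto_mult tendsto_star X)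
    show ?thesis
      by (rule closed_sequentially[OF closed_nonneg_Reals_complex _ lim]) (rule nonneg)
  qed
  then show ?thesis
    using linear_contraction_compression
    by (simp add: state_space_def linear_contraction_add linear_contraction_scaleC compression_one
        state_add[OF \<omega>] state_scaleC[OF \<omega>] state_one[OF \<omega>])
qed

text \<open>
  On a level, \<open>- \<i>\<close> times the generator multiplies the coefficient of \<open>E \<mu> \<nu>\<close> by \<open>freq \<mu> \<nu>\<close>, which for
  geodesic \<open>\<nu>\<close> is the excess of \<open>\<mu>\<close> over the least potential at its range.
\<close>

lemma compression_ground_state:
  assumes \<omega>: "\<omega> \<in> state_space"
  shows "\<omega> \<circ> compression \<in> ground_states flow_map"
proof -
  define h where "h \<mu> = freq \<mu> (SOME \<kappa>. \<kappa> \<in> G (length \<mu>) \<and> path_range Br v0 \<kappa> = path_range Br v0 \<mu>)" for \<mu>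
  have h: "freq \<mu> \<nu> = h \<mu> \<and> h \<mu> \<ge> 0" if *: "(\<mu>, \<nu>) \<in> unit_indices Br v0 n" "\<nu> \<in> G n" for n \<mu> \<nu>
  proof -
    have len: "length \<mu> = n" using *(1) by (auto simp: mem_unit_indices dest: length_paths)
    define \<kappa> where "\<kappa> = (SOME \<kappa>. \<kappa> \<in> G (length \<mu>) \<and> path_range Br v0 \<kappa> = path_range Br v0 \<mu>)"
    have "\<exists>\<kappa>. \<kappa> \<in> G (length \<mu>) \<and> path_range Br v0 \<kappa> = path_range Br v0 \<mu>"
      using * len by (auto simp: mem_unit_indices)
    from someI_ex[OF this, folded \<kappa>_def] have \<kappa>: "\<kappa> \<in> G n" "path_range Br v0 \<kappa> = path_range Br v0 \<mu>"
      by (simp_all add: len)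
    have "freq \<nu> \<kappa> = 0"
      using potential_constant_on_geodesics[OF *(2) \<kappa>(1)] \<kappa>(2) *(1) by (simp add: mem_unit_indices)
    moreover have "freq \<mu> \<kappa> \<ge> 0"
      using minimalD(2)[OF geodesic_path_minimal[OF \<kappa>(1)], of \<mu>] \<kappa> *(1) length_paths[OF \<kappa>(1)]
      by (simp add: mem_unit_indices freq_def)
    ultimately show ?thesis by (simp add: h_def \<kappa>_def[symmetric] freq_def)
  qed
  have "- \<i> * \<omega> (compression (star a * generator flow_map a)) \<in> \<real>\<^sub>\<ge>\<^sub>0" if a: "a \<in> generator_domain flow_map" for a
  proof -
    obtain n c where X: "(\<lambda>k. uc E (n k) (c k)) \<longlonglongrightarrow> a"
      "(\<lambda>k. uc E (n k) (\<lambda>\<mu> \<nu>. \<i> * of_real (freq \<mu> \<nu>) * c k \<mu> \<nu>)) \<longlonglongrightarrow> generator flow_map a"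
      using a by (rule generator_core)
    have nonneg: "- \<i> * \<omega> (compression (star (uc E (n k) (c k)) * uc E (n k) (\<lambda>\<mu> \<nu>. \<i> * of_real (freq \<mu> \<nu>) * c k \<mu> \<nu>))) \<in> \<real>\<^sub>\<ge>\<^sub>0" for k
    proof -
      have "uc E (n k) (\<lambda>\<mu> \<nu>. \<i> * of_real (freq \<mu> \<nu>) * c k \<mu> \<nu>) =
          \<i> *\<^sub>C uc E (n k) (\<lambda>\<mu> \<nu>. of_real (freq \<mu> \<nu>) * c k \<mu> \<nu>)"
        by (simp only: unit_combination_scaleC mult.assoc)
      then have "- \<i> * \<omega> (compression (star (uc E (n k) (c k)) * uc E (n k) (\<lambda>\<mu> \<nu>. \<i> * of_real (freq \<mu> \<nu>) * c k \<mu> \<nu>))) =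
          \<omega> (compression (star (uc E (n k) (c k)) * uc E (n k) (\<lambda>\<mu> \<nu>. of_real (freq \<mu> \<nu>) * c k \<mu> \<nu>)))"
        by (simp add: mult_scaleC_right linear_contraction_scaleC[OF linear_contraction_compression] state_scaleC[OF \<omega>])
      moreover have "\<omega> (compression (star (uc E (n k) (c k)) * uc E (n k) (\<lambda>\<mu> \<nu>. of_real (freq \<mu> \<nu>) * c k \<mu> \<nu>))) \<in> \<real>\<^sub>\<ge>\<^sub>0"
        by (rule state_compression_weighted_nonneg[OF \<omega>, of "n k" freq h "c k"]) (rule h)
      ultimately show ?thesis by (simp only:)
    qed
    have lim: "(\<lambda>k. - \<i> * \<omega> (compression (star (uc E (n k) (c k)) * uc E (n k) (\<lambda>\<mu> \<nu>. \<i> * of_real (freq \<mu> \<nu>) * c k \<mu> \<nu>))))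
        \<longlonglongrightarrow> - \<i> * \<omega> (compression (star a * generator flow_map a))"
      by (intro tendsto_mult[OF tendsto_const] state_compression_tendsto \<omega> tendsto_mult[OF tendsto_star] X)
    show ?thesis
      by (rule closed_sequentially[OF closed_nonneg_Reals_complex _ lim]) (rule nonneg)
  qed
  then show ?thesis using compression_state[OF \<omega>] by (simp add: ground_states_def)
qed

lemma unit_eq_star_mult:
  assumes "(\<mu>, \<nu>) \<in> unit_indices Br v0 n"
  shows "E \<nu> \<nu> = star (E \<mu> \<nu>) * E \<mu> \<nu>"
  using assms units_star[OF assms] units_mult[of \<nu> \<mu> n \<mu> \<nu>] by (simp add: mem_unit_indices)

lemma state_unit_nonneg:
  assumes "\<omega> \<in> state_space" "\<mu> \<in> paths Br v0 n"
  shows "\<omega> (E \<mu> \<mu>) \<in> \<real>\<^sub>\<ge>\<^sub>0"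
proof -
  have "E \<mu> \<mu> = star (E \<mu> \<mu>) * E \<mu> \<mu>"
    using assms(2) by (intro unit_eq_star_mult) (simp add: mem_unit_indices)
  then show ?thesis using state_nonneg[OF assms(1), of "E \<mu> \<mu>"] by simp
qed

text \<open>
  A path of positive weight has minimal potential, since otherwise the matrix unit that moves it to
  a path of smaller potential violates the ground state condition.  As the weight of a path is the
  sum of the weights of its extensions, these paths form a tree without leaves.
\<close>

lemma ground_state_vanishes:
  assumes \<phi>: "\<phi> \<in> ground_states flow_map" and \<mu>: "\<mu> \<in> paths Br v0 n" "\<mu> \<notin> G n"
  shows "\<phi> (E \<mu> \<mu>) = 0"
proof (rule ccontr)
  assume nonzero: "\<phi> (E \<mu> \<mu>) \<noteq> 0"
  have state: "\<phi> \<in> state_space" using \<phi> by (simp add: ground_states_def)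
  define S where "S = {\<mu>. \<mu> \<in> paths Br v0 (length \<mu>) \<and> \<phi> (E \<mu> \<mu>) \<noteq> 0}"
  have pos: "Re (\<phi> (E \<mu> \<mu>)) > 0" "\<phi> (E \<mu> \<mu>) = of_real (Re (\<phi> (E \<mu> \<mu>)))" if "\<mu> \<in> S" for \<mu>
    using state_unit_nonneg[OF state, of \<mu>] that
    by (auto simp: S_def complex_nonneg_Reals_iff complex_eq_iff less_le)
  have min_S: "minimal F \<mu>" if \<mu>: "\<mu> \<in> S" for \<mu>
    unfolding minimal_def
  proof (intro conjI ballI impI)
    show "\<mu> \<in> paths Br v0 (length \<mu>)" using \<mu> by (simp add: S_def)
    fix \<nu> assume \<nu>: "\<nu> \<in> paths Br v0 (length \<mu>)" "path_range Br v0 \<nu> = path_range Br v0 \<mu>"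
    have idx: "(\<nu>, \<mu>) \<in> unit_indices Br v0 (length \<mu>)" using \<nu> \<mu> by (simp add: mem_unit_indices S_def)
    have "- \<i> * \<phi> (star (E \<nu> \<mu>) * generator flow_map (E \<nu> \<mu>)) \<in> \<real>\<^sub>\<ge>\<^sub>0"
      using \<phi> generator_unit(1)[OF idx] by (simp add: ground_states_def)
    moreover have "- \<i> * \<phi> (star (E \<nu> \<mu>) * generator flow_map (E \<nu> \<mu>)) = of_real (freq \<nu> \<mu>) * \<phi> (E \<mu> \<mu>)"
      unfolding generator_unit(2)[OF idx] mult_scaleC_right state_scaleC[OF state] unit_eq_star_mult[OF idx, symmetric]
      by (simp add: mult.assoc)
    ultimately have "of_real (freq \<nu> \<mu>) * \<phi> (E \<mu> \<mu>) \<in> \<real>\<^sub>\<ge>\<^sub>0" by (simp only:)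
    then have "freq \<nu> \<mu> * Re (\<phi> (E \<mu> \<mu>)) \<ge> 0"
      by (simp add: complex_nonneg_Reals_iff)
    then show "path_potential F \<mu> \<le> path_potential F \<nu>"
      using pos(1)[OF \<mu>] by (simp add: freq_def zero_le_mult_iff)
  qed
  have split: "\<phi> (E \<mu> \<mu>) = (\<Sum>a\<in>out_arcs Br (path_range Br v0 \<mu>). \<phi> (E (\<mu> @ [a]) (\<mu> @ [a])))"
    if "\<mu> \<in> paths Br v0 (length \<mu>)" for \<mu>
  proof -
    have "E \<mu> \<mu> = (\<Sum>a\<in>out_arcs Br (path_range Br v0 \<mu>). E (\<mu> @ [a]) (\<mu> @ [a]))"
      using that by (intro units_refine[of \<mu> \<mu> "length \<mu>"]) (simp add: mem_unit_indices)
    then have "\<phi> (E \<mu> \<mu>) = \<phi> (\<Sum>a\<in>out_arcs Br (path_range Br v0 \<mu>). E (\<mu> @ [a]) (\<mu> @ [a]))"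
      by (rule arg_cong)
    then show ?thesis unfolding state_sum[OF state] .
  qed
  have ext: "\<mu> @ [a] \<in> paths Br v0 (Suc (length \<mu>))"
    if "\<mu> \<in> paths Br v0 (length \<mu>)" "a \<in> out_arcs Br (path_range Br v0 \<mu>)" for \<mu> a
    using that by (simp add: snoc_in_paths)
  have prefix_S: "\<mu> \<in> S" if \<mu>a: "\<mu> @ [a] \<in> S" for \<mu> a
  proof -
    have \<mu>: "\<mu> \<in> paths Br v0 (length \<mu>)" and a: "a \<in> out_arcs Br (path_range Br v0 \<mu>)"
      using \<mu>a by (simp_all add: S_def snoc_in_paths)
    have "0 < Re (\<phi> (E (\<mu> @ [a]) (\<mu> @ [a])))" by (rule pos(1)[OF \<mu>a])
    also have "\<dots> \<le> (\<Sum>a\<in>out_arcs Br (path_range Br v0 \<mu>). Re (\<phi> (E (\<mu> @ [a]) (\<mu> @ [a]))))"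
      using a state_unit_nonneg[OF state ext[OF \<mu>]] emits_finite[OF path_range_in_verts[OF \<mu>]]
      by (intro member_le_sum) (auto simp: complex_nonneg_Reals_iff)
    also have "\<dots> = Re (\<phi> (E \<mu> \<mu>))" by (simp add: split[OF \<mu>])
    finally show ?thesis using \<mu> by (auto simp: S_def)
  qed
  have extend_S: "\<exists>a. \<mu> @ [a] \<in> S" if "\<mu> \<in> S" for \<mu>
  proof -
    have \<mu>: "\<mu> \<in> paths Br v0 (length \<mu>)" "\<phi> (E \<mu> \<mu>) \<noteq> 0" using that by (simp_all add: S_def)
    then obtain a where "a \<in> out_arcs Br (path_range Br v0 \<mu>)" "\<phi> (E (\<mu> @ [a]) (\<mu> @ [a])) \<noteq> 0"
      unfolding split[OF \<mu>(1)] using sum.not_neutral_contains_not_neutral by blast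
    then have "\<mu> @ [a] \<in> S" using ext[OF \<mu>(1)] by (simp add: S_def)
    then show ?thesis by blast
  qed
  have "length \<mu> = n" using \<mu>(1) by (rule length_paths)
  then have "\<mu> \<in> S" using \<mu>(1) nonzero by (simp add: S_def)
  from geodesics_through_tree[OF min_S prefix_S extend_S this] show False
    using \<mu>(2) \<open>length \<mu> = n\<close> by simp
qed

text \<open>
  By the Cauchy-Schwarz inequality \<open>\<phi>\<close> vanishes on every unit outside the corners of the geodesic
  paths, so \<open>\<phi>\<close> is bounded by the norm of the compression and descends along the surjection
  \<open>compression\<close>.  Lifts are chosen in the fixed point algebra, where \<open>compression\<close> is multiplicative,
  to obtain positivity.
\<close>

lemma state_factors_through_compression:
  assumes \<phi>: "\<phi> \<in> state_space"
    and zero: "\<And>n \<mu>. \<mu> \<in> paths Br v0 n \<Longrightarrow> \<mu> \<notin> G n \<Longrightarrow> \<phi> (E \<mu> \<mu>) = 0"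
  obtains \<omega> where "\<omega> \<in> state_space" "\<phi> = \<omega> \<circ> compression"
proof -
  have unit_zero: "\<phi> (E \<mu> \<nu>) = 0" if *: "(\<mu>, \<nu>) \<in> unit_indices Br v0 n" "\<not> (\<mu> \<in> G n \<and> \<nu> \<in> G n)" for n \<mu> \<nu>
  proof -
    have \<mu>\<mu>: "(\<mu>, \<mu>) \<in> unit_indices Br v0 n" using *(1) by (simp add: mem_unit_indices)
    have "E \<mu> \<nu> = star (E \<mu> \<mu>) * E \<mu> \<nu>"
      using units_star[OF \<mu>\<mu>] units_mult[OF \<mu>\<mu> *(1)] by simp
    then have "(cmod (\<phi> (E \<mu> \<nu>)))\<^sup>2 \<le> Re (\<phi> (star (E \<mu> \<mu>) * E \<mu> \<mu>)) * Re (\<phi> (star (E \<mu> \<nu>) * E \<mu> \<nu>))"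
      using state_Cauchy_Schwarz[OF \<phi>, of "E \<mu> \<mu>" "E \<mu> \<nu>"] by simp
    also have "\<dots> = Re (\<phi> (E \<mu> \<mu>)) * Re (\<phi> (E \<nu> \<nu>))"
      by (simp only: unit_eq_star_mult[OF \<mu>\<mu>, symmetric] unit_eq_star_mult[OF *(1), symmetric])
    also have "\<dots> = 0" using zero[of \<mu> n] zero[of \<nu> n] * by (auto simp: mem_unit_indices)
    finally show ?thesis by simp
  qed
  have "\<phi> (uc E n c) = \<phi> (uc' E n c)" for n c
  proof -
    have "\<phi> (uc E n d) = (\<Sum>p\<in>unit_indices Br v0 n. d (fst p) (snd p) * \<phi> (E (fst p) (snd p)))" for d
      by (simp add: unit_combination_def case_prod_unfold state_sum[OF \<phi>] state_scaleC[OF \<phi>])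
    then show ?thesis
      unfolding uc'_eq_uc by (auto intro!: sum.cong simp: unit_zero)
  qed
  then have le_uc: "cmod (\<phi> (uc E n c)) \<le> norm (compression (uc E n c))" for n c
    using state_norm_le[OF \<phi>, of "uc' E n c"] by (simp add: compression_uc norm_uc'_eq)
  have le: "cmod (\<phi> x) \<le> norm (compression x)" for x
  proof -
    obtain n c where X: "(\<lambda>k. uc E (n k) (c k)) \<longlonglongrightarrow> x" by (rule AF_sequence)
    show ?thesis
      using tendsto_norm[OF state_tendsto[OF \<phi> X]]
        tendsto_norm[OF linear_contraction_tendsto[OF linear_contraction_compression X]]
      by (rule LIMSEQ_le) (auto intro: le_uc)
  qed
  define lift where "lift b = (SOME a. a \<in> Fix \<and> compression a = b)" for b
  have lift: "lift b \<in> Fix \<and> compression (lift b) = b" for b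
    unfolding lift_def by (rule someI_ex) (use compression_surj[of b] in blast)
  have \<phi>_eq: "\<phi> x = \<phi> y" if "compression x = compression y" for x y
    using le[of "x - y"] that
    by (simp add: state_diff[OF \<phi>] linear_contraction_diff[OF linear_contraction_compression])
  define \<omega> where "\<omega> b = \<phi> (lift b)" for b
  have \<omega>: "\<omega> (compression x) = \<phi> x" for x
    unfolding \<omega>_def by (rule \<phi>_eq) (simp add: lift)
  note lin = linear_contraction_add[OF linear_contraction_compression]
    linear_contraction_scaleC[OF linear_contraction_compression]
  have "\<omega> (x + y) = \<omega> x + \<omega> y" for x y
    using \<omega>[of "lift x + lift y"] by (simp add: lin lift state_add[OF \<phi>] \<omega>_def)
  moreover have "\<omega> (c *\<^sub>C x) = c * \<omega> x" for c x
    using \<omega>[of "c *\<^sub>C lift x"] by (simp add: lin lift state_scaleC[OF \<phi>] \<omega>_def)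
  moreover have "\<omega> (star x * x) \<in> \<real>\<^sub>\<ge>\<^sub>0" for x
    using \<omega>[of "star (lift x) * lift x"] state_nonneg[OF \<phi>, of "lift x"] lift[of x]
    by (simp add: compression_mult compression_star Fix_star)
  moreover have "\<omega> 1 = 1"
    using \<omega>[of 1] by (simp add: compression_one state_one[OF \<phi>])
  ultimately have "\<omega> \<in> state_space" by (simp add: state_space_def)
  moreover have "\<phi> = \<omega> \<circ> compression" by (simp add: fun_eq_iff \<omega>)
  ultimately show ?thesis by (rule that)
qed

lemma ground_states_eq:
  "ground_states flow_map =
    state_space \<inter> {\<phi>. \<forall>n. \<forall>\<mu>\<in>paths Br v0 n. \<mu> \<notin> G n \<longrightarrow> \<phi> (E \<mu> \<mu>) = 0}" (is "?L = ?R")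
proof (intro equalityI subsetI)
  fix \<phi> assume "\<phi> \<in> ?L"
  then show "\<phi> \<in> ?R" using ground_state_vanishes by (auto simp: ground_states_def)
next
  fix \<phi> assume "\<phi> \<in> ?R"
  then obtain \<omega> where "\<omega> \<in> state_space" "\<phi> = \<omega> \<circ> compression"
    using state_factors_through_compression[of \<phi>] by blast
  then show "\<phi> \<in> ?L" using compression_ground_state by simp
qed

lemma ground_states_image: "(\<lambda>\<omega>. \<omega> \<circ> compression) ` state_space = ground_states flow_map"
proof (intro equalityI subsetI)
  fix \<phi> assume "\<phi> \<in> ground_states flow_map"
  then obtain \<omega> where "\<omega> \<in> state_space" "\<phi> = \<omega> \<circ> compression"
    unfolding ground_states_eq using state_factors_through_compression[of \<phi>] by blast
  then show "\<phi> \<in> (\<lambda>\<omega>. \<omega> \<circ> compression) ` state_space" by blast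
qed (use compression_ground_state in blast)

lemma closedin_ground_states: "closedin (top_of_set state_space) (ground_states flow_map)"
  unfolding ground_states_eq
proof (rule closedin_closed_Int)
  show "closed {\<phi>::'a \<Rightarrow> complex. \<forall>n. \<forall>\<mu>\<in>paths Br v0 n. \<mu> \<notin> G n \<longrightarrow> \<phi> (E \<mu> \<mu>) = 0}"
    unfolding Ball_def
    by (intro closed_Collect_all closed_Collect_imp open_Collect_const closed_Collect_eq
        continuous_on_product_coordinates continuous_on_const)
qed

text \<open>
  The conditions \<open>\<phi> (E \<mu> \<mu>) = 0\<close> concern nonnegative numbers, so they pass from a proper convex
  combination to both of its ends.
\<close>

lemma ground_states_face: "ground_states flow_map face_of state_space"
  unfolding face_of_def
proof (intro conjI ballI impI)
  show "ground_states flow_map \<subseteq> state_space" by (auto simp: ground_states_def)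
  show "convex (ground_states flow_map)"
    unfolding convex_def
  proof (intro ballI allI impI)
    fix \<phi> \<psi> and u v :: real
    assume *: "\<phi> \<in> ground_states flow_map" "\<psi> \<in> ground_states flow_map" "0 \<le> u" "0 \<le> v" "u + v = 1"
    then have "u *\<^sub>R \<phi> + v *\<^sub>R \<psi> \<in> state_space"
      by (intro state_space_convex) (auto simp: ground_states_def)
    then show "u *\<^sub>R \<phi> + v *\<^sub>R \<psi> \<in> ground_states flow_map"
      using * unfolding ground_states_eq by (simp add: plus_fun_def scaleR_fun_def)
  qed
  fix \<phi> \<psi> \<xi>
  assume states: "\<phi> \<in> state_space" "\<psi> \<in> state_space" and \<xi>: "\<xi> \<in> ground_states flow_map" "\<xi> \<in> open_segment \<phi> \<psi>"
  obtain u where u: "0 < u" "u < 1" "\<xi> = (1 - u) *\<^sub>R \<phi> + u *\<^sub>R \<psi>"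
    using \<xi>(2) unfolding in_segment by blast
  have "\<phi> (E \<mu> \<mu>) = 0 \<and> \<psi> (E \<mu> \<mu>) = 0" if \<mu>: "\<mu> \<in> paths Br v0 n" "\<mu> \<notin> G n" for n \<mu>
  proof -
    have "\<xi> (E \<mu> \<mu>) = 0" using \<xi>(1) \<mu> unfolding ground_states_eq by blast
    then have "(1 - u) *\<^sub>R \<phi> (E \<mu> \<mu>) + u *\<^sub>R \<psi> (E \<mu> \<mu>) = 0"
      by (simp add: u(3) plus_fun_def scaleR_fun_def)
    then have "(1 - u) * Re (\<phi> (E \<mu> \<mu>)) + u * Re (\<psi> (E \<mu> \<mu>)) = 0"
      by (metis plus_complex.sel(1) scaleR_complex.sel(1) zero_complex.sel(1))
    moreover have nn: "Re (\<phi> (E \<mu> \<mu>)) \<ge> 0" "Im (\<phi> (E \<mu> \<mu>)) = 0" "Re (\<psi> (E \<mu> \<mu>)) \<ge> 0" "Im (\<psi> (E \<mu> \<mu>)) = 0"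
      using state_unit_nonneg[OF states(1) \<mu>(1)] state_unit_nonneg[OF states(2) \<mu>(1)]
      by (simp_all add: complex_nonneg_Reals_iff)
    ultimately have "(1 - u) * Re (\<phi> (E \<mu> \<mu>)) = 0 \<and> u * Re (\<psi> (E \<mu> \<mu>)) = 0"
      using u by (intro add_nonneg_eq_0_iff[THEN iffD1]) auto
    then show ?thesis using u nn by (simp add: complex_eq_iff)
  qed
  then show "\<phi> \<in> ground_states flow_map" "\<psi> \<in> ground_states flow_map"
    unfolding ground_states_eq using states by blast+
qed

text \<open>
  Evaluation at \<open>b\<close> of the state with image \<open>\<phi>\<close> is evaluation of \<open>\<phi>\<close> at a preimage of \<open>b\<close>, so the
  inverse of the composition with a surjection is continuous for pointwise convergence.
\<close>

lemma homeomorphic_map_ground_states: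
  "homeomorphic_map (top_of_set state_space) (top_of_set (ground_states flow_map)) (\<lambda>\<omega>. \<omega> \<circ> compression)"
proof -
  define lift where "lift b = (SOME a. compression a = b)" for b
  have lift: "compression (lift b) = b" for b
    unfolding lift_def by (rule someI_ex) (use compression_surj[of b] in blast)
  have comp_lift: "\<omega> \<circ> compression \<circ> lift = \<omega>" for \<omega> :: "'b \<Rightarrow> complex"
    by (simp add: fun_eq_iff lift)
  have "homeomorphic_maps (top_of_set state_space) (top_of_set (ground_states flow_map))
      (\<lambda>\<omega>. \<omega> \<circ> compression) (\<lambda>\<phi>. \<phi> \<circ> lift)"
    unfolding homeomorphic_maps_def
  proof (intro conjI ballI)
    show "continuous_map (top_of_set state_space) (top_of_set (ground_states flow_map)) (\<lambda>\<omega>. \<omega> \<circ> compression)"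
      by (rule continuous_map_precompose) (rule compression_ground_state)
    have "\<phi> \<circ> lift \<in> state_space" if "\<phi> \<in> ground_states flow_map" for \<phi>
      using that unfolding ground_states_image[symmetric] by (elim imageE) (simp add: comp_lift)
    then show "continuous_map (top_of_set (ground_states flow_map)) (top_of_set state_space) (\<lambda>\<phi>. \<phi> \<circ> lift)"
      by (rule continuous_map_precompose)
    show "\<omega> \<circ> compression \<circ> lift = \<omega>" if "\<omega> \<in> topspace (top_of_set state_space)" for \<omega>
      by (rule comp_lift)
    fix \<phi> assume "\<phi> \<in> topspace (top_of_set (ground_states flow_map))"
    then show "\<phi> \<circ> lift \<circ> compression = \<phi>"
      unfolding topspace_subtopology topspace_euclidean Int_UNIV_left ground_states_image[symmetric]
      by (elim imageE) (simp add: comp_lift)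
  qed
  then show ?thesis unfolding homeomorphic_map_maps by blast
qed

end

theorem theorem2p4:
  fixes Br :: "('v, 'e) pre_digraph" and level :: "nat \<Rightarrow> 'v set" and v0 :: 'v
    and F :: "'e \<Rightarrow> real"
    and E :: "'e list \<Rightarrow> 'e list \<Rightarrow> 'a::cstar_algebra"
    and E' :: "'e list \<Rightarrow> 'e list \<Rightarrow> 'b::cstar_algebra"
  assumes "bratteli_diagram Br level v0"
    and "AF_algebra Br v0 E"
    and "AF_algebra (geodesic_subdiagram Br v0 F) v0 E'"
  shows "closedin (top_of_set state_space) (ground_states (gauge_action Br v0 E F))
    \<and> ground_states (gauge_action Br v0 E F) face_of state_space
    \<and> homeomorphic_map (top_of_set state_space)
        (top_of_set (ground_states (gauge_action Br v0 E F)))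
        (\<lambda>\<omega>::'b \<Rightarrow> complex. \<omega> \<circ> geodesic_map Br v0 E E' F)
    \<and> (\<forall>\<omega>\<^sub>1 \<in> state_space. \<forall>\<omega>\<^sub>2 \<in> state_space. \<forall>t \<in> {0..1}.
        ((1 - t) *\<^sub>R \<omega>\<^sub>1 + t *\<^sub>R \<omega>\<^sub>2) \<circ> geodesic_map Br v0 E E' F =
          (1 - t) *\<^sub>R (\<omega>\<^sub>1 \<circ> geodesic_map Br v0 E E' F) +
          t *\<^sub>R (\<omega>\<^sub>2 \<circ> geodesic_map Br v0 E E' F))"
proof -
  interpret geodesic_system Br level v0 E F E'
    using assms by (intro geodesic_system.intro gauge_system.intro bratteli_AF.intro)
  show ?thesis
    unfolding gauge_action_eq geodesic_map_eq
    using closedin_ground_states ground_states_face homeomorphic_map_ground_states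
    by (simp add: fun_eq_iff plus_fun_def scaleR_fun_def)
qed

end
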